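(* Let $G$ be a $(C_4,2K_2)$-free finite simple graph on the vertices $x_1,\dots,x_n$, let $\Bbbk$ be a field, and let $I(G)^{\vee}\subset \Bbbk[x_1,\dots,x_n]$ be the vertex cover ideal of $G$. Then for each $s\geq 1$, $$\operatorname{reg}\big((I(G)^{\vee})^s\big)=\begin{cases}3s & \text{if } G \text{ is the disjoint union of a 5-cycle } C_5 \text{ and a (possibly empty) set of isolated vertices},\\ s\,\Delta(G) & \text{otherwise,}\end{cases}$$ where $\Delta(G)$ is the maximum degree of $G$.
   Context: All graphs are finite and simple. $C_n$ denotes the cycle on $n$ vertices, and $2K_2$ denotes the complement graph of $C_4$ (two disjoint edges). A graph is $(C_4,2K_2)$-free if it has no induced subgraph isomorphic to $C_4$ and no induced subgraph isomorphic to $2K_2$. A vertex is isolated if it has no neighbors. The degree of a vertex is the number of its neighbors, and $\Delta(G)$ is the maximum of the degrees of the vertices of $G$. A set $C$ of vertices of $G$ is a vertex cover if every edge of $G$ contains a vertex of $C$; it is minimal if no proper subset of $C$ is a vertex cover. The vertex cover ideal of $G$ is $I(G)^{\vee}=(x_{i_1}\cdots x_{i_k} : \{x_{i_1},\dots,x_{i_k}\}\text{ is a minimal vertex cover of }G)\subset S=\Bbbk[x_1,\dots,x_n]$ (the empty product being $1$). For a monomial ideal $I\subset S$ (with $S$ standard graded), the Castelnuovo-Mumford regularity is $\operatorname{reg}(I)=\max\{j-i : b_{i,j}(I)\neq 0\}$, where $b_{i,j}(I)$ are the graded Betti numbers of $I$. *)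

theory Defs
  imports
    Main
    "HOL-Library.Poly_Mapping"
    "Jordan_Normal_Form.Matrix"
    "Jordan_Normal_Form.Matrix_Kernel"
begin

section \<open>Simple graphs\<close>

text \<open>A graph is given by a vertex set \<open>V\<close> and a set \<open>E\<close> of two-element subsets of \<open>V\<close>.\<close>

definition simple_graph :: "'v set \<Rightarrow> 'v set set \<Rightarrow> bool" where
  "simple_graph V E \<longleftrightarrow> finite V \<and> (\<forall>e\<in>E. e \<subseteq> V \<and> card e = 2)"

definition induced_edges :: "'v set set \<Rightarrow> 'v set \<Rightarrow> 'v set set" where
  "induced_edges E U = {e \<in> E. e \<subseteq> U}"

definition complement_edges :: "'v set \<Rightarrow> 'v set set \<Rightarrow> 'v set set" where
  "complement_edges V E = {e. e \<subseteq> V \<and> card e = 2 \<and> e \<notin> E}"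

definition graph_isomorphic :: "'v set \<Rightarrow> 'v set set \<Rightarrow> 'w set \<Rightarrow> 'w set set \<Rightarrow> bool" where
  "graph_isomorphic V E W F \<longleftrightarrow>
     (\<exists>f. bij_betw f V W \<and> (\<forall>a\<in>V. \<forall>b\<in>V. {a, b} \<in> E \<longleftrightarrow> {f a, f b} \<in> F))"

text \<open>\<open>(V, E)\<close> has no induced subgraph isomorphic to \<open>(W, F)\<close>.\<close>

definition induced_free :: "'v set \<Rightarrow> 'v set set \<Rightarrow> 'w set \<Rightarrow> 'w set set \<Rightarrow> bool" where
  "induced_free V E W F \<longleftrightarrow>
     \<not> (\<exists>U \<subseteq> V. graph_isomorphic U (induced_edges E U) W F)"

text \<open>The edges of the cycle \<open>C\<^sub>n\<close> on the vertex set \<open>{..<n}\<close>, for \<open>n \<ge> 3\<close>.\<close>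

definition cycle_edges :: "nat \<Rightarrow> nat set set" where
  "cycle_edges n = {{i, (i + 1) mod n} |i. i < n}"

definition C4_2K2_free :: "'v set \<Rightarrow> 'v set set \<Rightarrow> bool" where
  "C4_2K2_free V E \<longleftrightarrow>
     induced_free V E {..<4} (cycle_edges 4) \<and>
     induced_free V E {..<4} (complement_edges {..<4} (cycle_edges 4))"

definition neighbors :: "'v set set \<Rightarrow> 'v \<Rightarrow> 'v set" where
  "neighbors E v = {w. {v, w} \<in> E}"

definition max_degree :: "'v set \<Rightarrow> 'v set set \<Rightarrow> nat" where
  "max_degree V E = Max ((\<lambda>v. card (neighbors E v)) ` V)"

text \<open>As the vertices outside \<open>U\<close> have no neighbors, all edges lie in \<open>U\<close>.\<close>

definition C5_plus_isolated :: "'v set \<Rightarrow> 'v set set \<Rightarrow> bool" where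
  "C5_plus_isolated V E \<longleftrightarrow>
     (\<exists>U \<subseteq> V. graph_isomorphic U (induced_edges E U) {..<5} (cycle_edges 5) \<and>
              (\<forall>v \<in> V - U. neighbors E v = {}))"

definition vertex_cover :: "'v set \<Rightarrow> 'v set set \<Rightarrow> 'v set \<Rightarrow> bool" where
  "vertex_cover V E C \<longleftrightarrow> C \<subseteq> V \<and> (\<forall>e\<in>E. e \<inter> C \<noteq> {})"

definition minimal_vertex_cover :: "'v set \<Rightarrow> 'v set set \<Rightarrow> 'v set \<Rightarrow> bool" where
  "minimal_vertex_cover V E C \<longleftrightarrow>
     vertex_cover V E C \<and> (\<forall>D. D \<subset> C \<longrightarrow> \<not> vertex_cover V E D)"


section \<open>The polynomial ring and its ideals\<close>

text \<open>The variables are indexed by a finite type \<open>'v\<close>.\<close>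

type_synonym ('v, 'k) mpoly = "('v \<Rightarrow>\<^sub>0 nat) \<Rightarrow>\<^sub>0 'k"

definition Var :: "'v \<Rightarrow> ('v, 'k::field) mpoly" where
  "Var v = Poly_Mapping.single (Poly_Mapping.single v 1) 1"

text \<open>The zero polynomial is homogeneous of every degree. Degrees are integers because the entries
  of the matrices below have differences of shifts as degrees.\<close>

definition homogeneous :: "int \<Rightarrow> ('v::finite, 'k::field) mpoly \<Rightarrow> bool" where
  "homogeneous d p \<longleftrightarrow>
     (\<forall>m \<in> Poly_Mapping.keys p. int (\<Sum>v\<in>UNIV. Poly_Mapping.lookup m v) = d)"

definition ideal_generated :: "'a::comm_ring_1 set \<Rightarrow> 'a set" where
  "ideal_generated B = module.span (*) B"

definition ideal_power :: "'a::comm_ring_1 set \<Rightarrow> nat \<Rightarrow> 'a set" where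
  "ideal_power I s = ideal_generated {\<Prod>i<s. f i |f. \<forall>i<s. f i \<in> I}"

definition cover_ideal :: "'v::finite set set \<Rightarrow> ('v, 'k::field) mpoly set" where
  "cover_ideal E = ideal_generated {\<Prod>v\<in>C. Var v |C. minimal_vertex_cover UNIV E C}"


section \<open>Graded Betti numbers and regularity\<close>

text \<open>
  A minimal graded free resolution \<open>\<dots> \<rightarrow> F\<^sub>1 \<rightarrow> F\<^sub>0 \<rightarrow> I \<rightarrow> 0\<close> over the polynomial ring \<open>S\<close>:
  \<^item> \<open>d i\<close> is the list of the degrees of the basis elements of \<open>F\<^sub>i\<close>, so \<open>F\<^sub>i\<close> is the direct sum of
    the modules \<open>S(-d i ! k)\<close> for \<open>k < length (d i)\<close>;
  \<^item> \<open>g\<close> is the vector of the images of the basis elements of \<open>F\<^sub>0\<close> in \<open>I\<close>;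
  \<^item> \<open>D i\<close> is the matrix of the differential from \<open>F\<^sub>i\<^sub>+\<^sub>1\<close> to \<open>F\<^sub>i\<close>.

  The maps are graded of degree zero. Minimality says that the differentials map each free module
  into the multiple of the next one by the ideal generated by the variables.
\<close>

definition minimal_graded_free_resolution ::
  "('v::finite, 'k::field) mpoly set \<Rightarrow> (nat \<Rightarrow> int list) \<Rightarrow> ('v, 'k) mpoly vec \<Rightarrow>
    (nat \<Rightarrow> ('v, 'k) mpoly mat) \<Rightarrow> bool" where
  "minimal_graded_free_resolution I d g D \<longleftrightarrow>
     g \<in> carrier_vec (length (d 0)) \<and>
     (\<forall>i. D i \<in> carrier_mat (length (d i)) (length (d (Suc i)))) \<and>
     (\<forall>k < length (d 0). homogeneous (d 0 ! k) (g $ k)) \<and>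
     (\<forall>i. \<forall>k < length (d i). \<forall>l < length (d (Suc i)).
        homogeneous (d (Suc i) ! l - d i ! k) (D i $$ (k, l))) \<and>
     {g \<bullet> u |u. u \<in> carrier_vec (length (d 0))} = I \<and>
     {u \<in> carrier_vec (length (d 0)). g \<bullet> u = 0} =
       {D 0 *\<^sub>v w |w. w \<in> carrier_vec (length (d 1))} \<and>
     (\<forall>i. mat_kernel (D i) =
        {D (Suc i) *\<^sub>v w |w. w \<in> carrier_vec (length (d (Suc (Suc i))))}) \<and>
     (\<forall>i. \<forall>k < length (d i). \<forall>l < length (d (Suc i)).
        D i $$ (k, l) \<in> ideal_generated (range Var))"

text \<open>The choice below does not depend on the resolution, since minimal graded free resolutions
  exist for homogeneous ideals and are unique up to graded isomorphism.\<close>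

definition graded_betti :: "('v::finite, 'k::field) mpoly set \<Rightarrow> nat \<Rightarrow> int \<Rightarrow> nat" where
  "graded_betti I i j =
     (SOME b. \<exists>d g D. minimal_graded_free_resolution I d g D \<and> b = count_list (d i) j)"

text \<open>Intended for nonzero homogeneous ideals, for which the set is finite and nonempty.\<close>

definition regularity :: "('v::finite, 'k::field) mpoly set \<Rightarrow> int" where
  "regularity I = Max {j - int i |i j. graded_betti I i j \<noteq> 0}"

end

(* A (C4, 2K2)-free graph consists of a clique K, an independent set and possibly an induced 5-cycle
   that is complete to K and anticomplete to the independent set. Hence its minimal vertex covers are
   the neighborhoods of the vertices of K and the sets K + B, where B is empty (no 5-cycle) or one of
   the five minimal covers of the cycle. The s-fold products of the corresponding monomials, ordered
   by degree, then by the number of neighborhoods used, then lexicographically by the covers of the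
   cycle, have linear quotients with nondecreasing degrees. Adding such generators one at a time by
   mapping cones gives a minimal resolution in which j - i runs through the degrees of the
   generators, so the regularity is their largest degree. *)

theory Submission
  imports Defs
    "HOL-Library.Product_Lexorder"
begin

section \<open>Monomials and homogeneous components\<close>

text \<open>The Betti numbers are those of some chosen minimal resolution, so a constructed
  resolution has to be compared with an arbitrary one. The regularity only depends on which degrees
  occur in each homological position, and for this it suffices to lift the identity in both
  directions: the composite is the identity up to entries without constant term.

  The order of the generators answers two demands. The mapping cone is minimal if the new generator
  has at least the degree of the old ones, so the degree comes first. A neighborhood of a vertex
  \<open>v\<close> of K can be traded for K + B at the cost of the single variable \<open>v\<close>.
  This never raises the degree but may preserve it, so the number of neighborhoods breaks ties.
  Conversely, the exponent of \<open>v\<close> in a product of \<open>s\<close> covers is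
  \<open>s\<close> minus the multiplicity of its neighborhood, so these variables detect different
  multiplicities.

  The constant 3 is the size of a minimal cover of the 5-cycle. If K is empty, all generators have
  degree \<open>3 * s\<close> although the maximum degree is 2. If K is nonempty, the neighborhoods
  are at least as large as the covers K + B, and the maximum degree is attained in K.\<close>

interpretation ideal: module "(*) :: 'a::comm_ring_1 \<Rightarrow> 'a \<Rightarrow> 'a"
  by unfold_locales (auto simp: algebra_simps)

text \<open>For the ring as a module over itself this rule is associativity, oriented against the
  usual normal form of products.\<close>

declare ideal.scale_scale [simp del]

lemma ideal_generated_span: "ideal_generated B = ideal.span B"
  by (simp add: ideal_generated_def)

abbreviation xpow :: "('v \<Rightarrow>\<^sub>0 nat) \<Rightarrow> ('v, 'k::field) mpoly" where
  "xpow t \<equiv> Poly_Mapping.single t 1"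

definition mdeg :: "('v::finite \<Rightarrow>\<^sub>0 nat) \<Rightarrow> int" where
  "mdeg t = int (\<Sum>v\<in>UNIV. Poly_Mapping.lookup t v)"

lemma mdeg_zero [simp]: "mdeg 0 = 0"
  by (simp add: mdeg_def)

lemma mdeg_add [simp]: "mdeg (s + t) = mdeg s + mdeg t"
  by (simp add: mdeg_def lookup_add sum.distrib)

lemma homogeneous_iff: "homogeneous d p \<longleftrightarrow> (\<forall>t\<in>Poly_Mapping.keys p. mdeg t = d)"
  by (simp add: homogeneous_def mdeg_def)

lemma sum_monomials:
  fixes p :: "'a \<Rightarrow>\<^sub>0 'b::comm_monoid_add"
  shows "(\<Sum>t\<in>Poly_Mapping.keys p. Poly_Mapping.single t (Poly_Mapping.lookup p t)) = p"
  by (rule poly_mapping_eqI)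
    (simp add: lookup_sum lookup_single when_def in_keys_iff)

text \<open>Polynomials are finite sums of monomials, so identities that are additive in
  \<open>p\<close> can be checked on monomials, without unfolding the convolution product.\<close>

lemma poly_mapping_additive_induct [case_names single add]:
  fixes p :: "'a \<Rightarrow>\<^sub>0 'b::comm_monoid_add"
  assumes "\<And>t c. P (Poly_Mapping.single t c)" and "\<And>p q. P p \<Longrightarrow> P q \<Longrightarrow> P (p + q)"
  shows "P p"
proof -
  have "P (\<Sum>t\<in>A. Poly_Mapping.single t (Poly_Mapping.lookup p t))" if "finite A" for A
    using that
  proof induction
    case empty
    \<comment> \<open>The empty sum is a monomial with coefficient 0.\<close>
    show ?case using assms(1)[of _ 0] by simp
  next
    case (insert a A)
    then show ?case using assms by simp
  qed
  from this[of "Poly_Mapping.keys p"] show ?thesis by (simp add: sum_monomials)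
qed

text \<open>Shifting exponents by \<open>m\<close> is injective, so nothing cancels; for general
  factors only an inclusion of supports holds. The equality makes colon ideals by a monomial
  computable.\<close>

lemma keys_xpow_mult: "Poly_Mapping.keys (p * xpow m) = (\<lambda>t. t + m) ` Poly_Mapping.keys p"
  for m :: "'v \<Rightarrow>\<^sub>0 nat" and p :: "('v, 'k::field) mpoly"
proof -
  have "Poly_Mapping.lookup (p * xpow m) (t + m) = Poly_Mapping.lookup p t" for t
  proof (induction p rule: poly_mapping_additive_induct)
    case (single s c)
    then show ?case by (simp add: mult_single lookup_single)
  qed (simp add: distrib_right lookup_add)
  moreover have "Poly_Mapping.keys (p * xpow m) \<subseteq> (\<lambda>t. t + m) ` Poly_Mapping.keys p"
    using keys_mult[of p "xpow m :: ('v, 'k) mpoly"] by auto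
  ultimately show ?thesis
    by (auto simp: in_keys_iff)
qed

text \<open>This truncation turns an arbitrary solution of a graded linear system into a graded
  one.\<close>

definition hom_comp :: "int \<Rightarrow> ('v::finite, 'k::field) mpoly \<Rightarrow> ('v, 'k) mpoly" where
  "hom_comp d p = Poly_Mapping.mapp (\<lambda>t c. if mdeg t = d then c else 0) p"

lemma lookup_hom_comp:
  "Poly_Mapping.lookup (hom_comp d p) t = (if mdeg t = d then Poly_Mapping.lookup p t else 0)"
  by (auto simp: hom_comp_def lookup_mapp when_def in_keys_iff)

lemma hom_comp_add: "hom_comp d (p + q) = hom_comp d p + hom_comp d q"
  by (rule poly_mapping_eqI) (simp add: lookup_hom_comp lookup_add)

lemma hom_comp_0 [simp]: "hom_comp d 0 = 0"
  by (rule poly_mapping_eqI) (simp add: lookup_hom_comp)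

lemma hom_comp_sum: "hom_comp d (\<Sum>i\<in>A. f i) = (\<Sum>i\<in>A. hom_comp d (f i))"
  by (induction A rule: infinite_finite_induct) (auto simp: hom_comp_add)

lemma homogeneous_hom_comp [simp]: "homogeneous d (hom_comp d p)"
  by (auto simp: homogeneous_iff in_keys_iff lookup_hom_comp split: if_splits)

lemma hom_comp_homogeneous: "homogeneous d p \<Longrightarrow> hom_comp d p = p"
  by (rule poly_mapping_eqI) (auto simp: lookup_hom_comp homogeneous_iff in_keys_iff)

lemma hom_comp_single:
  "hom_comp d (Poly_Mapping.single t c) = (if mdeg t = d then Poly_Mapping.single t c else 0)"
  by (rule poly_mapping_eqI) (auto simp: lookup_hom_comp lookup_single when_def)

text \<open>A homogeneous factor shifts all degrees by the same amount. As both sides are additive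
  in \<open>h\<close> and in \<open>p\<close>, only products of monomials have to be
  compared.\<close>

lemma hom_comp_mult:
  assumes "homogeneous e h"
  shows "hom_comp d (h * p) = h * hom_comp (d - e) p"
proof -
  have single: "hom_comp d (Poly_Mapping.single t c * p) =
      Poly_Mapping.single t c * hom_comp (d - e) p" if "mdeg t = e" for t c p
  proof (induction p rule: poly_mapping_additive_induct)
    case (single s b)
    then show ?case using that by (auto simp: mult_single hom_comp_single)
  qed (simp add: distrib_left hom_comp_add)
  have "h * q = (\<Sum>t\<in>Poly_Mapping.keys h. Poly_Mapping.single t (Poly_Mapping.lookup h t) * q)" for q
    by (simp add: sum_monomials flip: sum_distrib_right)
  then show ?thesis
    using assms by (simp add: hom_comp_sum homogeneous_iff single)
qed

lemma homogeneous_0 [simp]: "homogeneous d 0"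
  by (simp add: homogeneous_def)

lemma homogeneous_add: "homogeneous d p \<Longrightarrow> homogeneous d q \<Longrightarrow> homogeneous d (p + q)"
  using keys_add[of p q] by (auto simp: homogeneous_iff)

lemma homogeneous_uminus [simp]: "homogeneous d (- p) \<longleftrightarrow> homogeneous d p"
  by (simp add: homogeneous_iff in_keys_iff)

lemma homogeneous_sum: "(\<And>i. i \<in> A \<Longrightarrow> homogeneous d (f i)) \<Longrightarrow> homogeneous d (\<Sum>i\<in>A. f i)"
  by (induction A rule: infinite_finite_induct) (auto simp: homogeneous_add)

lemma homogeneous_mult: "homogeneous d p \<Longrightarrow> homogeneous e q \<Longrightarrow> homogeneous (d + e) (p * q)"
  using keys_mult[of p q] unfolding homogeneous_iff by (auto dest!: subsetD)

lemma homogeneous_one [simp]: "homogeneous 0 1"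
  by (simp add: homogeneous_iff)

lemma homogeneous_xpow: "homogeneous d (xpow t) \<longleftrightarrow> mdeg t = d"
  by (simp add: homogeneous_iff)

section \<open>Constant coefficients and membership in monomial ideals\<close>

abbreviation const_coeff :: "('v, 'k::field) mpoly \<Rightarrow> 'k" where
  "const_coeff p \<equiv> Poly_Mapping.lookup p 0"

text \<open>Exponents are nonnegative, so a constant term of a product arises only from two constant
  terms. Together with additivity this makes \<open>const_coeff\<close> the reduction modulo the
  ideal of the variables.\<close>

lemma const_coeff_mult:
  fixes p q :: "('v, 'k::field) mpoly"
  shows "const_coeff (p * q) = const_coeff p * const_coeff q"
proof (induction p rule: poly_mapping_additive_induct)
  case (single s b)
  show ?case
  proof (induction q rule: poly_mapping_additive_induct)
    case (single t c)
    have "s + t = 0 \<longleftrightarrow> s = 0 \<and> t = 0"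
      by (auto simp: poly_mapping_eq_iff fun_eq_iff lookup_add)
    then show ?case by (auto simp: mult_single lookup_single when_def)
  qed (simp add: distrib_left lookup_add)
qed (simp add: distrib_right lookup_add)

text \<open>Used in both directions: an entry of nonzero degree has no constant term, and an entry
  with a constant term joins basis elements of equal degree.\<close>

lemma homogeneous_const_coeff: "homogeneous d p \<Longrightarrow> const_coeff p \<noteq> 0 \<Longrightarrow> d = 0"
  by (metis homogeneous_iff in_keys_iff mdeg_zero)

lemma mem_monomial_ideal:
  fixes p :: "('v, 'k::field) mpoly"
  shows "p \<in> ideal_generated (xpow ` M) \<longleftrightarrow>
    (\<forall>t\<in>Poly_Mapping.keys p. \<exists>m\<in>M. \<exists>u. t = u + m)" (is "?L \<longleftrightarrow> ?R")
proof
  assume ?L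
  then have "p \<in> ideal.span (xpow ` M)" by (simp add: ideal_generated_span)
  then show ?R
  proof (induction rule: ideal.span_induct_alt)
    case base
    show ?case by simp
  next
    case (step c x y)
    then obtain m where m: "m \<in> M" "x = xpow m" by auto
    show ?case
    proof
      fix t assume "t \<in> Poly_Mapping.keys (c * x + y)"
      then have "t \<in> (\<lambda>u. u + m) ` Poly_Mapping.keys c \<or> t \<in> Poly_Mapping.keys y"
        using keys_add[of "c * x" y] keys_xpow_mult[of c m] unfolding m(2) by blast
      then show "\<exists>m\<in>M. \<exists>u. t = u + m"
        using step(2) m(1) by blast
    qed
  qed
next
  assume R: ?R
  have "Poly_Mapping.single t (Poly_Mapping.lookup p t) \<in> ideal.span (xpow ` M)"
    if t: "t \<in> Poly_Mapping.keys p" for t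
  proof -
    obtain m u where m: "m \<in> M" "t = u + m" using R t by blast
    have "Poly_Mapping.single t (Poly_Mapping.lookup p t) =
        Poly_Mapping.single u (Poly_Mapping.lookup p t) * xpow m"
      using m by (simp add: mult_single)
    then show ?thesis
      using m(1) by (simp add: ideal.span_base ideal.span_scale)
  qed
  then have "(\<Sum>t\<in>Poly_Mapping.keys p. Poly_Mapping.single t (Poly_Mapping.lookup p t)) \<in> ideal.span (xpow ` M)"
    by (rule ideal.span_sum)
  then show ?L by (simp add: sum_monomials ideal_generated_span)
qed

text \<open>Every nonzero exponent vector is divisible by a variable. The minimality clause of
  resolutions thus becomes a condition on constant coefficients, which behave
  multiplicatively.\<close>

lemma mem_irrelevant_ideal:
  fixes p :: "('v, 'k::field) mpoly"
  shows "p \<in> ideal_generated (range Var) \<longleftrightarrow> const_coeff p = 0"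
proof -
  have *: "(\<exists>v u. t = u + Poly_Mapping.single v 1) \<longleftrightarrow> t \<noteq> 0" for t :: "'v \<Rightarrow>\<^sub>0 nat"
  proof
    assume "t \<noteq> 0"
    then obtain v where v: "Poly_Mapping.lookup t v \<noteq> 0"
      using poly_mapping_eqI[of t 0] by auto
    have "t = (t - Poly_Mapping.single v 1) + Poly_Mapping.single v 1"
      using v by (intro poly_mapping_eqI) (auto simp: lookup_add lookup_minus lookup_single when_def)
    then show "\<exists>v u. t = u + Poly_Mapping.single v 1" by blast
  next
    assume "\<exists>v u. t = u + Poly_Mapping.single v 1"
    then obtain v u where "t = u + Poly_Mapping.single v 1" by blast
    then have "Poly_Mapping.lookup t v \<noteq> 0" by (simp add: lookup_add)
    then show "t \<noteq> 0" by auto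
  qed
  have "range (Var :: 'v \<Rightarrow> ('v, 'k) mpoly) = xpow ` range (\<lambda>v. Poly_Mapping.single v 1)"
    by (auto simp: Var_def)
  then show ?thesis
    using mem_monomial_ideal[of p "range (\<lambda>v. Poly_Mapping.single v 1)"] *
    by (auto simp: in_keys_iff)
qed

section \<open>Graded resolutions\<close>

text \<open>Maps of degree zero between graded free modules: the rows belong to the target with
  basis degrees \<open>a\<close>, the columns to the source with basis degrees
  \<open>b\<close>.\<close>

definition hom_mat :: "int list \<Rightarrow> int list \<Rightarrow> ('v::finite, 'k::field) mpoly mat \<Rightarrow> bool" where
  "hom_mat a b A \<longleftrightarrow> A \<in> carrier_mat (length a) (length b) \<and>
     (\<forall>k<length a. \<forall>l<length b. homogeneous (b ! l - a ! k) (A $$ (k, l)))"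

lemma hom_mat_carrier: "hom_mat a b A \<Longrightarrow> A \<in> carrier_mat (length a) (length b)"
  by (simp add: hom_mat_def)

lemma index_mult_mat_sum:
  assumes "A \<in> carrier_mat n m" "B \<in> carrier_mat m r" "k < n" "l < r"
  shows "(A * B) $$ (k, l) = (\<Sum>j<m. A $$ (k, j) * B $$ (j, l))"
proof -
  have "row A k \<bullet> col B l = (\<Sum>j<m. row A k $ j * col B l $ j)"
    using assms by (simp add: scalar_prod_def atLeast0LessThan)
  also have "\<dots> = (\<Sum>j<m. A $$ (k, j) * B $$ (j, l))"
    using assms by (intro sum.cong) auto
  finally show ?thesis using assms by simp
qed

lemma index_mult_mat_vec_sum:
  assumes "A \<in> carrier_mat n m" "w \<in> carrier_vec m" "k < n"
  shows "(A *\<^sub>v w) $ k = (\<Sum>j<m. A $$ (k, j) * w $ j)"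
proof -
  have "row A k \<bullet> w = (\<Sum>j<m. row A k $ j * w $ j)"
    using assms by (simp add: scalar_prod_def atLeast0LessThan)
  also have "\<dots> = (\<Sum>j<m. A $$ (k, j) * w $ j)"
    using assms by (intro sum.cong) auto
  finally show ?thesis using assms by simp
qed

lemma hom_mat_mult:
  assumes "hom_mat a b A" "hom_mat b c B"
  shows "hom_mat a c (A * B)"
  unfolding hom_mat_def
proof (intro conjI allI impI)
  note car = assms[THEN hom_mat_carrier]
  show "A * B \<in> carrier_mat (length a) (length c)" using car by simp
  fix k l assume kl: "k < length a" "l < length c"
  have "homogeneous (c ! l - a ! k) (A $$ (k, j) * B $$ (j, l))" if "j < length b" for j
  proof -
    have "homogeneous ((b ! j - a ! k) + (c ! l - b ! j)) (A $$ (k, j) * B $$ (j, l))"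
      using assms that kl by (intro homogeneous_mult) (auto simp: hom_mat_def)
    then show ?thesis by simp
  qed
  then show "homogeneous (c ! l - a ! k) ((A * B) $$ (k, l))"
    unfolding index_mult_mat_sum[OF car kl] by (intro homogeneous_sum) simp
qed

text \<open>Solve each column separately and truncate every entry of the solution to the degree it
  should have. A graded \<open>A\<close> commutes with this truncation, and \<open>U\<close> is
  graded already.\<close>

lemma hom_lift:
  assumes A: "hom_mat a b A" and U: "hom_mat a c U"
    and sol: "\<And>l. l < length c \<Longrightarrow> \<exists>w\<in>carrier_vec (length b). A *\<^sub>v w = col U l"
  obtains W where "hom_mat b c W" "A * W = U"
proof -
  obtain w where w: "\<And>l. l < length c \<Longrightarrow> w l \<in> carrier_vec (length b) \<and> A *\<^sub>v w l = col U l"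
    using sol by metis
  define W where "W = mat (length b) (length c) (\<lambda>(j, l). hom_comp (c ! l - b ! j) (w l $ j))"
  have W: "hom_mat b c W" by (simp add: W_def hom_mat_def)
  note car = A[THEN hom_mat_carrier] U[THEN hom_mat_carrier] W[THEN hom_mat_carrier]
  have "A * W = U"
  proof (rule eq_matI)
    fix k l assume "k < dim_row U" "l < dim_col U"
    then have kl: "k < length a" "l < length c" using car by auto
    have "(A * W) $$ (k, l) = (\<Sum>j<length b. A $$ (k, j) * hom_comp (c ! l - b ! j) (w l $ j))"
      unfolding index_mult_mat_sum[OF car(1,3) kl] using kl by (simp add: W_def)
    also have "\<dots> = (\<Sum>j<length b. hom_comp (c ! l - a ! k) (A $$ (k, j) * w l $ j))"
    proof (rule sum.cong)
      fix j assume "j \<in> {..<length b}"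
      then have "homogeneous (b ! j - a ! k) (A $$ (k, j))" using A kl by (simp add: hom_mat_def)
      from hom_comp_mult[OF this, of "c ! l - a ! k"]
      show "A $$ (k, j) * hom_comp (c ! l - b ! j) (w l $ j) =
          hom_comp (c ! l - a ! k) (A $$ (k, j) * w l $ j)" by simp
    qed simp
    also have "\<dots> = hom_comp (c ! l - a ! k) ((A *\<^sub>v w l) $ k)"
      using index_mult_mat_vec_sum[OF car(1) _ kl(1), of "w l"] w[OF kl(2)] by (simp add: hom_comp_sum)
    also have "\<dots> = U $$ (k, l)"
      using w[OF kl(2)] car U kl by (simp add: hom_comp_homogeneous hom_mat_def)
    finally show "(A * W) $$ (k, l) = U $$ (k, l)" .
  qed (use car in auto)
  with W show ?thesis by (rule that)
qed

text \<open>A minimal resolution of \<open>I\<close>, augmented by the map to \<open>e 0 = [0]\<close>, that is, to the ring itself.\<close>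

definition augmented_resolution ::
  "('v::finite, 'k::field) mpoly set \<Rightarrow> (nat \<Rightarrow> int list) \<Rightarrow> (nat \<Rightarrow> ('v, 'k) mpoly mat) \<Rightarrow> bool" where
  "augmented_resolution I e M \<longleftrightarrow>
     e 0 = [0] \<and> (\<forall>i. hom_mat (e i) (e (Suc i)) (M i)) \<and>
     (\<forall>p. p \<in> I \<longleftrightarrow> (\<exists>w\<in>carrier_vec (length (e 1)). p = (M 0 *\<^sub>v w) $ 0)) \<and>
     (\<forall>i. M i * M (Suc i) = 0\<^sub>m (length (e i)) (length (e (Suc (Suc i))))) \<and>
     (\<forall>i. \<forall>u\<in>carrier_vec (length (e (Suc i))). M i *\<^sub>v u = 0\<^sub>v (length (e i)) \<longrightarrow>
        (\<exists>w\<in>carrier_vec (length (e (Suc (Suc i)))). u = M (Suc i) *\<^sub>v w)) \<and>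
     (\<forall>i. \<forall>k<length (e (Suc i)). \<forall>l<length (e (Suc (Suc i))). const_coeff (M (Suc i) $$ (k, l)) = 0)"

lemma augmented_resolutionD:
  assumes "augmented_resolution I e M"
  shows "e 0 = [0]" and "hom_mat (e i) (e (Suc i)) (M i)"
    and "p \<in> I \<longleftrightarrow> (\<exists>w\<in>carrier_vec (length (e 1)). p = (M 0 *\<^sub>v w) $ 0)"
    and "M i * M (Suc i) = 0\<^sub>m (length (e i)) (length (e (Suc (Suc i))))"
    and "u \<in> carrier_vec (length (e (Suc i))) \<Longrightarrow> M i *\<^sub>v u = 0\<^sub>v (length (e i)) \<Longrightarrow>
        \<exists>w\<in>carrier_vec (length (e (Suc (Suc i)))). u = M (Suc i) *\<^sub>v w"
    and "k < length (e (Suc i)) \<Longrightarrow> l < length (e (Suc (Suc i))) \<Longrightarrow>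
        const_coeff (M (Suc i) $$ (k, l)) = 0"
  using assms by (auto simp: augmented_resolution_def)

section \<open>Chain maps and homotopies between resolutions\<close>

lemma augmented_resolution_lift_column:
  assumes "augmented_resolution I e M" "U \<in> carrier_mat (length (e (Suc i))) m"
    and "M i * U = 0\<^sub>m (length (e i)) m" "l < m"
  shows "\<exists>w\<in>carrier_vec (length (e (Suc (Suc i)))). M (Suc i) *\<^sub>v w = col U l"
proof -
  have "M i \<in> carrier_mat (length (e i)) (length (e (Suc i)))"
    using augmented_resolutionD(2)[OF assms(1)] by (rule hom_mat_carrier)
  then have "M i *\<^sub>v col U l = col (0\<^sub>m (length (e i)) m) l"
    unfolding assms(3)[symmetric] by (rule col_mult2[OF _ assms(2,4), symmetric])
  then have "M i *\<^sub>v col U l = 0\<^sub>v (length (e i))"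
    using assms(4) by simp
  moreover have "col U l \<in> carrier_vec (length (e (Suc i)))"
    using assms(2,4) by (metis carrier_matD(1) carrier_vec_dim_vec dim_col)
  ultimately show ?thesis
    using augmented_resolutionD(5)[OF assms(1)] by metis
qed

text \<open>The comparison theorem: exactness is asked of \<open>M\<close>, while \<open>N\<close>
  is a complex of graded matrices. This form also admits a shifted resolution as \<open>N\<close>,
  whose ring does not sit in degree 0.\<close>

lemma comparison_map:
  assumes M: "augmented_resolution I e M"
    and N: "\<And>i. hom_mat (f i) (f (Suc i)) (N i)"
    and NN: "\<And>i. N i * N (Suc i) = 0\<^sub>m (length (f i)) (length (f (Suc (Suc i))))"
    and P: "hom_mat (e 0) (f 0) P" and PI: "\<And>l. l < length (f 1) \<Longrightarrow> (P * N 0) $$ (0, l) \<in> I"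
  obtains \<Phi> where "\<Phi> 0 = P" "\<And>i. hom_mat (e i) (f i) (\<Phi> i)" "\<And>i. M i * \<Phi> (Suc i) = \<Phi> i * N i"
proof -
  \<comment> \<open>The invariant includes that the next lifting problem is solvable. Membership in
    \<open>I\<close> provides this at the start, exactness of \<open>M\<close> afterwards.\<close>
  let ?P = "\<lambda>n x. hom_mat (e n) (f n) x \<and> (n = 0 \<longrightarrow> x = P) \<and>
    (\<forall>l<length (f (Suc n)). \<exists>w\<in>carrier_vec (length (e (Suc n))). M n *\<^sub>v w = col (x * N n) l)"
  have Mh: "hom_mat (e n) (e (Suc n)) (M n)" for n
    using augmented_resolutionD(2)[OF M] .
  have Mc: "M n \<in> carrier_mat (length (e n)) (length (e (Suc n)))" for n
    using Mh by (rule hom_mat_carrier)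
  have Nc: "N n \<in> carrier_mat (length (f n)) (length (f (Suc n)))" for n
    using N by (rule hom_mat_carrier)
  have e0: "e 0 = [0]" using augmented_resolutionD(1)[OF M] .
  have "\<exists>\<Phi>. \<forall>n. ?P n (\<Phi> n) \<and> M n * \<Phi> (Suc n) = \<Phi> n * N n"
  proof (rule dependent_nat_choice)
    have "\<exists>w\<in>carrier_vec (length (e (Suc 0))). M 0 *\<^sub>v w = col (P * N 0) l"
      if l: "l < length (f (Suc 0))" for l
    proof -
      obtain w where w: "w \<in> carrier_vec (length (e 1))" "(P * N 0) $$ (0, l) = (M 0 *\<^sub>v w) $ 0"
        using PI l augmented_resolutionD(3)[OF M] by auto
      have "M 0 *\<^sub>v w = col (P * N 0) l"
        using w(2) Mc[of 0] Nc[of 0] P[THEN hom_mat_carrier] l e0 w(1) by (intro eq_vecI) auto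
      with w(1) show ?thesis by auto
    qed
    then show "\<exists>x. ?P 0 x" using P by blast
  next
    fix x n assume x: "?P n x"
    obtain y where y: "hom_mat (e (Suc n)) (f (Suc n)) y" "M n * y = x * N n"
      using hom_lift[OF Mh[of n] hom_mat_mult[OF conjunct1[OF x] N]] x by blast
    note xc = hom_mat_carrier[OF conjunct1[OF x]] and yc = hom_mat_carrier[OF y(1)]
    have "M n * (y * N (Suc n)) = M n * y * N (Suc n)"
      by (rule assoc_mult_mat[OF Mc yc Nc, symmetric])
    also have "\<dots> = x * (N n * N (Suc n))"
      unfolding y(2) by (rule assoc_mult_mat[OF xc Nc Nc])
    also have "\<dots> = 0\<^sub>m (length (e n)) (length (f (Suc (Suc n))))"
      unfolding NN using xc by simp
    finally have "M n * (y * N (Suc n)) = 0\<^sub>m (length (e n)) (length (f (Suc (Suc n))))" .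
    then have "\<exists>w\<in>carrier_vec (length (e (Suc (Suc n)))). M (Suc n) *\<^sub>v w = col (y * N (Suc n)) l"
      if "l < length (f (Suc (Suc n)))" for l
      using that yc Nc[of "Suc n"] by (intro augmented_resolution_lift_column[OF M]) auto
    then show "\<exists>y. ?P (Suc n) y \<and> M n * y = x * N n"
      using y by blast
  qed
  then show ?thesis using that by auto
qed

text \<open>A graded endomorphism of a minimal resolution that lifts zero is null-homotopic, so its
  entries have no constant term.\<close>

lemma lift_of_zero_const_coeff:
  assumes M: "augmented_resolution I e M"
    and Z: "\<And>i. hom_mat (e i) (e i) (Z i)" "\<And>i. M i * Z (Suc i) = Z i * M i"
    and Z0: "Z 0 = 0\<^sub>m 1 1"
    and kl: "k < length (e i)" "l < length (e i)"
  shows "const_coeff (Z i $$ (k, l)) = 0"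
proof -
  have Mh: "hom_mat (e n) (e (Suc n)) (M n)" for n
    using augmented_resolutionD(2)[OF M] .
  have Mc: "M n \<in> carrier_mat (length (e n)) (length (e (Suc n)))" for n
    using Mh by (rule hom_mat_carrier)
  have Zc: "Z n \<in> carrier_mat (length (e n)) (length (e n))" for n
    using Z(1) by (rule hom_mat_carrier)
  have e0: "e 0 = [0]" using augmented_resolutionD(1)[OF M] .
  \<comment> \<open>\<open>x\<close> is the homotopy in place \<open>n\<close>. By the last clause,
    the part of \<open>Z (Suc n)\<close> that it does not account for lies in the kernel of
    \<open>M n\<close>, hence lifts along \<open>M (Suc n)\<close>.\<close>
  let ?P = "\<lambda>n x. hom_mat (e (Suc n)) (e n) x \<and> (n = 0 \<longrightarrow> x = 0\<^sub>m (length (e 1)) (length (e 0))) \<and>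
    M n * (Z (Suc n) - x * M n) = 0\<^sub>m (length (e n)) (length (e (Suc n)))"
  have "\<exists>h. \<forall>n. ?P n (h n) \<and> Z (Suc n) = M (Suc n) * h (Suc n) + h n * M n"
  proof (rule dependent_nat_choice)
    have "Z (Suc 0) - 0\<^sub>m (length (e 1)) (length (e 0)) * M 0 = Z (Suc 0)"
      using Mc[of 0] Zc[of "Suc 0"] by (intro eq_matI) auto
    moreover have "M 0 * Z (Suc 0) = 0\<^sub>m (length (e 0)) (length (e (Suc 0)))"
      unfolding Z(2) Z0 using Mc[of 0] e0 by simp
    ultimately have "?P 0 (0\<^sub>m (length (e 1)) (length (e 0)))"
      by (simp add: hom_mat_def)
    then show "\<exists>x. ?P 0 x" by blast
  next
    fix x n assume x: "?P n x"
    note xc = hom_mat_carrier[OF conjunct1[OF x]]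
    let ?U = "Z (Suc n) - x * M n"
    have xM: "hom_mat (e (Suc n)) (e (Suc n)) (x * M n)"
      using x Mh hom_mat_mult by blast
    have hom: "hom_mat (e (Suc n)) (e (Suc n)) ?U"
      unfolding hom_mat_def
    proof (intro conjI allI impI)
      show "?U \<in> carrier_mat (length (e (Suc n))) (length (e (Suc n)))"
        using xM[THEN hom_mat_carrier] by (rule minus_carrier_mat)
      fix k l assume kl: "k < length (e (Suc n))" "l < length (e (Suc n))"
      have "?U $$ (k, l) = Z (Suc n) $$ (k, l) + - ((x * M n) $$ (k, l))"
        using kl hom_mat_carrier[OF xM] by (subst index_minus_mat) auto
      moreover have "homogeneous (e (Suc n) ! l - e (Suc n) ! k) \<dots>"
        using kl xM Z(1)[of "Suc n"] by (intro homogeneous_add) (auto simp: hom_mat_def)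
      ultimately show "homogeneous (e (Suc n) ! l - e (Suc n) ! k) (?U $$ (k, l))" by simp
    qed
    obtain y where y: "hom_mat (e (Suc (Suc n))) (e (Suc n)) y" "M (Suc n) * y = ?U"
      using hom_lift[OF Mh[of "Suc n"] hom]
        augmented_resolution_lift_column[OF M hom_mat_carrier[OF hom]] x by blast
    note yc = hom_mat_carrier[OF y(1)]
    have eq: "Z (Suc n) = M (Suc n) * y + x * M n"
      unfolding y(2) using Zc[of "Suc n"] hom_mat_carrier[OF xM] by (intro eq_matI) auto
    have xMM: "x * M n * M (Suc n) = 0\<^sub>m (length (e (Suc n))) (length (e (Suc (Suc n))))"
      unfolding assoc_mult_mat[OF xc Mc Mc] augmented_resolutionD(4)[OF M] using xc by simp
    have c1: "M (Suc n) * y \<in> carrier_mat (length (e (Suc n))) (length (e (Suc n)))"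
      using Mc[of "Suc n"] yc by auto
    have c2: "M (Suc n) * y * M (Suc n) \<in> carrier_mat (length (e (Suc n))) (length (e (Suc (Suc n))))"
      using Mc[of "Suc n"] c1 by auto
    have yM: "y * M (Suc n) \<in> carrier_mat (length (e (Suc (Suc n)))) (length (e (Suc (Suc n))))"
      using Mc[of "Suc n"] yc by auto
    have "M (Suc n) * (Z (Suc (Suc n)) - y * M (Suc n)) =
        Z (Suc n) * M (Suc n) - M (Suc n) * (y * M (Suc n))"
      using mult_minus_distrib_mat[OF Mc Zc yM] by (simp add: Z(2))
    also have "M (Suc n) * (y * M (Suc n)) = M (Suc n) * y * M (Suc n)"
      by (rule assoc_mult_mat[OF Mc yc Mc, symmetric])
    also have "Z (Suc n) * M (Suc n) = M (Suc n) * y * M (Suc n) + x * M n * M (Suc n)"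
      unfolding eq by (rule add_mult_distrib_mat[OF c1 hom_mat_carrier[OF xM] Mc])
    also have "\<dots> - M (Suc n) * y * M (Suc n) = 0\<^sub>m (length (e (Suc n))) (length (e (Suc (Suc n))))"
      unfolding xMM using c2 by (intro eq_matI) auto
    finally show "\<exists>y. ?P (Suc n) y \<and> Z (Suc n) = M (Suc n) * y + x * M n"
      using y(1) eq by blast
  qed
  then obtain h where h: "\<And>n. hom_mat (e (Suc n)) (e n) (h n)"
      and h0: "h 0 = 0\<^sub>m (length (e 1)) (length (e 0))"
      and hZ: "\<And>n. Z (Suc n) = M (Suc n) * h (Suc n) + h n * M n"
    by blast
  show ?thesis
  proof (cases i)
    case 0
    then show ?thesis using kl e0 by (simp add: Z0)
  next
    case (Suc n)
    note hc = h[THEN hom_mat_carrier]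
    have kl': "k < length (e (Suc n))" "l < length (e (Suc n))" using kl Suc by auto
    have "const_coeff ((M (Suc n) * h (Suc n)) $$ (k, l)) = 0"
      unfolding index_mult_mat_sum[OF Mc hc kl'] using kl' augmented_resolutionD(6)[OF M]
      by (simp add: lookup_sum const_coeff_mult)
    \<comment> \<open>Minimality concerns only the matrices \<open>M (Suc n)\<close>. The
      augmentation \<open>M 0\<close> has a unit entry if \<open>I\<close> is the whole ring, and
      there the claim rests on \<open>h 0\<close> being zero.\<close>
    moreover have "const_coeff ((h n * M n) $$ (k, l)) = 0"
    proof (cases n)
      case 0
      then show ?thesis using h0 kl' Mc[of 0] by simp
    next
      case (Suc n')
      then show ?thesis
        unfolding index_mult_mat_sum[OF hc Mc kl'] using kl' augmented_resolutionD(6)[OF M]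
        by (simp add: lookup_sum const_coeff_mult)
    qed
    moreover have "Z i $$ (k, l) = (M (Suc n) * h (Suc n)) $$ (k, l) + (h n * M n) $$ (k, l)"
      unfolding Suc hZ using kl' Mc[of n] hc[of n] by (subst index_add_mat) auto
    ultimately show ?thesis by (simp add: lookup_add)
  qed
qed

text \<open>Lift the identity of the ring in both directions. The composite differs from the
  identity by a lift of zero, so its diagonal entries have nonzero constant terms. Such a term
  requires an entry of \<open>\<Psi>\<close> with a constant term, and this entry joins equal
  degrees.\<close>

lemma augmented_resolution_degrees_subset:
  assumes M: "augmented_resolution I e M" and N: "augmented_resolution I f N"
  shows "set (e i) \<subseteq> set (f i)"
proof
  have Mh: "hom_mat (e n) (e (Suc n)) (M n)" for n using augmented_resolutionD(2)[OF M] .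
  have Nh: "hom_mat (f n) (f (Suc n)) (N n)" for n using augmented_resolutionD(2)[OF N] .
  note Mc = Mh[THEN hom_mat_carrier] and Nc = Nh[THEN hom_mat_carrier]
  have e0: "e 0 = [0]" and f0: "f 0 = [0]"
    using augmented_resolutionD(1) M N by auto
  have in_I: "(1\<^sub>m 1 * M 0) $$ (0, l) \<in> I" if "augmented_resolution I e M" "l < length (e 1)" for e M l
  proof -
    have c: "M 0 \<in> carrier_mat 1 (length (e 1))"
      using hom_mat_carrier[OF augmented_resolutionD(2)[OF that(1), of 0]] augmented_resolutionD(1)[OF that(1)]
      by simp
    have "(M 0 *\<^sub>v unit_vec (length (e 1)) l) $ 0 = (1\<^sub>m 1 * M 0) $$ (0, l)"
      using c that(2) by simp
    then show ?thesis unfolding augmented_resolutionD(3)[OF that(1)] by (metis unit_vec_carrier)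
  qed
  have one: "hom_mat [0] [0] (1\<^sub>m 1)" by (simp add: hom_mat_def)
  obtain \<Phi> where \<Phi>: "\<Phi> 0 = 1\<^sub>m 1" "\<And>i. hom_mat (f i) (e i) (\<Phi> i)" "\<And>i. N i * \<Phi> (Suc i) = \<Phi> i * M i"
    using comparison_map[where N = M and P = "1\<^sub>m 1", OF N Mh augmented_resolutionD(4)[OF M]] in_I[OF M] e0 f0 one by auto
  obtain \<Psi> where \<Psi>: "\<Psi> 0 = 1\<^sub>m 1" "\<And>i. hom_mat (e i) (f i) (\<Psi> i)" "\<And>i. M i * \<Psi> (Suc i) = \<Psi> i * N i"
    using comparison_map[where N = N and P = "1\<^sub>m 1", OF M Nh augmented_resolutionD(4)[OF N]] in_I[OF N] e0 f0 one by auto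
  note \<Phi>c = \<Phi>(2)[THEN hom_mat_carrier] and \<Psi>c = \<Psi>(2)[THEN hom_mat_carrier]
  define Z where "Z i = \<Psi> i * \<Phi> i - 1\<^sub>m (length (e i))" for i
  have PP: "hom_mat (e i) (e i) (\<Psi> i * \<Phi> i)" for i
    using hom_mat_mult \<Phi>(2) \<Psi>(2) by blast
  note PPc = PP[THEN hom_mat_carrier]
  have Zh: "hom_mat (e i) (e i) (Z i)" for i
    unfolding hom_mat_def
  proof (intro conjI allI impI)
    show "Z i \<in> carrier_mat (length (e i)) (length (e i))" by (simp add: Z_def minus_carrier_mat)
    fix k l assume kl: "k < length (e i)" "l < length (e i)"
    have "Z i $$ (k, l) = (\<Psi> i * \<Phi> i) $$ (k, l) + - (1\<^sub>m (length (e i)) $$ (k, l))"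
      unfolding Z_def using kl by (subst index_minus_mat) auto
    moreover have "homogeneous (e i ! l - e i ! k) \<dots>"
      using PP[of i] kl by (intro homogeneous_add) (auto simp: hom_mat_def one_mat_def)
    ultimately show "homogeneous (e i ! l - e i ! k) (Z i $$ (k, l))" by simp
  qed
  have MZ: "M i * Z (Suc i) = Z i * M i" for i
  proof -
    have "M i * Z (Suc i) = M i * (\<Psi> (Suc i) * \<Phi> (Suc i)) - M i * 1\<^sub>m (length (e (Suc i)))"
      unfolding Z_def by (rule mult_minus_distrib_mat[OF Mc PPc one_carrier_mat])
    also have "M i * (\<Psi> (Suc i) * \<Phi> (Suc i)) = \<Psi> i * N i * \<Phi> (Suc i)"
      using assoc_mult_mat[OF Mc \<Psi>c \<Phi>c] \<Psi>(3) by simp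
    also have "\<dots> = \<Psi> i * \<Phi> i * M i"
      using assoc_mult_mat[OF \<Psi>c Nc \<Phi>c] assoc_mult_mat[OF \<Psi>c \<Phi>c Mc] \<Phi>(3) by simp
    also have "M i * 1\<^sub>m (length (e (Suc i))) = 1\<^sub>m (length (e i)) * M i"
      using Mc[of i] by simp
    also have "\<Psi> i * \<Phi> i * M i - 1\<^sub>m (length (e i)) * M i = Z i * M i"
      unfolding Z_def by (rule minus_mult_distrib_mat[OF PPc one_carrier_mat Mc, symmetric])
    finally show ?thesis .
  qed
  have Z0: "Z 0 = 0\<^sub>m 1 1"
    using e0 by (simp add: Z_def \<Phi>(1) \<Psi>(1))
  fix d assume "d \<in> set (e i)"
  then obtain k where k: "k < length (e i)" "e i ! k = d" by (auto simp: in_set_conv_nth)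
  have "const_coeff (Z i $$ (k, k)) = 0"
    by (rule lift_of_zero_const_coeff[OF M Zh MZ Z0 k(1) k(1)])
  moreover have "Z i $$ (k, k) = (\<Psi> i * \<Phi> i) $$ (k, k) - 1"
    unfolding Z_def using k(1) by (subst index_minus_mat) auto
  ultimately have "const_coeff ((\<Psi> i * \<Phi> i) $$ (k, k)) \<noteq> 0"
    by (simp add: lookup_minus)
  then have "(\<Sum>j<length (f i). const_coeff (\<Psi> i $$ (k, j)) * const_coeff (\<Phi> i $$ (j, k))) \<noteq> 0"
    unfolding index_mult_mat_sum[OF \<Psi>c \<Phi>c k(1) k(1)] by (simp add: lookup_sum const_coeff_mult)
  then obtain j where j: "j < length (f i)" "const_coeff (\<Psi> i $$ (k, j)) \<noteq> 0"
    by (metis (no_types, lifting) lessThan_iff mult_eq_0_iff sum.neutral)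
  moreover have "homogeneous (f i ! j - e i ! k) (\<Psi> i $$ (k, j))"
    using \<Psi>(2)[of i] j(1) k(1) unfolding hom_mat_def by blast
  ultimately have "f i ! j = d"
    using homogeneous_const_coeff k(2) by fastforce
  then show "d \<in> set (f i)" using j(1) by auto
qed

section \<open>Regularity from a resolution\<close>

text \<open>With the ring placed in front, \<open>g\<close> becomes a matrix with one row, and the
  conditions on the kernels of \<open>g\<close> and of \<open>D i\<close> become instances of one
  condition, at the price of an index shift by one.\<close>

lemma minimal_resolution_iff_augmented:
  assumes g: "g \<in> carrier_vec (length (d 0))"
  shows "minimal_graded_free_resolution I d g D \<longleftrightarrow>
    augmented_resolution I (case_nat [0] d) (case_nat (mat_of_row g) D)"
proof -
  have row0: "mat_of_row g *\<^sub>v u = 0\<^sub>v (Suc 0) \<longleftrightarrow> g \<bullet> u = 0" for u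
    by (auto simp: vec_eq_iff)
  have hom0: "hom_mat [0] (d 0) (mat_of_row g) \<longleftrightarrow> (\<forall>k<length (d 0). homogeneous (d 0 ! k) (g $ k))"
    using g by (auto simp: hom_mat_def)
  have comp: "A * B = 0\<^sub>m n r \<longleftrightarrow> (\<forall>w\<in>carrier_vec r. A *\<^sub>v (B *\<^sub>v w) = 0\<^sub>v n)"
    if AB: "A \<in> carrier_mat n m" "B \<in> carrier_mat m r" for A B :: "('a, 'b) mpoly mat" and n m r
  proof
    assume *: "A * B = 0\<^sub>m n r"
    show "\<forall>w\<in>carrier_vec r. A *\<^sub>v (B *\<^sub>v w) = 0\<^sub>v n"
    proof
      fix w :: "('a, 'b) mpoly vec" assume w: "w \<in> carrier_vec r"
      have "0\<^sub>m n r *\<^sub>v w = 0\<^sub>v n" using w by auto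
      then show "A *\<^sub>v (B *\<^sub>v w) = 0\<^sub>v n"
        using assoc_mult_mat_vec[OF AB w] * by simp
    qed
  next
    assume *: "\<forall>w\<in>carrier_vec r. A *\<^sub>v (B *\<^sub>v w) = 0\<^sub>v n"
    show "A * B = 0\<^sub>m n r"
    proof (rule mat_col_eqI)
      fix l assume "l < dim_col (0\<^sub>m n r :: ('a, 'b) mpoly mat)"
      then have l: "l < r" by simp
      have "B *\<^sub>v unit_vec r l = col B l"
        using AB l by (intro eq_vecI) auto
      then have "col (A * B) l = A *\<^sub>v (B *\<^sub>v unit_vec r l)"
        using col_mult2[OF AB l] by simp
      also have "\<dots> = 0\<^sub>v n"
        using * by simp
      finally show "col (A * B) l = col (0\<^sub>m n r) l" using l by simp
    qed (use AB in auto)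
  qed
  have ker: "{u \<in> carrier_vec m. A *\<^sub>v u = 0\<^sub>v n} = {B *\<^sub>v w |w. w \<in> carrier_vec r} \<longleftrightarrow>
      A * B = 0\<^sub>m n r \<and>
      (\<forall>u\<in>carrier_vec m. A *\<^sub>v u = 0\<^sub>v n \<longrightarrow> (\<exists>w\<in>carrier_vec r. u = B *\<^sub>v w))"
    if AB: "A \<in> carrier_mat n m" "B \<in> carrier_mat m r" for A B :: "('a, 'b) mpoly mat" and n m r
    unfolding comp[OF AB] using AB by (auto intro: mult_mat_vec_carrier)
  show ?thesis
  \<comment> \<open>Gradedness follows from either side. Splitting it off supplies the dimensions
    under which the equalities of kernels and images can be rewritten.\<close>
  proof (cases "\<forall>i. hom_mat (case_nat [0] d i) (case_nat [0] d (Suc i)) (case_nat (mat_of_row g) D i)")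
    case False
    have "\<exists>i. \<not> hom_mat (d i) (d (Suc i)) (D i)" if "\<forall>k<length (d 0). homogeneous (d 0 ! k) (g $ k)"
    proof -
      obtain i where "\<not> hom_mat (case_nat [0] d i) (case_nat [0] d (Suc i)) (case_nat (mat_of_row g) D i)"
        using False by blast
      then show ?thesis using that hom0 by (cases i) auto
    qed
    moreover have "(\<forall>k<length (d 0). homogeneous (d 0 ! k) (g $ k)) \<and> hom_mat (d i) (d (Suc i)) (D i)"
      if "minimal_graded_free_resolution I d g D" for i
      using that by (simp add: minimal_graded_free_resolution_def hom_mat_def)
    moreover have "\<not> augmented_resolution I (case_nat [0] d) (case_nat (mat_of_row g) D)"
      using False augmented_resolutionD(2) by metis
    ultimately show ?thesis by metis
  next
    case True
    then have hD: "hom_mat (d i) (d (Suc i)) (D i)" and hg: "hom_mat [0] (d 0) (mat_of_row g)" for i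
      using True[rule_format, of "Suc i"] True[rule_format, of 0] by auto
    have gc: "mat_of_row g \<in> carrier_mat (Suc 0) (length (d 0))" using g by (rule mat_of_row_carrier)
    have Dc: "D i \<in> carrier_mat (length (d i)) (length (d (Suc i)))" for i
      using hD by (rule hom_mat_carrier)
    have k0: "({u \<in> carrier_vec (length (d 0)). g \<bullet> u = 0} = {D 0 *\<^sub>v w |w. w \<in> carrier_vec (length (d 1))}) \<longleftrightarrow>
      mat_of_row g * D 0 = 0\<^sub>m (Suc 0) (length (d 1)) \<and>
      (\<forall>u\<in>carrier_vec (length (d 0)). mat_of_row g *\<^sub>v u = 0\<^sub>v (Suc 0) \<longrightarrow> (\<exists>w\<in>carrier_vec (length (d 1)). u = D 0 *\<^sub>v w))"
      using ker[OF gc Dc[of 0]] by (simp add: row0)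
    have kS: "(mat_kernel (D i) = {D (Suc i) *\<^sub>v w |w. w \<in> carrier_vec (length (d (Suc (Suc i))))}) \<longleftrightarrow>
      D i * D (Suc i) = 0\<^sub>m (length (d i)) (length (d (Suc (Suc i)))) \<and>
      (\<forall>u\<in>carrier_vec (length (d (Suc i))). D i *\<^sub>v u = 0\<^sub>v (length (d i)) \<longrightarrow>
        (\<exists>w\<in>carrier_vec (length (d (Suc (Suc i)))). u = D (Suc i) *\<^sub>v w))" for i
      using ker[OF Dc Dc, of i] Dc[of i] by (simp add: mat_kernel_def)
    have im: "{g \<bullet> u |u. u \<in> carrier_vec (length (d 0))} = I \<longleftrightarrow>
      (\<forall>p. p \<in> I \<longleftrightarrow> (\<exists>w\<in>carrier_vec (length (d 0)). p = (mat_of_row g *\<^sub>v w) $ 0))"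
      by auto
    have all_nat: "(\<forall>i. P i) \<longleftrightarrow> P 0 \<and> (\<forall>i. P (Suc i))" for P :: "nat \<Rightarrow> bool"
      by (metis nat.exhaust)
    let ?e = "case_nat [0] d" and ?M = "case_nat (mat_of_row g) D"
    have comp_iff: "(\<forall>i. ?M i * ?M (Suc i) = 0\<^sub>m (length (?e i)) (length (?e (Suc (Suc i))))) \<longleftrightarrow>
      mat_of_row g * D 0 = 0\<^sub>m (Suc 0) (length (d 1)) \<and>
      (\<forall>i. D i * D (Suc i) = 0\<^sub>m (length (d i)) (length (d (Suc (Suc i)))))"
      by (subst all_nat) simp
    have exact_iff: "(\<forall>i. \<forall>u\<in>carrier_vec (length (?e (Suc i))). ?M i *\<^sub>v u = 0\<^sub>v (length (?e i)) \<longrightarrow>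
        (\<exists>w\<in>carrier_vec (length (?e (Suc (Suc i)))). u = ?M (Suc i) *\<^sub>v w)) \<longleftrightarrow>
      (\<forall>u\<in>carrier_vec (length (d 0)). mat_of_row g *\<^sub>v u = 0\<^sub>v (Suc 0) \<longrightarrow>
        (\<exists>w\<in>carrier_vec (length (d 1)). u = D 0 *\<^sub>v w)) \<and>
      (\<forall>i. \<forall>u\<in>carrier_vec (length (d (Suc i))). D i *\<^sub>v u = 0\<^sub>v (length (d i)) \<longrightarrow>
        (\<exists>w\<in>carrier_vec (length (d (Suc (Suc i)))). u = D (Suc i) *\<^sub>v w))"
      by (subst all_nat) simp
    have "minimal_graded_free_resolution I d g D \<longleftrightarrow>
      (\<forall>p. p \<in> I \<longleftrightarrow> (\<exists>w\<in>carrier_vec (length (d 0)). p = (mat_of_row g *\<^sub>v w) $ 0)) \<and>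
      (\<forall>i. ?M i * ?M (Suc i) = 0\<^sub>m (length (?e i)) (length (?e (Suc (Suc i))))) \<and>
      (\<forall>i. \<forall>u\<in>carrier_vec (length (?e (Suc i))). ?M i *\<^sub>v u = 0\<^sub>v (length (?e i)) \<longrightarrow>
        (\<exists>w\<in>carrier_vec (length (?e (Suc (Suc i)))). u = ?M (Suc i) *\<^sub>v w)) \<and>
      (\<forall>i. \<forall>k<length (d i). \<forall>l<length (d (Suc i)). const_coeff (D i $$ (k, l)) = 0)"
      unfolding minimal_graded_free_resolution_def k0 kS im mem_irrelevant_ideal comp_iff exact_iff
      using g hg hD Dc hom0 unfolding hom_mat_def by (simp only:) blast
    then show ?thesis
      unfolding augmented_resolution_def using True by simp
  qed
qed

text \<open>Whichever resolution \<open>SOME\<close> picks, comparison with \<open>M\<close> in both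
  directions yields the same set of degrees in each position.\<close>

lemma graded_betti_support:
  assumes M: "augmented_resolution I e M"
  shows "graded_betti I i j \<noteq> 0 \<longleftrightarrow> j \<in> set (e (Suc i))"
proof -
  have M0: "M 0 \<in> carrier_mat 1 (length (e (Suc 0)))"
    using hom_mat_carrier[OF augmented_resolutionD(2)[OF M, of 0]] augmented_resolutionD(1)[OF M] by simp
  have "case_nat [0] (\<lambda>i. e (Suc i)) = e"
    using augmented_resolutionD(1)[OF M] by (auto simp: fun_eq_iff split: nat.split)
  moreover have "mat_of_row (row (M 0) 0) = M 0"
    using M0 by (intro eq_matI) auto
  then have "case_nat (mat_of_row (row (M 0) 0)) (\<lambda>i. M (Suc i)) = M"
    by (auto simp: fun_eq_iff split: nat.split)
  ultimately have "minimal_graded_free_resolution I (\<lambda>i. e (Suc i)) (row (M 0) 0) (\<lambda>i. M (Suc i))"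
    using M row_carrier_vec[OF _ M0, of 0] by (subst minimal_resolution_iff_augmented) auto
  then have "\<exists>b d g D. minimal_graded_free_resolution I d g D \<and> b = count_list (d i) j"
    by blast
  from someI_ex[OF this] obtain d g D
    where res: "minimal_graded_free_resolution I d g D" and b: "graded_betti I i j = count_list (d i) j"
    unfolding graded_betti_def by blast
  have "g \<in> carrier_vec (length (d 0))"
    using res by (simp add: minimal_graded_free_resolution_def)
  with res have N: "augmented_resolution I (case_nat [0] d) (case_nat (mat_of_row g) D)"
    by (simp add: minimal_resolution_iff_augmented)
  have "set (d i) = set (e (Suc i))"
    using augmented_resolution_degrees_subset[OF M N, of "Suc i"]
      augmented_resolution_degrees_subset[OF N M, of "Suc i"] by simp
  then show ?thesis by (simp add: b count_list_0_iff)
qed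

text \<open>\<open>A\<close> is the set of the values \<open>j - i\<close> over the nonzero Betti numbers \<open>b\<^bsub>i,j\<^esub>(I)\<close>.\<close>

definition resolved :: "('v::finite, 'k::field) mpoly set \<Rightarrow> int set \<Rightarrow> bool" where
  "resolved I A \<longleftrightarrow> (\<exists>e M. augmented_resolution I e M \<and> A = {x - int i |x i. x \<in> set (e (Suc i))})"

lemma regularity_resolved:
  assumes "resolved I A"
  shows "regularity I = Max A"
proof -
  obtain e M where M: "augmented_resolution I e M" and A: "A = {x - int i |x i. x \<in> set (e (Suc i))}"
    using assms by (auto simp: resolved_def)
  have "{j - int i |i j. graded_betti I i j \<noteq> 0} = A"
    unfolding A graded_betti_support[OF M] by blast
  then show ?thesis by (simp add: regularity_def)
qed

text \<open>The starting point for adding generators one at a time: after the ring itself, all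
  modules are zero.\<close>

lemma resolved_zero_ideal: "resolved ({0} :: ('v::finite, 'k::field) mpoly set) {}"
proof -
  let ?e = "case_nat [0] (\<lambda>_. [])"
  let ?M = "\<lambda>i. 0\<^sub>m (length (?e i :: int list)) 0 :: ('v, 'k) mpoly mat"
  have z: "w \<in> carrier_vec 0 \<Longrightarrow> (0\<^sub>m 1 0 *\<^sub>v w) $ 0 = 0" for w :: "('v, 'k) mpoly vec"
    by (simp add: scalar_prod_def)
  have "augmented_resolution {0} ?e ?M"
    unfolding augmented_resolution_def
    using z by (auto simp: hom_mat_def intro!: exI[of _ "0\<^sub>v 0 :: ('v, 'k) mpoly vec"] eq_vecI)
  then show ?thesis by (force simp: resolved_def)
qed

section \<open>Adding one generator\<close>

lemma hom_mat_four_block: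
  assumes "hom_mat a c A" "hom_mat a d B" "hom_mat b c C" "hom_mat b d D"
  shows "hom_mat (a @ b) (c @ d) (four_block_mat A B C D)"
  using assms by (auto simp: hom_mat_def nth_append)

lemma hom_mat_zero: "hom_mat a b (0\<^sub>m (length a) (length b))"
  by (simp add: hom_mat_def)

lemma hom_mat_shift: "hom_mat (map ((+) D) a) (map ((+) D) b) A \<longleftrightarrow> hom_mat a b A"
  by (auto simp: hom_mat_def)

lemma hom_mat_uminus: "hom_mat a b A \<Longrightarrow> hom_mat a b (- A)"
  by (auto simp: hom_mat_def)

text \<open>Mapping cone of a comparison map from the linear resolution of the colon ideal \<open>Q\<close>, shifted by
  \<open>D\<close>, to the resolution of \<open>I\<close>. It is minimal because the entries of that map have positive
  degree by the bound on \<open>A\<close>.\<close>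

lemma resolved_add_generator:
  fixes I Q :: "('v::finite, 'k::field) mpoly set"
  assumes I: "resolved I A" and Q: "resolved Q B" and B: "B \<subseteq> {1}"
    and m: "homogeneous D m" and A_le: "\<And>x. x \<in> A \<Longrightarrow> x \<le> D"
    and colon: "\<And>p. p \<in> Q \<longleftrightarrow> p * m \<in> I"
  shows "resolved {q + p * m |q p. q \<in> I} (insert D A)"
proof -
  obtain e M where M: "augmented_resolution I e M" and A: "A = {x - int i |x i. x \<in> set (e (Suc i))}"
    using I by (auto simp: resolved_def)
  obtain f N where N: "augmented_resolution Q f N" and Bf: "B = {x - int i |x i. x \<in> set (f (Suc i))}"
    using Q by (auto simp: resolved_def)
  have e0: "e 0 = [0]" and f0: "f 0 = [0]" using augmented_resolutionD(1) M N by auto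
  \<comment> \<open>Linearity of the resolution of \<open>Q\<close>: with the ring in place 0, place
    \<open>i\<close> is generated in degree \<open>i\<close>.\<close>
  have f_deg: "x = int i" if "x \<in> set (f i)" for x i
  proof (cases i)
    case 0
    then show ?thesis using that f0 by simp
  next
    case (Suc j)
    then have "x - int j \<in> B" unfolding Bf using that by blast
    then show ?thesis using B Suc by auto
  qed
  define f' where "f' i = map ((+) D) (f i)" for i
  have len [simp]: "length (f' i) = length (f i)" for i by (simp add: f'_def)
  have Nh: "hom_mat (f' i) (f' (Suc i)) (N i)" for i
    unfolding f'_def hom_mat_shift by (rule augmented_resolutionD(2)[OF N])
  have Mh: "hom_mat (e i) (e (Suc i)) (M i)" for i by (rule augmented_resolutionD(2)[OF M])
  have Mc: "M i \<in> carrier_mat (length (e i)) (length (e (Suc i)))" for i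
    using Mh by (rule hom_mat_carrier)
  have Nc: "N i \<in> carrier_mat (length (f i)) (length (f (Suc i)))" for i
    using Nh[THEN hom_mat_carrier] by simp
  \<comment> \<open>Multiplication by \<open>m\<close> maps the shifted ring to the ring and, since
    \<open>Q\<close> is the colon ideal, maps \<open>Q\<close> into \<open>I\<close>.\<close>
  let ?P = "mat 1 1 (\<lambda>_. m)"
  have P: "hom_mat (e 0) (f' 0) ?P"
    using m by (simp add: hom_mat_def e0 f'_def f0)
  have "(?P * N 0) $$ (0, l) \<in> I" if l: "l < length (f' 1)" for l
  proof -
    have c: "N 0 \<in> carrier_mat 1 (length (f 1))" using Nc[of 0] f0 by simp
    have "(N 0 *\<^sub>v unit_vec (length (f 1)) l) $ 0 = N 0 $$ (0, l)"
      using c l by simp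
    then have "N 0 $$ (0, l) \<in> Q" unfolding augmented_resolutionD(3)[OF N] by (metis unit_vec_carrier)
    moreover have "(?P * N 0) $$ (0, l) = N 0 $$ (0, l) * m"
      by (subst index_mult_mat_sum[of _ 1 1 _ "length (f 1)"]) (use c l in \<open>auto simp: mult.commute\<close>)
    ultimately show ?thesis using colon by simp
  qed
  then obtain \<Phi> where \<Phi>: "\<Phi> 0 = ?P" "\<And>i. hom_mat (e i) (f' i) (\<Phi> i)" "\<And>i. M i * \<Phi> (Suc i) = \<Phi> i * N i"
    using comparison_map[where f = f' and N = N and P = ?P, OF M Nh _ P] augmented_resolutionD(4)[OF N]
    unfolding len by metis
  have \<Phi>c: "\<Phi> i \<in> carrier_mat (length (e i)) (length (f i))" for i
    using hom_mat_carrier[OF \<Phi>(2)[of i]] by simp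
  \<comment> \<open>The resolution of \<open>Q\<close> enters the cone one place later: place 0
    receives nothing, and the shifted ring in place 1 becomes the basis element that maps to
    \<open>m\<close>. The sign in \<open>R\<close> makes consecutive maps of the cone compose to
    zero.\<close>
  define r where "r = case_nat [] f'"
  define R where "R = case_nat (0\<^sub>m 0 1) (\<lambda>i. - N i)"
  have rS [simp]: "r (Suc i) = f' i" for i by (simp add: r_def)
  have RS [simp]: "R (Suc i) = - N i" for i by (simp add: R_def)
  have Rh: "hom_mat (r i) (f' i) (R i)" for i
  proof (cases i)
    case 0
    then show ?thesis by (simp add: r_def R_def f'_def f0 hom_mat_def)
  next
    case (Suc j)
    then show ?thesis using hom_mat_uminus[OF Nh[of j]] by (simp add: r_def R_def)
  qed
  have Rc: "R i \<in> carrier_mat (length (r i)) (length (f i))" for i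
    using hom_mat_carrier[OF Rh[of i]] by simp
  define e' where "e' i = e i @ r i" for i
  define M' where "M' i = four_block_mat (M i) (\<Phi> i) (0\<^sub>m (length (r i)) (length (e (Suc i)))) (R i)" for i
  have M'h: "hom_mat (e' i) (e' (Suc i)) (M' i)" for i
    unfolding e'_def M'_def rS using Mh \<Phi>(2) Rh by (intro hom_mat_four_block hom_mat_zero) auto
  have M'_mult: "M' i *\<^sub>v (a @\<^sub>v b) = (M i *\<^sub>v a + \<Phi> i *\<^sub>v b) @\<^sub>v (R i *\<^sub>v b)"
    if ab: "a \<in> carrier_vec (length (e (Suc i)))" "b \<in> carrier_vec (length (f i))" for i a b
  proof -
    have "0\<^sub>m (length (r i)) (length (e (Suc i))) *\<^sub>v a = 0\<^sub>v (length (r i))"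
      using ab(1) by auto
    then show ?thesis
      unfolding M'_def using four_block_mat_mult_vec[OF Mc[of i] \<Phi>c[of i] zero_carrier_mat Rc[of i] ab] Rc[of i] ab(2)
      by simp
  qed
  have split: "\<exists>a\<in>carrier_vec (length (e (Suc i))). \<exists>b\<in>carrier_vec (length (f i)). u = a @\<^sub>v b"
    if "u \<in> carrier_vec (length (e' (Suc i)))" for u :: "('v, 'k) mpoly vec" and i
    using that vec_first_last_append[of u "length (e (Suc i))" "length (f i)"]
    by (metis e'_def len length_append rS vec_first_carrier vec_last_carrier)
  have image: "p \<in> {q + p * m |q p. q \<in> I} \<longleftrightarrow> (\<exists>w\<in>carrier_vec (length (e' 1)). p = (M' 0 *\<^sub>v w) $ 0)" for p
  proof -
    have val: "(M' 0 *\<^sub>v (a @\<^sub>v b)) $ 0 = (M 0 *\<^sub>v a) $ 0 + b $ 0 * m"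
      if ab: "a \<in> carrier_vec (length (e 1))" "b \<in> carrier_vec 1" for a b
    proof -
      have "(\<Phi> 0 *\<^sub>v b) $ 0 = b $ 0 * m"
        unfolding \<Phi>(1) by (subst index_mult_mat_vec_sum[of _ 1 1]) (use ab in \<open>auto simp: mult.commute\<close>)
      then show ?thesis
        using M'_mult[of a 0 b] ab f0 Mc[of 0] \<Phi>c[of 0] e0 by (simp add: r_def)
    qed
    show ?thesis
    proof
      assume "p \<in> {q + p * m |q p. q \<in> I}"
      then obtain q c where p: "p = q + c * m" "q \<in> I" by blast
      then obtain a where a: "a \<in> carrier_vec (length (e 1))" "q = (M 0 *\<^sub>v a) $ 0"
        using augmented_resolutionD(3)[OF M] by blast
      have "p = (M' 0 *\<^sub>v (a @\<^sub>v vec 1 (\<lambda>_. c))) $ 0"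
        unfolding val[OF a(1) vec_carrier] p(1) a(2)[symmetric] by simp
      moreover have "a @\<^sub>v vec 1 (\<lambda>_. c) \<in> carrier_vec (length (e' 1))"
        using carrier_vecD[OF a(1)] f0 by (intro carrier_vecI) (simp add: e'_def)
      ultimately show "\<exists>w\<in>carrier_vec (length (e' 1)). p = (M' 0 *\<^sub>v w) $ 0"
        by (intro bexI[of _ "a @\<^sub>v vec 1 (\<lambda>_. c)"])
    next
      assume "\<exists>w\<in>carrier_vec (length (e' 1)). p = (M' 0 *\<^sub>v w) $ 0"
      then obtain a b where ab: "a \<in> carrier_vec (length (e 1))" "b \<in> carrier_vec 1"
          "p = (M' 0 *\<^sub>v (a @\<^sub>v b)) $ 0"
        using split[of _ 0] f0 by (metis One_nat_def length_Cons list.size(3))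
      then have "p = (M 0 *\<^sub>v a) $ 0 + b $ 0 * m" using val by simp
      moreover have "(M 0 *\<^sub>v a) $ 0 \<in> I" using ab(1) augmented_resolutionD(3)[OF M] by blast
      ultimately show "p \<in> {q + p * m |q p. q \<in> I}" by blast
    qed
  qed
  have M'M': "M' i * M' (Suc i) = 0\<^sub>m (length (e' i)) (length (e' (Suc (Suc i))))" for i
  proof -
    have RN: "R i * (- N i) = 0\<^sub>m (length (r i)) (length (f (Suc i)))"
    proof (cases i)
      case 0
      then show ?thesis using Nc[of 0] by (intro eq_matI) (auto simp: R_def r_def)
    next
      case (Suc j)
      have "- N j * (- N (Suc j)) = N j * N (Suc j)"
        using Nc[of j] Nc[of "Suc j"] by (simp add: uminus_mult_left_mat uminus_mult_right_mat)
      then show ?thesis using Suc augmented_resolutionD(4)[OF N, of j] by simp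
    qed
    have MP: "M i * \<Phi> (Suc i) + \<Phi> i * (- N i) = 0\<^sub>m (length (e i)) (length (f (Suc i)))"
    proof -
      have c: "\<Phi> i * N i \<in> carrier_mat (length (e i)) (length (f (Suc i)))"
        using \<Phi>c[of i] Nc[of i] by (rule mult_carrier_mat)
      have "\<Phi> i * (- N i) = - (\<Phi> i * N i)"
        using \<Phi>c[of i] Nc[of i] by (subst uminus_mult_right_mat) auto
      moreover have "X + - X = 0\<^sub>m (length (e i)) (length (f (Suc i)))"
        if "X \<in> carrier_mat (length (e i)) (length (f (Suc i)))" for X :: "('v, 'k) mpoly mat"
        using that by (intro eq_matI) auto
      ultimately show ?thesis unfolding \<Phi>(3) using c by simp
    qed
    have Nc': "- N i \<in> carrier_mat (length (f i)) (length (f (Suc i)))"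
      using Nc[of i] by auto
    have "M' i * M' (Suc i) = four_block_mat
        (M i * M (Suc i) + \<Phi> i * 0\<^sub>m (length (f i)) (length (e (Suc (Suc i)))))
        (M i * \<Phi> (Suc i) + \<Phi> i * (- N i))
        (0\<^sub>m (length (r i)) (length (e (Suc i))) * M (Suc i) + R i * 0\<^sub>m (length (f i)) (length (e (Suc (Suc i)))))
        (0\<^sub>m (length (r i)) (length (e (Suc i))) * \<Phi> (Suc i) + R i * (- N i))"
      unfolding M'_def rS RS len
      by (rule mult_four_block_mat[OF Mc \<Phi>c zero_carrier_mat Rc Mc \<Phi>c zero_carrier_mat Nc'])
    also have "\<dots> = 0\<^sub>m (length (e' i)) (length (e' (Suc (Suc i))))"
      unfolding MP RN augmented_resolutionD(4)[OF M]
      using \<Phi>c[of i] \<Phi>c[of "Suc i"] Mc[of "Suc i"] Rc[of i] by (simp add: e'_def)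
    finally show ?thesis .
  qed
  have exact: "\<exists>w\<in>carrier_vec (length (e' (Suc (Suc i)))). u = M' (Suc i) *\<^sub>v w"
    if u: "u \<in> carrier_vec (length (e' (Suc i)))" "M' i *\<^sub>v u = 0\<^sub>v (length (e' i))" for i u
  proof -
    obtain a b where ab: "a \<in> carrier_vec (length (e (Suc i)))" "b \<in> carrier_vec (length (f i))" "u = a @\<^sub>v b"
      using split[OF u(1)] by blast
    have MP: "M i *\<^sub>v a \<in> carrier_vec (length (e i))" "\<Phi> i *\<^sub>v b \<in> carrier_vec (length (e i))"
      using Mc \<Phi>c ab by (auto intro: mult_mat_vec_carrier)
    have "(M i *\<^sub>v a + \<Phi> i *\<^sub>v b) @\<^sub>v (R i *\<^sub>v b) = 0\<^sub>v (length (e i)) @\<^sub>v 0\<^sub>v (length (r i))"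
      using u(2) unfolding ab(3) M'_mult[OF ab(1,2)] e'_def by (auto intro!: eq_vecI)
    then have sum0: "M i *\<^sub>v a + \<Phi> i *\<^sub>v b = 0\<^sub>v (length (e i))" and Rb: "R i *\<^sub>v b = 0\<^sub>v (length (r i))"
      using append_vec_eq[OF add_carrier_vec[OF MP] zero_carrier_vec] by auto
    \<comment> \<open>For \<open>i = 0\<close> the kernel condition says that
      \<open>b $ 0 * m\<close> lies in \<open>I\<close>, and the colon condition puts
      \<open>b $ 0\<close> into \<open>Q\<close>. For larger \<open>i\<close> this is exactness of
      the resolution of \<open>Q\<close>.\<close>
    have "\<exists>w\<in>carrier_vec (length (f (Suc i))). b = N i *\<^sub>v w"
    proof (cases i)
      case 0
      have b: "b \<in> carrier_vec 1" using ab(2) 0 f0 by simp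
      have "(M 0 *\<^sub>v a) $ 0 + (\<Phi> 0 *\<^sub>v b) $ 0 = 0"
        using arg_cong[OF sum0, of "\<lambda>x. x $ 0"] Mc[of 0] \<Phi>c[of 0] 0 e0 by simp
      moreover have "(\<Phi> 0 *\<^sub>v b) $ 0 = b $ 0 * m"
        unfolding \<Phi>(1) by (subst index_mult_mat_vec_sum[of _ 1 1]) (use b in \<open>auto simp: mult.commute\<close>)
      ultimately have eq: "b $ 0 * m = - (M 0 *\<^sub>v a) $ 0" by (simp add: eq_neg_iff_add_eq_0 add.commute)
      have "(M 0 *\<^sub>v (- a)) $ 0 \<in> I"
        unfolding augmented_resolutionD(3)[OF M] using ab(1) 0 by auto
      moreover have "M 0 *\<^sub>v (- a) = - (M 0 *\<^sub>v a)"
        using ab(1) 0 Mc[of 0] by (intro eq_vecI) auto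
      ultimately have "b $ 0 * m \<in> I" using eq Mc[of 0] 0 e0 by simp
      then obtain w where "w \<in> carrier_vec (length (f 1))" "b $ 0 = (N 0 *\<^sub>v w) $ 0"
        using colon augmented_resolutionD(3)[OF N] by blast
      then show ?thesis using 0 b Nc[of 0] f0 by (intro bexI[of _ w] eq_vecI) auto
    next
      case (Suc j)
      have bc: "b \<in> carrier_vec (length (f (Suc j)))" using ab(2) Suc by simp
      have "- (N j *\<^sub>v b) = 0\<^sub>v (length (f j))" using Rb Suc bc Nc[of j] by simp
      then have "N j *\<^sub>v b = 0\<^sub>v (length (f j))"
        using Nc[of j] bc by (metis mult_mat_vec_carrier uminus_uminus_vec uminus_zero_vec)
      then show ?thesis using augmented_resolutionD(5)[OF N bc] Suc by blast
    qed
    then obtain w where w: "w \<in> carrier_vec (length (f (Suc i)))" "b = N i *\<^sub>v w" by blast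
    \<comment> \<open>Adding the image of \<open>w\<close> under \<open>\<Phi> (Suc i)\<close> to
      \<open>a\<close> gives an element of the kernel of \<open>M i\<close>. A preimage
      \<open>x\<close> of it, completed by \<open>- w\<close>, is the required preimage of
      \<open>u\<close>.\<close>
    have Pw: "\<Phi> (Suc i) *\<^sub>v w \<in> carrier_vec (length (e (Suc i)))"
      using \<Phi>c w by (auto intro: mult_mat_vec_carrier)
    have "M i *\<^sub>v (\<Phi> (Suc i) *\<^sub>v w) = \<Phi> i *\<^sub>v b"
      unfolding w(2) using assoc_mult_mat_vec[OF Mc \<Phi>c w(1)] assoc_mult_mat_vec[OF \<Phi>c Nc w(1)] \<Phi>(3) by simp
    then have "M i *\<^sub>v (a + \<Phi> (Suc i) *\<^sub>v w) = 0\<^sub>v (length (e i))"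
      using mult_add_distrib_mat_vec[OF Mc ab(1) Pw] sum0 by simp
    then obtain x where x: "x \<in> carrier_vec (length (e (Suc (Suc i))))" "a + \<Phi> (Suc i) *\<^sub>v w = M (Suc i) *\<^sub>v x"
      using augmented_resolutionD(5)[OF M add_carrier_vec[OF ab(1) Pw]] by blast
    have wc: "- w \<in> carrier_vec (length (f (Suc i)))" using w(1) by simp
    have "M' (Suc i) *\<^sub>v (x @\<^sub>v - w) = (M (Suc i) *\<^sub>v x + \<Phi> (Suc i) *\<^sub>v (- w)) @\<^sub>v (- N i *\<^sub>v (- w))"
      using M'_mult[OF x(1) wc] by simp
    also have "\<Phi> (Suc i) *\<^sub>v (- w) = - (\<Phi> (Suc i) *\<^sub>v w)"
      using \<Phi>c[of "Suc i"] w(1) by (intro eq_vecI) auto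
    also have "M (Suc i) *\<^sub>v x + - (\<Phi> (Suc i) *\<^sub>v w) = a"
      unfolding x(2)[symmetric] using ab(1) Pw by (intro eq_vecI) auto
    also have "- N i *\<^sub>v (- w) = b"
      unfolding w(2) using Nc[of i] w(1) by (intro eq_vecI) auto
    finally have "u = M' (Suc i) *\<^sub>v (x @\<^sub>v - w)" using ab(3) by simp
    moreover have "x @\<^sub>v - w \<in> carrier_vec (length (e' (Suc (Suc i))))"
      using x(1) wc by (simp add: e'_def)
    ultimately show ?thesis by blast
  qed
  have minimal: "const_coeff (M' (Suc i) $$ (k, l)) = 0"
    if kl: "k < length (e' (Suc i))" "l < length (e' (Suc (Suc i)))" for i k l
  proof -
    have M'kl: "M' (Suc i) $$ (k, l) = (if k < length (e (Suc i))
        then (if l < length (e (Suc (Suc i))) then M (Suc i) $$ (k, l) else \<Phi> (Suc i) $$ (k, l - length (e (Suc (Suc i)))))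
        else (if l < length (e (Suc (Suc i))) then 0 else (- N i) $$ (k - length (e (Suc i)), l - length (e (Suc (Suc i))))))"
      using kl Mc[of "Suc i"] \<Phi>c[of "Suc i"] Nc[of i] by (auto simp: M'_def e'_def)
    have hom: "homogeneous (e' (Suc (Suc i)) ! l - e' (Suc i) ! k) (M' (Suc i) $$ (k, l))"
      using M'h[of "Suc i"] kl by (auto simp: hom_mat_def)
    show ?thesis
    proof (cases "l < length (e (Suc (Suc i)))")
      case True
      then show ?thesis using M'kl augmented_resolutionD(6)[OF M] by auto
    next
      \<comment> \<open>Columns from the resolution of \<open>Q\<close> have degree
        \<open>D + i + 1\<close>, and all rows have degree at most \<open>D + i\<close>: those from
        \<open>I\<close> by the bound on \<open>A\<close>, the others by linearity. This includes
        the block \<open>- N 0\<close>, about which minimality of \<open>N\<close> says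
        nothing.\<close>
      case False
      then have l: "e' (Suc (Suc i)) ! l = D + int (Suc i)"
        using kl(2) f_deg[of "f (Suc i) ! (l - length (e (Suc (Suc i))))" "Suc i"]
        by (simp add: e'_def f'_def nth_append)
      have "e' (Suc i) ! k \<le> D + int i"
      proof (cases "k < length (e (Suc i))")
        case True
        then have "e (Suc i) ! k - int i \<in> A" unfolding A using nth_mem by blast
        from A_le[OF this] show ?thesis using True by (simp add: e'_def nth_append)
      next
        case False
        then show ?thesis
          using kl(1) f_deg[of "f i ! (k - length (e (Suc i)))" i] by (simp add: e'_def f'_def nth_append)
      qed
      with l hom show ?thesis using homogeneous_const_coeff by fastforce
    qed
  qed
  have "augmented_resolution {q + p * m |q p. q \<in> I} e' M'"
    unfolding augmented_resolution_def
    using M'h image M'M' exact minimal by (auto simp: e'_def e0 r_def)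
  moreover have "insert D A = {x - int i |x i. x \<in> set (e' (Suc i))}"
  proof -
    have "{x - int i |x i. x \<in> set (e' (Suc i))} = A \<union> {x - int i |x i. x \<in> set (f' i)}"
      unfolding A e'_def rS by auto
    moreover have "{x - int i |x i. x \<in> set (f' i)} = {D}"
    proof
      show "{x - int i |x i. x \<in> set (f' i)} \<subseteq> {D}" using f_deg by (auto simp: f'_def)
      have "D \<in> set (f' 0)" by (simp add: f'_def f0)
      then show "{D} \<subseteq> {x - int i |x i. x \<in> set (f' i)}" by force
    qed
    ultimately show ?thesis by auto
  qed
  ultimately show ?thesis unfolding resolved_def by blast
qed

section \<open>Monomial ideals with linear quotients\<close>

lemma monomial_dvd_iff:
  fixes m t :: "'v \<Rightarrow>\<^sub>0 nat"
  shows "(\<exists>u. t = u + m) \<longleftrightarrow> (\<forall>v. Poly_Mapping.lookup m v \<le> Poly_Mapping.lookup t v)"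
proof
  assume "\<exists>u. t = u + m"
  then show "\<forall>v. Poly_Mapping.lookup m v \<le> Poly_Mapping.lookup t v" by (auto simp: lookup_add)
next
  assume "\<forall>v. Poly_Mapping.lookup m v \<le> Poly_Mapping.lookup t v"
  then have "t = (t - m) + m" by (intro poly_mapping_eqI) (simp add: lookup_add lookup_minus)
  then show "\<exists>u. t = u + m" ..
qed

lemma mem_monomial_ideal_le:
  "p \<in> ideal_generated (xpow ` M) \<longleftrightarrow>
    (\<forall>t\<in>Poly_Mapping.keys p. \<exists>m\<in>M. \<forall>v. Poly_Mapping.lookup m v \<le> Poly_Mapping.lookup t v)"
  unfolding mem_monomial_ideal monomial_dvd_iff ..

text \<open>Brings the adjunction of a generator into the form in which the mapping cone delivers
  it.\<close>

lemma ideal_generated_insert: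
  "ideal_generated (insert m A) = {q + p * m |q p. q \<in> ideal_generated A}"
proof -
  have "x - p * m \<in> ideal.span A \<longleftrightarrow> (\<exists>q\<in>ideal.span A. x = q + p * m)" for x p
    by (metis add_diff_cancel_right' diff_add_cancel)
  then show ?thesis
    unfolding ideal_generated_span ideal.span_insert by blast
qed

lemma colon_monomial_ideal:
  fixes p :: "('v, 'k::field) mpoly"
  shows "p * xpow m \<in> ideal_generated (xpow ` M) \<longleftrightarrow>
    (\<forall>t\<in>Poly_Mapping.keys p. \<exists>n\<in>M. \<forall>v. Poly_Mapping.lookup n v \<le> Poly_Mapping.lookup t v + Poly_Mapping.lookup m v)"
  by (simp add: mem_monomial_ideal_le keys_xpow_mult lookup_add)

text \<open>The variables form a regular sequence: the colon ideal of the previous ones by a new one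
  is again the ideal of the previous ones. Iterated cones thus build the Koszul complex; the set of
  values is empty for \<open>X = {}\<close>.\<close>

lemma resolved_variables:
  fixes X :: "'v::finite set"
  shows "\<exists>B\<subseteq>{1}. resolved (ideal_generated (xpow ` (\<lambda>x. Poly_Mapping.single x 1) ` X) :: ('v, 'k::field) mpoly set) B"
  using finite[of X]
proof induction
  case empty
  have "ideal_generated {} = ({0} :: ('v, 'k) mpoly set)" by (simp add: ideal_generated_span)
  then show ?case using resolved_zero_ideal by fastforce
next
  case (insert x X)
  let ?I = "ideal_generated (xpow ` (\<lambda>x. Poly_Mapping.single x 1) ` X) :: ('v, 'k) mpoly set"
  obtain B where B: "B \<subseteq> {1}" "resolved ?I B" using insert.IH by blast
  have hom: "homogeneous 1 (xpow (Poly_Mapping.single x 1) :: ('v, 'k) mpoly)"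
    by (simp add: homogeneous_xpow mdeg_def lookup_single when_def)
  have "p \<in> ?I \<longleftrightarrow> p * xpow (Poly_Mapping.single x 1) \<in> ?I" for p
  proof -
    have "(\<forall>v. Poly_Mapping.lookup (Poly_Mapping.single y (1::nat)) v \<le> Poly_Mapping.lookup t v) \<longleftrightarrow>
        (\<forall>v. Poly_Mapping.lookup (Poly_Mapping.single y 1) v \<le> Poly_Mapping.lookup t v + Poly_Mapping.lookup (Poly_Mapping.single x 1) v)"
      if "y \<in> X" for y and t :: "'v \<Rightarrow>\<^sub>0 nat"
      using that insert.hyps(2) by (auto simp: lookup_single when_def)
    then show ?thesis unfolding colon_monomial_ideal unfolding mem_monomial_ideal_le by simp
  qed
  \<comment> \<open>The same ideal serves as the ideal to be enlarged and as the colon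
    ideal.\<close>
  from resolved_add_generator[OF B(2,2,1) hom _ this] B(1)
  have "resolved (ideal_generated (insert (xpow (Poly_Mapping.single x 1)) (xpow ` (\<lambda>x. Poly_Mapping.single x 1) ` X)) :: ('v, 'k) mpoly set) (insert 1 B)"
    unfolding ideal_generated_insert by auto
  then show ?case using B(1) by (intro exI[of _ "insert 1 B"]) auto
qed

text \<open>The last two hypotheses compute the colon ideal of the earlier generators by the one of
  \<open>p\<close>: a variable of \<open>X p\<close> brings it into their ideal, and every earlier
  generator exceeds it in the exponent of some variable of \<open>X p\<close>. The second hypothesis
  makes the degrees nondecreasing along \<open>key\<close>, as the mapping cone demands.\<close>

lemma resolved_linear_quotients:
  fixes mon :: "'i \<Rightarrow> 'v::finite \<Rightarrow>\<^sub>0 nat" and key :: "'i \<Rightarrow> 'o::linorder"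
  assumes "finite P"
    and "\<And>p q. p \<in> P \<Longrightarrow> q \<in> P \<Longrightarrow> key q \<le> key p \<Longrightarrow> mdeg (mon q) \<le> mdeg (mon p)"
    and "\<And>p x. p \<in> P \<Longrightarrow> x \<in> X p \<Longrightarrow> \<exists>q\<in>P. key q < key p \<and>
      (\<forall>v. Poly_Mapping.lookup (mon q) v \<le> Poly_Mapping.lookup (mon p) v + of_bool (v = x))"
    and "\<And>p q. p \<in> P \<Longrightarrow> q \<in> P \<Longrightarrow> q \<noteq> p \<Longrightarrow> key q \<le> key p \<Longrightarrow>
      \<exists>x\<in>X p. Poly_Mapping.lookup (mon p) x < Poly_Mapping.lookup (mon q) x"
  shows "resolved (ideal_generated (xpow ` mon ` P) :: ('v, 'k::field) mpoly set) ((\<lambda>p. mdeg (mon p)) ` P)"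
  using assms
proof (induction P rule: finite_ranking_induct[where f = key])
  case empty
  then show ?case using resolved_zero_ideal by (simp add: ideal_generated_span)
next
  case (insert p S)
  show ?case
  proof (cases "p \<in> S")
    case True
    then have "insert p S = S" by blast
    with insert show ?thesis by simp
  next
    case False
    let ?I = "ideal_generated (xpow ` mon ` S) :: ('v, 'k) mpoly set"
    have step: "\<exists>q\<in>S. key q < key r \<and>
        (\<forall>v. Poly_Mapping.lookup (mon q) v \<le> Poly_Mapping.lookup (mon r) v + of_bool (v = x))"
      if rx: "r \<in> insert p S" "x \<in> X r" for r x
    proof -
      obtain q where q: "q \<in> insert p S" "key q < key r"
          "\<forall>v. Poly_Mapping.lookup (mon q) v \<le> Poly_Mapping.lookup (mon r) v + of_bool (v = x)"
        using insert.prems(2)[OF rx] by blast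
      \<comment> \<open>\<open>p\<close> has the largest key so far, so a strictly smaller key
        excludes \<open>q = p\<close>.\<close>
      have "key r \<le> key p" using rx(1) insert.hyps(2) by auto
      then have "q \<in> S" using q(1,2) by auto
      with q(2,3) show ?thesis by blast
    qed
    have I: "resolved ?I ((\<lambda>p. mdeg (mon p)) ` S)"
    proof (rule insert.IH)
      show "mdeg (mon q) \<le> mdeg (mon r)" if "r \<in> S" "q \<in> S" "key q \<le> key r" for r q
        using that by (intro insert.prems(1)) auto
      show "\<exists>q\<in>S. key q < key r \<and>
        (\<forall>v. Poly_Mapping.lookup (mon q) v \<le> Poly_Mapping.lookup (mon r) v + of_bool (v = x))"
        if "r \<in> S" "x \<in> X r" for r x using that by (intro step) auto
      show "\<exists>x\<in>X r. Poly_Mapping.lookup (mon r) x < Poly_Mapping.lookup (mon q) x"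
        if "r \<in> S" "q \<in> S" "q \<noteq> r" "key q \<le> key r" for r q
        using that by (intro insert.prems(3)) auto
    qed
    let ?Q = "ideal_generated (xpow ` (\<lambda>x. Poly_Mapping.single x 1) ` X p) :: ('v, 'k) mpoly set"
    obtain B where B: "B \<subseteq> {1}" "resolved ?Q B" using resolved_variables by blast
    have hom: "homogeneous (mdeg (mon p)) (xpow (mon p) :: ('v, 'k) mpoly)"
      by (simp add: homogeneous_xpow)
    have le: "d \<le> mdeg (mon p)" if "d \<in> (\<lambda>p. mdeg (mon p)) ` S" for d
      using that insert.prems(1) insert.hyps(2) by auto
    have "c \<in> ?Q \<longleftrightarrow> c * xpow (mon p) \<in> ?I" for c
    proof -
      have "(\<exists>x\<in>X p. \<forall>v. Poly_Mapping.lookup (Poly_Mapping.single x 1) v \<le> Poly_Mapping.lookup t v) \<longleftrightarrow>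
          (\<exists>q\<in>S. \<forall>v. Poly_Mapping.lookup (mon q) v \<le> Poly_Mapping.lookup t v + Poly_Mapping.lookup (mon p) v)"
        (is "?l \<longleftrightarrow> ?r") for t :: "'v \<Rightarrow>\<^sub>0 nat"
      proof
        assume ?l
        then obtain x where x: "x \<in> X p" "Poly_Mapping.lookup t x \<ge> 1"
          by (metis lookup_single_eq)
        obtain q where q: "q \<in> S"
            "\<forall>v. Poly_Mapping.lookup (mon q) v \<le> Poly_Mapping.lookup (mon p) v + of_bool (v = x)"
          using step[of p x] x(1) by blast
        have "Poly_Mapping.lookup (mon q) v \<le> Poly_Mapping.lookup t v + Poly_Mapping.lookup (mon p) v" for v
        proof -
          have "of_bool (v = x) \<le> Poly_Mapping.lookup t v" using x(2) by simp
          with q(2) show ?thesis by (metis add.commute add_left_mono order_trans)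
        qed
        then show ?r using q(1) by blast
      next
        assume ?r
        then obtain q where q: "q \<in> S"
            "\<And>v. Poly_Mapping.lookup (mon q) v \<le> Poly_Mapping.lookup t v + Poly_Mapping.lookup (mon p) v"
          by blast
        have "q \<noteq> p" using q(1) False by blast
        then obtain x where x: "x \<in> X p" "Poly_Mapping.lookup (mon p) x < Poly_Mapping.lookup (mon q) x"
          using insert.prems(3)[of p q] q(1) insert.hyps(2) by blast
        then have "Poly_Mapping.lookup t x \<ge> 1" using q(2)[of x] by linarith
        then show ?l using x(1) by (intro bexI[of _ x]) (auto simp: lookup_single when_def)
      qed
      then show ?thesis
        unfolding colon_monomial_ideal unfolding mem_monomial_ideal_le by simp
    qed
    from resolved_add_generator[OF I B(2,1) hom le this]
    show ?thesis by (simp add: ideal_generated_insert)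
  qed
qed

section \<open>Powers of monomial ideals\<close>

fun fold_sums :: "nat \<Rightarrow> 'a::comm_monoid_add set \<Rightarrow> 'a set" where
  "fold_sums 0 L = {0}"
| "fold_sums (Suc s) L = {a + b |a b. a \<in> fold_sums s L \<and> b \<in> L}"

lemma ideal_generated_superset: "A \<subseteq> ideal_generated A"
  unfolding ideal_generated_span by (rule ideal.span_superset)

lemma ideal_generated_subset:
  "A \<subseteq> ideal_generated B \<Longrightarrow> ideal_generated A \<subseteq> ideal_generated B"
  unfolding ideal_generated_span by (rule ideal.span_minimal[OF _ ideal.subspace_span])

text \<open>\<open>ideal_power\<close> is generated by products of arbitrary elements of the ideal.
  Every monomial of such a product is a product of monomials of the factors, hence a multiple of a
  product of \<open>s\<close> generators.\<close>

lemma ideal_power_monomial: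
  fixes L :: "('v \<Rightarrow>\<^sub>0 nat) set"
  shows "ideal_power (ideal_generated (xpow ` L) :: ('v, 'k::field) mpoly set) s =
    ideal_generated (xpow ` fold_sums s L)"
proof
  have "(\<Prod>i<n. f i) \<in> ideal_generated (xpow ` fold_sums n L)"
    if "\<forall>i<n. f i \<in> ideal_generated (xpow ` L)" for n and f :: "nat \<Rightarrow> ('v, 'k) mpoly"
    using that
  proof (induction n)
    case 0
    then show ?case by (simp add: ideal_generated_span ideal.span_base)
  next
    case (Suc n)
    have A: "\<forall>t\<in>Poly_Mapping.keys (\<Prod>i<n. f i). \<exists>m\<in>fold_sums n L. \<exists>u. t = u + m"
      using Suc.IH Suc.prems unfolding mem_monomial_ideal by (meson less_SucI)
    have B: "\<forall>t\<in>Poly_Mapping.keys (f n). \<exists>m\<in>L. \<exists>u. t = u + m"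
      using Suc.prems unfolding mem_monomial_ideal by (meson lessI)
    have "\<exists>m\<in>fold_sums (Suc n) L. \<exists>u. t = u + m" if t: "t \<in> Poly_Mapping.keys ((\<Prod>i<n. f i) * f n)" for t
    proof -
      obtain a b where ab: "t = a + b" "a \<in> Poly_Mapping.keys (\<Prod>i<n. f i)" "b \<in> Poly_Mapping.keys (f n)"
        using t keys_mult by blast
      obtain m u where m: "m \<in> fold_sums n L" "a = u + m" using A ab(2) by blast
      obtain m' u' where m': "m' \<in> L" "b = u' + m'" using B ab(3) by blast
      have "t = (u + u') + (m + m')" using ab(1) m(2) m'(2) by (simp add: ac_simps)
      moreover have "m + m' \<in> fold_sums (Suc n) L" using m(1) m'(1) by auto
      ultimately show ?thesis by blast
    qed
    then have "(\<Prod>i<n. f i) * f n \<in> ideal_generated (xpow ` fold_sums (Suc n) L)"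
      unfolding mem_monomial_ideal by blast
    then show ?case by (simp del: fold_sums.simps)
  qed
  then show "ideal_power (ideal_generated (xpow ` L) :: ('v, 'k) mpoly set) s \<subseteq> ideal_generated (xpow ` fold_sums s L)"
    unfolding ideal_power_def by (intro ideal_generated_subset) blast
  have "\<exists>f. (\<forall>i<n. f i \<in> (ideal_generated (xpow ` L) :: ('v, 'k) mpoly set)) \<and> xpow t = (\<Prod>i<n. f i)"
    if "t \<in> fold_sums n L" for n t
    using that
  proof (induction n arbitrary: t)
    case 0
    then show ?case by simp
  next
    case (Suc n)
    then obtain a b where ab: "a \<in> fold_sums n L" "b \<in> L" "t = a + b" by auto
    obtain f where f: "\<forall>i<n. f i \<in> (ideal_generated (xpow ` L) :: ('v, 'k) mpoly set)" "xpow a = (\<Prod>i<n. f i)"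
      using Suc.IH[OF ab(1)] by blast
    have "xpow b \<in> (ideal_generated (xpow ` L) :: ('v, 'k) mpoly set)"
      using ab(2) by (simp add: ideal_generated_span ideal.span_base)
    moreover have "xpow t = xpow a * (xpow b :: ('v, 'k) mpoly)"
      by (simp add: ab(3) mult_single)
    moreover have "(\<Prod>i<n. (f(n := xpow b)) i) = (\<Prod>i<n. f i)" by (intro prod.cong) auto
    ultimately show ?case
      using f by (intro exI[of _ "f(n := xpow b)"]) (auto simp: less_Suc_eq)
  qed
  note product = this
  show "ideal_generated (xpow ` fold_sums s L) \<subseteq> ideal_power (ideal_generated (xpow ` L) :: ('v, 'k) mpoly set) s"
    unfolding ideal_power_def
  proof (rule ideal_generated_subset, rule subsetI)
    fix p :: "('v, 'k) mpoly" assume "p \<in> xpow ` fold_sums s L"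
    then obtain t where t: "t \<in> fold_sums s L" "p = xpow t" by (rule imageE)
    obtain f where f: "\<forall>i<s. f i \<in> (ideal_generated (xpow ` L) :: ('v, 'k) mpoly set)" "p = (\<Prod>i<s. f i)"
      using product[OF t(1)] unfolding t(2) by (elim exE conjE)
    have "p \<in> {\<Prod>i<s. f i |f. \<forall>i<s. f i \<in> (ideal_generated (xpow ` L) :: ('v, 'k) mpoly set)}"
      using f by (intro CollectI exI[of _ f] conjI)
    then show "p \<in> ideal_generated {\<Prod>i<s. f i |f. \<forall>i<s. f i \<in> (ideal_generated (xpow ` L) :: ('v, 'k) mpoly set)}"
      using ideal_generated_superset by (rule rev_subsetD)
  qed
qed

section \<open>Exponents of the powers of the cover ideal\<close>

text \<open>Over the finite type \<open>'v\<close> every function has finite support, so this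
  conversion loses nothing.\<close>

abbreviation expo :: "('v::finite \<Rightarrow> nat) \<Rightarrow> 'v \<Rightarrow>\<^sub>0 nat" where
  "expo \<equiv> Abs_poly_mapping"

lemma expo_add: "expo (\<lambda>x. f x + g x) = expo f + expo g"
  by (rule poly_mapping_eqI) (simp add: lookup_add)

lemma mdeg_expo: "mdeg (expo f) = int (\<Sum>x\<in>UNIV. f x)"
  by (simp add: mdeg_def)

text \<open>In the application the minimal covers are the sets \<open>N v\<close> for \<open>v \<in> K\<close> and the sets with
  indicator function \<open>n b\<close> for \<open>w b = 1\<close>. More generally \<open>n b\<close>, for \<open>b \<in> J\<close> with \<open>w b = t\<close>, are the
  sums of \<open>t\<close> covers of the second kind.\<close>

locale cover_exponents =
  fixes K :: "'v::finite set" and N :: "'v \<Rightarrow> 'v set"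
    and J :: "'b::linorder set" and w :: "'b \<Rightarrow> nat" and n :: "'b \<Rightarrow> 'v \<Rightarrow> nat"
    and X :: "'b \<Rightarrow> 'v set" and d :: nat
  assumes N_K: "v \<in> K \<Longrightarrow> N v \<inter> K = K - {v}"
    and n_K: "b \<in> J \<Longrightarrow> x \<in> K \<Longrightarrow> n b x = w b"
    and finite_J: "finite {b \<in> J. w b = t}"
    and J_degree: "b \<in> J \<Longrightarrow> (\<Sum>x\<in>UNIV. n b x) = d * w b"
    and N_degree: "v \<in> K \<Longrightarrow> d \<le> card (N v)"
    and J_step: "b \<in> J \<Longrightarrow> v \<in> K \<Longrightarrow>
      \<exists>b'\<in>J. w b' = Suc (w b) \<and> (\<forall>x. n b' x \<le> n b x + of_bool (x \<in> insert v (N v)))"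
    and X_step: "b \<in> J \<Longrightarrow> x \<in> X b \<Longrightarrow>
      \<exists>b'\<in>J. w b' = w b \<and> b' < b \<and> (\<forall>y. n b' y \<le> n b y + of_bool (y = x))"
    and X_witness: "b \<in> J \<Longrightarrow> b' \<in> J \<Longrightarrow> w b' = w b \<Longrightarrow> b' < b \<Longrightarrow> \<exists>x\<in>X b. n b x < n b' x"
    and J_zero: "\<exists>b\<in>J. w b = t" "b \<in> J \<Longrightarrow> w b = 0 \<Longrightarrow> n b x = 0"
    and J_add: "b \<in> J \<Longrightarrow> c \<in> J \<Longrightarrow> w c = 1 \<Longrightarrow>
      \<exists>b'\<in>J. w b' = Suc (w b) \<and> (\<forall>x. n b' x = n b x + n c x)"
    and J_split: "b \<in> J \<Longrightarrow> w b = Suc t \<Longrightarrow>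
      \<exists>b'\<in>J. \<exists>c\<in>J. w b' = t \<and> w c = 1 \<and> (\<forall>x. n b x = n b' x + n c x)"
begin

text \<open>\<open>a v\<close> counts the factors \<open>N v\<close>; the remaining
  \<open>w b\<close> factors are recorded by \<open>b\<close>.\<close>

fun mon :: "('v \<Rightarrow> nat) \<times> 'b \<Rightarrow> 'v \<Rightarrow> nat" where
  "mon (a, b) x = (\<Sum>v\<in>K. a v * of_bool (x \<in> N v)) + n b x"

text \<open>\<open>a\<close> vanishes outside \<open>K\<close> so that it is determined by the
  multiplicities and the set is finite.\<close>

definition indices :: "nat \<Rightarrow> (('v \<Rightarrow> nat) \<times> 'b) set" where
  "indices s = {(a, b). (\<forall>v. v \<notin> K \<longrightarrow> a v = 0) \<and> b \<in> J \<and> (\<Sum>v\<in>K. a v) + w b = s}"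

lemma mon_degree:
  assumes "b \<in> J"
  shows "(\<Sum>x\<in>UNIV. mon (a, b) x) = (\<Sum>v\<in>K. a v * card (N v)) + d * w b"
proof -
  have "(\<Sum>x\<in>UNIV. \<Sum>v\<in>K. a v * of_bool (x \<in> N v)) = (\<Sum>v\<in>K. \<Sum>x\<in>UNIV. a v * of_bool (x \<in> N v))"
    by (rule sum.swap)
  also have "\<dots> = (\<Sum>v\<in>K. a v * card (N v))"
    by (simp add: flip: sum_distrib_left)
  finally show ?thesis using J_degree[OF assms] by (simp add: sum.distrib)
qed

text \<open>Only the factors \<open>N x\<close> miss the vertex \<open>x\<close> of
  \<open>K\<close>; each other factor contributes 1 to its exponent. Hence the multiplicities can be
  read off the monomial.\<close>

lemma mon_K:
  assumes "(a, b) \<in> indices s" "x \<in> K"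
  shows "mon (a, b) x + a x = s"
proof -
  have "(\<Sum>v\<in>K. a v * of_bool (x \<in> N v)) = (\<Sum>v\<in>K - {x}. a v)"
  proof -
    have "x \<in> N v \<longleftrightarrow> v \<noteq> x" if "v \<in> K" for v using N_K[OF that] assms(2) by blast
    then have "(\<Sum>v\<in>K. a v * of_bool (x \<in> N v)) = (\<Sum>v\<in>K. if v = x then 0 else a v)"
      by (intro sum.cong) auto
    also have "\<dots> = (\<Sum>v\<in>K - {x}. a v)"
      by (intro sum.mono_neutral_cong_right) auto
    finally show ?thesis .
  qed
  then show ?thesis
    using assms n_K[of b x] sum.remove[of K x a] by (simp add: indices_def)
qed

lemma finite_indices: "finite (indices s)"
proof -
  have "indices s \<subseteq> {a. \<forall>v. a v \<le> s} \<times> (\<Union>t\<in>{..s}. {b \<in> J. w b = t})"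
  proof
    fix p assume p: "p \<in> indices s"
    obtain a b where ab: "p = (a, b)" by fastforce
    have "a v \<le> s" for v
    proof (cases "v \<in> K")
      case True
      then have "a v \<le> (\<Sum>v\<in>K. a v)" by (intro member_le_sum) auto
      then show ?thesis using p ab by (simp add: indices_def)
    next
      case False
      then show ?thesis using p ab by (simp add: indices_def)
    qed
    then show "p \<in> {a. \<forall>v. a v \<le> s} \<times> (\<Union>t\<in>{..s}. {b \<in> J. w b = t})"
      using p ab by (auto simp: indices_def)
  qed
  moreover have "finite {a :: 'v \<Rightarrow> nat. \<forall>v. a v \<le> s}"
    using finite_PiE[of "UNIV :: 'v set" "\<lambda>_. {..s}"] by (simp add: PiE_def Pi_def)
  ultimately show ?thesis
    using finite_J by (auto intro: finite_subset)
qed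

text \<open>The effect of removing one factor \<open>N v\<close>. The weight \<open>c\<close> is 1
  for the number of factors, \<open>card (N u)\<close> for the degree and an indicator for a single
  exponent.\<close>

lemma sum_fun_upd_pred:
  fixes a :: "'v \<Rightarrow> nat" and c :: "'v \<Rightarrow> nat"
  assumes "v \<in> K" "a v > 0"
  shows "(\<Sum>u\<in>K. (a(v := a v - 1)) u * c u) + c v = (\<Sum>u\<in>K. a u * c u)"
proof -
  have "(\<Sum>u\<in>K - {v}. (a(v := a v - 1)) u * c u) = (\<Sum>u\<in>K - {v}. a u * c u)"
    by (intro sum.cong) auto
  moreover have "(a v - 1) * c v + c v = a v * c v"
    using assms(2) by (cases "a v") auto
  ultimately show ?thesis
    using sum.remove[OF _ assms(1), of "\<lambda>u. (a(v := a v - 1)) u * c u"]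
      sum.remove[OF _ assms(1), of "\<lambda>u. a u * c u"] by simp
qed

text \<open>The colon variables stem from two kinds of trades: a factor \<open>N x\<close> becomes a
  cover of the second kind at the cost of \<open>x\<close>, or \<open>b\<close> alone is changed by
  \<open>X_step\<close>. They suffice because a smaller multiplicity of \<open>N v\<close> shows in
  the exponent of \<open>v\<close>, and with equal multiplicities only \<open>b\<close>
  differs.\<close>

lemma resolved_indices:
  "resolved (ideal_generated (xpow ` expo ` mon ` indices s) :: ('v, 'k::field) mpoly set)
    ((\<lambda>p. int (\<Sum>x\<in>UNIV. mon p x)) ` indices s)"
proof -
  \<comment> \<open>The degree comes first, as the cones require. The number of neighborhoods comes
    second, because a trade with \<open>card (N v) = d\<close> keeps the degree.\<close>
  let ?key = "\<lambda>(a, b). (\<Sum>x\<in>UNIV. mon (a, b) x, \<Sum>v\<in>K. a v, b)"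
  let ?X = "\<lambda>(a, b). {v \<in> K. a v > 0} \<union> X b"
  have "resolved (ideal_generated (xpow ` (\<lambda>p. expo (mon p)) ` indices s) :: ('v, 'k) mpoly set)
    ((\<lambda>p. mdeg (expo (mon p))) ` indices s)"
  proof (rule resolved_linear_quotients[where key = ?key and X = ?X])
    show "finite (indices s)" by (rule finite_indices)
    show "mdeg (expo (mon q)) \<le> mdeg (expo (mon p))" if "?key q \<le> ?key p" for p q
      using that unfolding mdeg_expo of_nat_le_iff
      by (cases p; cases q) (auto simp: less_eq_prod_def simp del: mon.simps)
  next
    fix p x assume p: "p \<in> indices s" and x: "x \<in> ?X p"
    obtain a b where ab: "p = (a, b)" by fastforce
    have I: "\<forall>v. v \<notin> K \<longrightarrow> a v = 0" "b \<in> J" "(\<Sum>v\<in>K. a v) + w b = s"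
      using p ab by (auto simp: indices_def)
    have "\<exists>q\<in>indices s. ?key q < ?key p \<and> (\<forall>v. mon q v \<le> mon p v + of_bool (v = x))"
    proof (cases "x \<in> K \<and> a x > 0")
      case True
      then obtain b' where b': "b' \<in> J" "w b' = Suc (w b)"
          "\<forall>y. n b' y \<le> n b y + of_bool (y \<in> insert x (N x))"
        using J_step I(2) by blast
      let ?a = "a(x := a x - 1)"
      have sum_a: "(\<Sum>v\<in>K. ?a v) + 1 = (\<Sum>v\<in>K. a v)"
        using sum_fun_upd_pred[of x a "\<lambda>_. 1"] True by simp
      have mem: "(?a, b') \<in> indices s"
        using I b' sum_a True by (auto simp: indices_def)
      have "mon (?a, b') v \<le> mon (a, b) v + of_bool (v = x)" for v
      proof -
        have "(\<Sum>u\<in>K. ?a u * of_bool (v \<in> N u)) + of_bool (v \<in> N x) = (\<Sum>u\<in>K. a u * of_bool (v \<in> N u))"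
          by (rule sum_fun_upd_pred) (use True in auto)
        moreover have "n b' v \<le> n b v + of_bool (v \<in> insert x (N x))" using b'(3) by blast
        moreover have "of_bool (v \<in> insert x (N x)) \<le> of_bool (v \<in> N x) + (of_bool (v = x) :: nat)" by simp
        ultimately show ?thesis unfolding mon.simps by linarith
      qed
      moreover have "?key (?a, b') < ?key (a, b)"
      proof -
        have "(\<Sum>v\<in>K. ?a v * card (N v)) + card (N x) = (\<Sum>v\<in>K. a v * card (N v))"
          by (rule sum_fun_upd_pred) (use True in auto)
        moreover have "d * w b' = d * w b + d" using b'(2) by simp
        moreover have "d \<le> card (N x)" using N_degree True by blast
        ultimately have "(\<Sum>x\<in>UNIV. mon (?a, b') x) \<le> (\<Sum>x\<in>UNIV. mon (a, b) x)"
          unfolding mon_degree[OF b'(1)] mon_degree[OF I(2)] by linarith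
        then show ?thesis using sum_a by (simp add: less_prod_def del: mon.simps)
      qed
      ultimately show ?thesis using mem ab by blast
    next
      case False
      then have "x \<in> X b" using x ab by auto
      then obtain b' where b': "b' \<in> J" "w b' = w b" "b' < b" "\<forall>y. n b' y \<le> n b y + of_bool (y = x)"
        using X_step I(2) by blast
      have "(a, b') \<in> indices s" using I b' by (simp add: indices_def)
      moreover have "(\<Sum>x\<in>UNIV. mon (a, b') x) = (\<Sum>x\<in>UNIV. mon (a, b) x)"
        unfolding mon_degree[OF b'(1)] mon_degree[OF I(2)] b'(2) ..
      then have "?key (a, b') < ?key (a, b)"
        using b'(3) by (simp add: less_prod_def del: mon.simps)
      moreover have "\<forall>v. mon (a, b') v \<le> mon (a, b) v + of_bool (v = x)"
        using b'(4) by (simp only: mon.simps add.assoc add_le_cancel_left simp_thms)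
      ultimately show ?thesis using ab by blast
    qed
    then show "\<exists>q\<in>indices s. ?key q < ?key p \<and> (\<forall>v. Poly_Mapping.lookup (expo (mon q)) v
        \<le> Poly_Mapping.lookup (expo (mon p)) v + of_bool (v = x))"
      by simp
  next
    fix p q assume p: "p \<in> indices s" and q: "q \<in> indices s" and neq: "q \<noteq> p" and le: "?key q \<le> ?key p"
    obtain a b a' b' where ab: "p = (a, b)" "q = (a', b')" by fastforce
    have I: "\<forall>v. v \<notin> K \<longrightarrow> a v = 0" "b \<in> J" "(\<Sum>v\<in>K. a v) + w b = s"
      and I': "\<forall>v. v \<notin> K \<longrightarrow> a' v = 0" "b' \<in> J" "(\<Sum>v\<in>K. a' v) + w b' = s"
      using p q ab by (auto simp: indices_def)
    have "\<exists>x\<in>?X p. mon p x < mon q x"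
    proof (cases "\<exists>v\<in>K. a' v < a v")
      case True
      then obtain v where v: "v \<in> K" "a' v < a v" by blast
      \<comment> \<open>Both sides are \<open>s\<close>, so fewer factors \<open>N v\<close> mean a
        larger exponent of \<open>v\<close>.\<close>
      have "mon p v + a v = mon q v + a' v"
        using mon_K[of a b s v] mon_K[of a' b' s v] p q ab v(1) by simp
      then have "mon p v < mon q v" using v(2) by linarith
      then show ?thesis using v ab by (intro bexI[of _ v]) auto
    next
      case False
      then have ge: "a v \<le> a' v" for v using I(1) by (cases "v \<in> K") (auto simp: not_less)
      have sum_ge: "(\<Sum>v\<in>K. a v) \<le> (\<Sum>v\<in>K. a' v)" using ge by (intro sum_mono) auto
      \<comment> \<open>Each surplus neighborhood in \<open>q\<close> has degree at least
        \<open>d\<close>, the degree of the cover that it displaces. So \<open>q\<close> has at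
        least the degree of \<open>p\<close>; being no later in the order, it cannot have more
        neighborhoods, and then \<open>a' = a\<close>.\<close>
      have deg: "(\<Sum>v\<in>K. a v * card (N v)) + d * (\<Sum>v\<in>K. a' v) \<le> (\<Sum>v\<in>K. a' v * card (N v)) + d * (\<Sum>v\<in>K. a v)"
      proof -
        have "a v * card (N v) + d * a' v \<le> a' v * card (N v) + d * a v" if "v \<in> K" for v
        proof -
          obtain e where e: "a' v = a v + e" using ge[of v] le_Suc_ex by blast
          have "d * e \<le> card (N v) * e" using N_degree[OF that] by simp
          then show ?thesis unfolding e by (simp add: algebra_simps)
        qed
        then have "(\<Sum>v\<in>K. a v * card (N v) + d * a' v) \<le> (\<Sum>v\<in>K. a' v * card (N v) + d * a v)"
          by (rule sum_mono)
        then show ?thesis by (simp add: sum.distrib sum_distrib_left)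
      qed
      have "d * (\<Sum>v\<in>K. a v) + d * w b = d * (\<Sum>v\<in>K. a' v) + d * w b'"
        using I(3) I'(3) by (metis distrib_left)
      with deg have deg': "(\<Sum>x\<in>UNIV. mon (a, b) x) \<le> (\<Sum>x\<in>UNIV. mon (a', b') x)"
        unfolding mon_degree[OF I(2)] mon_degree[OF I'(2)] by linarith
      have "(\<Sum>v\<in>K. a' v) \<le> (\<Sum>v\<in>K. a v)"
        using le ab deg' by (auto simp: less_eq_prod_def simp del: mon.simps)
      then have sum_eq: "(\<Sum>v\<in>K. a' v) = (\<Sum>v\<in>K. a v)" using sum_ge by linarith
      have "a' v = a v" for v
      proof (cases "v \<in> K")
        case True
        show ?thesis
        proof (rule ccontr)
          assume "a' v \<noteq> a v"
          then have "(\<Sum>v\<in>K. a v) < (\<Sum>v\<in>K. a' v)"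
            using ge True by (intro sum_strict_mono_ex1) (auto simp: nat_less_le intro!: bexI[of _ v])
          then show False using sum_eq by linarith
        qed
      qed (use I I' in auto)
      then have a: "a' = a" by blast
      then have wb: "w b' = w b" using I(3) I'(3) by simp
      have "(\<Sum>x\<in>UNIV. mon (a', b') x) = (\<Sum>x\<in>UNIV. mon (a, b) x)"
        unfolding mon_degree[OF I(2)] mon_degree[OF I'(2)] a wb ..
      then have "b' \<le> b" using le ab a by (auto simp: less_eq_prod_def simp del: mon.simps)
      then have "b' < b" using neq ab a by (simp add: order.strict_iff_order)
      then obtain x where "x \<in> X b" "n b x < n b' x" using X_witness[OF I(2) I'(2) wb] by blast
      then show ?thesis using ab a by (intro bexI[of _ x]) auto
    qed
    then show "\<exists>x\<in>?X p. Poly_Mapping.lookup (expo (mon p)) x < Poly_Mapping.lookup (expo (mon q)) x"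
      by simp
  qed
  then show ?thesis by (simp only: image_image mdeg_expo)
qed

text \<open>One more factor either raises a multiplicity or is absorbed into \<open>b\<close> by
  \<open>J_add\<close>. Conversely, a factor \<open>N v\<close> is removed if there is one, and
  otherwise \<open>J_split\<close> takes a factor out of \<open>b\<close>.\<close>

lemma fold_sums_indices:
  "fold_sums s (expo ` ((\<lambda>v x. of_bool (x \<in> N v)) ` K \<union> n ` {b \<in> J. w b = 1})) =
    expo ` mon ` indices s"
proof (induction s)
  case 0
  obtain b where b: "b \<in> J" "w b = 0" using J_zero(1) by blast
  then have "(\<lambda>_. 0, b) \<in> indices 0" by (simp add: indices_def)
  then have "indices 0 \<noteq> {}" by blast
  moreover have "mon p = (\<lambda>_. 0)" if "p \<in> indices 0" for p
    using that J_zero(2) by (cases p) (auto simp: indices_def fun_eq_iff)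
  then have "mon ` indices 0 = (\<lambda>_ _. 0) ` indices 0" by (rule image_cong[OF refl])
  ultimately have "mon ` indices 0 = {\<lambda>_. 0}" by (simp add: image_constant_conv)
  then show ?case by simp
next
  case (Suc s)
  let ?L = "expo ` ((\<lambda>v x. of_bool (x \<in> N v)) ` K \<union> n ` {b \<in> J. w b = 1})"
  show ?case
  proof (intro equalityI subsetI)
    fix m assume "m \<in> fold_sums (Suc s) ?L"
    then obtain p l where pl: "p \<in> indices s" "l \<in> ?L" "m = expo (mon p) + l"
      unfolding fold_sums.simps Suc.IH by blast
    obtain a b where ab: "p = (a, b)" by fastforce
    have I: "\<forall>v. v \<notin> K \<longrightarrow> a v = 0" "b \<in> J" "(\<Sum>v\<in>K. a v) + w b = s"
      using pl(1) ab by (auto simp: indices_def)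
    have "\<exists>q\<in>indices (Suc s). m = expo (mon q)"
    proof (cases "\<exists>v\<in>K. l = expo (\<lambda>x. of_bool (x \<in> N v))")
      case True
      then obtain v where v: "v \<in> K" "l = expo (\<lambda>x. of_bool (x \<in> N v))" by blast
      let ?a = "a(v := Suc (a v))"
      have upd: "(\<Sum>u\<in>K. a u * c u) + c v = (\<Sum>u\<in>K. ?a u * c u)" for c :: "'v \<Rightarrow> nat"
        using sum_fun_upd_pred[of v ?a c] v(1) by (simp add: fun_upd_idem)
      have "(?a, b) \<in> indices (Suc s)"
        using I v(1) upd[of "\<lambda>_. 1"] by (auto simp: indices_def)
      moreover have "mon (?a, b) = (\<lambda>x. mon (a, b) x + of_bool (x \<in> N v))"
        unfolding mon.simps upd[symmetric] by (simp add: ac_simps)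
      then have "m = expo (mon (?a, b))" unfolding pl(3) v(2) ab expo_add[symmetric] by simp
      ultimately show ?thesis by blast
    next
      case False
      then obtain c where c: "c \<in> J" "w c = 1" "l = expo (n c)" using pl(2) by auto
      obtain b' where b': "b' \<in> J" "w b' = Suc (w b)" "\<forall>x. n b' x = n b x + n c x"
        using J_add[OF I(2) c(1,2)] by blast
      have "(a, b') \<in> indices (Suc s)" using I b' by (simp add: indices_def)
      moreover have "mon (a, b') = (\<lambda>x. mon (a, b) x + n c x)" using b'(3) by (simp add: fun_eq_iff)
      then have "m = expo (mon (a, b'))" unfolding pl(3) c(3) ab expo_add[symmetric] by simp
      ultimately show ?thesis by blast
    qed
    then show "m \<in> expo ` mon ` indices (Suc s)" by blast
  next
    fix m assume "m \<in> expo ` mon ` indices (Suc s)"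
    then obtain a b where ab: "(a, b) \<in> indices (Suc s)" "m = expo (mon (a, b))" by auto
    have I: "\<forall>v. v \<notin> K \<longrightarrow> a v = 0" "b \<in> J" "(\<Sum>v\<in>K. a v) + w b = Suc s"
      using ab by (auto simp: indices_def)
    have "\<exists>q\<in>indices s. \<exists>l\<in>?L. m = expo (mon q) + l"
    proof (cases "\<exists>v\<in>K. a v > 0")
      case True
      then obtain v where v: "v \<in> K" "a v > 0" by blast
      let ?a = "a(v := a v - 1)"
      note upd = sum_fun_upd_pred[where a = a, OF v]
      have "(?a, b) \<in> indices s"
        using I v upd[of "\<lambda>_. 1"] by (auto simp: indices_def)
      moreover have "mon (a, b) = (\<lambda>x. mon (?a, b) x + of_bool (x \<in> N v))"
        unfolding mon.simps upd[symmetric] by (simp add: ac_simps)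
      then have "m = expo (mon (?a, b)) + expo (\<lambda>x. of_bool (x \<in> N v))"
        unfolding ab(2) expo_add[symmetric] by simp
      ultimately show ?thesis using v(1) by blast
    next
      case False
      then have "w b = Suc s" using I(3) by simp
      then obtain b' c where b': "b' \<in> J" "c \<in> J" "w b' = s" "w c = 1" "\<forall>x. n b x = n b' x + n c x"
        using J_split[OF I(2)] by blast
      have "(a, b') \<in> indices s" using I b' False by (simp add: indices_def)
      moreover have "mon (a, b) = (\<lambda>x. mon (a, b') x + n c x)" using b'(5) by (simp add: fun_eq_iff)
      then have "m = expo (mon (a, b')) + expo (n c)"
        unfolding ab(2) expo_add[symmetric] by simp
      ultimately show ?thesis using b'(2,4) by blast
    qed
    then show "m \<in> fold_sums (Suc s) ?L" unfolding fold_sums.simps Suc.IH by blast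
  qed
qed

text \<open>The degree is linear in the multiplicities, so it is largest when all \<open>s\<close>
  factors have the largest size.\<close>

lemma Max_mon_degree:
  assumes le: "\<And>v. v \<in> K \<Longrightarrow> card (N v) \<le> D" "d \<le> D"
    and attained: "d = D \<or> (\<exists>v\<in>K. card (N v) = D)"
  shows "Max ((\<lambda>p. int (\<Sum>x\<in>UNIV. mon p x)) ` indices s) = int s * int D"
proof (rule Max_eqI)
  show "finite ((\<lambda>p. int (\<Sum>x\<in>UNIV. mon p x)) ` indices s)" using finite_indices by simp
  fix y assume "y \<in> (\<lambda>p. int (\<Sum>x\<in>UNIV. mon p x)) ` indices s"
  then obtain a b where ab: "(a, b) \<in> indices s" "y = int (\<Sum>x\<in>UNIV. mon (a, b) x)" by auto
  have "b \<in> J" and s: "(\<Sum>v\<in>K. a v) + w b = s" using ab by (auto simp: indices_def)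
  have "(\<Sum>v\<in>K. a v * card (N v)) \<le> (\<Sum>v\<in>K. a v * D)"
    using le(1) by (intro sum_mono mult_left_mono) auto
  moreover have "d * w b \<le> D * w b" using le(2) by simp
  moreover have "(\<Sum>v\<in>K. a v * D) + D * w b = s * D"
    unfolding s[symmetric] by (simp add: distrib_right mult.commute[of D] flip: sum_distrib_right)
  ultimately have "(\<Sum>x\<in>UNIV. mon (a, b) x) \<le> s * D"
    unfolding mon_degree[OF \<open>b \<in> J\<close>] by linarith
  then show "y \<le> int s * int D" unfolding ab(2) by (metis of_nat_le_iff of_nat_mult)
next
  have "\<exists>p\<in>indices s. (\<Sum>x\<in>UNIV. mon p x) = s * D"
    using attained
  proof
    assume "d = D"
    obtain b where b: "b \<in> J" "w b = s" using J_zero(1) by blast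
    then have "(\<lambda>_. 0, b) \<in> indices s" by (simp add: indices_def)
    moreover have "(\<Sum>x\<in>UNIV. mon (\<lambda>_. 0, b) x) = s * D"
      unfolding mon_degree[OF b(1)] using b(2) \<open>d = D\<close> by simp
    ultimately show ?thesis by blast
  next
    assume "\<exists>v\<in>K. card (N v) = D"
    then obtain v where v: "v \<in> K" "card (N v) = D" by blast
    obtain b where b: "b \<in> J" "w b = 0" using J_zero(1) by blast
    let ?a = "\<lambda>u. if u = v then s else 0"
    have "(?a, b) \<in> indices s" using b v(1) by (auto simp: indices_def)
    moreover have "(\<Sum>x\<in>UNIV. mon (?a, b) x) = s * D"
      unfolding mon_degree[OF b(1)] using b(2) v
      by (simp add: if_distrib[of "\<lambda>z. z * _"] cong: if_cong)
    ultimately show ?thesis by blast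
  qed
  then obtain p where "p \<in> indices s" "(\<Sum>x\<in>UNIV. mon p x) = s * D" by blast
  then show "int s * int D \<in> (\<lambda>p. int (\<Sum>x\<in>UNIV. mon p x)) ` indices s"
    by (intro image_eqI[of _ _ p]) (simp_all only: of_nat_mult)
qed

lemma regularity_power:
  assumes "\<And>v. v \<in> K \<Longrightarrow> card (N v) \<le> D" "d \<le> D" "d = D \<or> (\<exists>v\<in>K. card (N v) = D)"
  shows "regularity (ideal_power (ideal_generated (xpow ` expo `
      ((\<lambda>v x. of_bool (x \<in> N v)) ` K \<union> n ` {b \<in> J. w b = 1})) :: ('v, 'k::field) mpoly set) s) = int s * int D"
  unfolding ideal_power_monomial fold_sums_indices regularity_resolved[OF resolved_indices]
  by (rule Max_mon_degree[OF assms])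

end

section \<open>Structure of the graphs\<close>

text \<open>Distinctness is stated in \<open>no_C4\<close> only for the two nonadjacent pairs, since
  adjacent vertices are distinct by \<open>irrefl\<close>. In \<open>no_2K2\<close> a common vertex
  of the two edges would itself produce one of the excluded adjacencies.\<close>

locale C4_2K2_free_relation =
  fixes R :: "'v::finite \<Rightarrow> 'v \<Rightarrow> bool"
  assumes sym: "R a b \<Longrightarrow> R b a" and irrefl: "\<not> R a a"
    and no_C4: "R a b \<Longrightarrow> R b c \<Longrightarrow> R c d \<Longrightarrow> R d a \<Longrightarrow> \<not> R a c \<Longrightarrow> \<not> R b d \<Longrightarrow> a \<noteq> c \<Longrightarrow> b \<noteq> d \<Longrightarrow> False"
    and no_2K2: "R a b \<Longrightarrow> R c d \<Longrightarrow> \<not> R a c \<Longrightarrow> \<not> R a d \<Longrightarrow> \<not> R b c \<Longrightarrow> \<not> R b d \<Longrightarrow> False"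
begin

definition C5 :: "'v \<Rightarrow> 'v \<Rightarrow> 'v \<Rightarrow> 'v \<Rightarrow> 'v \<Rightarrow> bool" where
  "C5 a b c d e \<longleftrightarrow> R a b \<and> R b c \<and> R c d \<and> R d e \<and> R e a \<and>
     \<not> R a c \<and> \<not> R a d \<and> \<not> R b d \<and> \<not> R b e \<and> \<not> R c e"

lemma C5_distinct: "C5 a b c d e \<Longrightarrow> distinct [a, b, c, d, e]"
  unfolding C5_def by (auto dest: sym simp: irrefl)

definition clique :: "'v set \<Rightarrow> bool" where
  "clique K \<longleftrightarrow> (\<forall>x\<in>K. \<forall>y\<in>K. x \<noteq> y \<longrightarrow> R x y)"

lemma clique_insert: "clique K \<Longrightarrow> (\<And>u. u \<in> K \<Longrightarrow> R x u) \<Longrightarrow> clique (insert x K)"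
  unfolding clique_def using sym by blast

text \<open>The argument of Foeldes and Hammer: a maximum clique, of maximal degree sum among those, has
  an independent complement.\<close>

lemma split_partition_exists:
  assumes no_C5: "\<And>a b c d e. \<not> C5 a b c d e"
  shows "\<exists>K. clique K \<and> (\<forall>x y. x \<notin> K \<longrightarrow> y \<notin> K \<longrightarrow> \<not> R x y)"
proof -
  let ?deg = "\<lambda>v. card {u. R v u}"
  \<comment> \<open>Pairs are ordered lexicographically: the size of the clique first, then its
    degree sum.\<close>
  let ?f = "\<lambda>K. (card K, sum ?deg K)"
  have "clique {}" by (simp add: clique_def)
  then have ne: "?f ` {K. clique K} \<noteq> {}" by blast
  have fin: "finite (?f ` {K. clique K})" by simp
  obtain K where K: "clique K" "?f K = Max (?f ` {K. clique K})"
    using Max_in[OF fin ne] by (metis (no_types, lifting) imageE mem_Collect_eq)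
  have max: "?f K' \<le> ?f K" if "clique K'" for K'
    unfolding K(2) using fin that by (intro Max_ge) auto
  have nonnbr: "\<exists>u\<in>K. \<not> R x u" if "x \<notin> K" for x
  proof (rule ccontr)
    assume "\<not> (\<exists>u\<in>K. \<not> R x u)"
    then have "clique (insert x K)" using clique_insert[OF K(1)] by blast
    from max[OF this] show False using that by (auto simp: less_eq_prod_def)
  qed
  have adj: "R u w" if "u \<in> K" "w \<in> K" "u \<noteq> w" for u w
    using K(1) that by (simp add: clique_def)
  have main: False if xy: "x \<notin> K" "y \<notin> K" "R x y" and sub: "\<forall>u\<in>K. \<not> R y u \<longrightarrow> \<not> R x u" for x y
  proof -
    obtain z where z: "z \<in> K" "\<not> R y z" using nonnbr xy by blast
    then have xz: "\<not> R x z" using sub by blast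
    \<comment> \<open>A second nonneighbor of \<open>y\<close> in \<open>K\<close> would, like
      \<open>z\<close>, be a nonneighbor of \<open>x\<close>, and its edge to \<open>z\<close> would
      form an induced \<open>2K2\<close> with the edge from \<open>x\<close> to
      \<open>y\<close>.\<close>
    have yK: "R y u" if "u \<in> K" "u \<noteq> z" for u
    proof (rule ccontr)
      assume "\<not> R y u"
      moreover from this have "\<not> R x u" using sub that by blast
      ultimately show False using no_2K2[OF xy(3) adj[OF that(1) z(1) that(2)]] xz z(2) by blast
    qed
    have "clique (K - {z})" using K(1) by (auto simp: clique_def)
    then have "clique (insert y (K - {z}))" using yK by (intro clique_insert) auto
    \<comment> \<open>Exchanging \<open>z\<close> for \<open>y\<close> gives another maximum clique,
      whose degree sum cannot be larger.\<close>
    from max[OF this] have "sum ?deg (insert y (K - {z})) \<le> sum ?deg K"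
      using xy(2) z(1) by (auto simp: less_eq_prod_def card_Suc_Diff1)
    moreover have "sum ?deg (insert y (K - {z})) = ?deg y + sum ?deg (K - {z})"
      using xy(2) by (intro sum.insert) auto
    moreover have "sum ?deg K = ?deg z + sum ?deg (K - {z})"
      using z(1) by (intro sum.remove) auto
    ultimately have deg: "?deg y \<le> ?deg z" by linarith
    \<comment> \<open>As \<open>x\<close> is a neighbor of \<open>y\<close> but not of
      \<open>z\<close>, the comparison of degrees leaves \<open>z\<close> a neighbor that
      \<open>y\<close> lacks.\<close>
    have "\<exists>w. R z w \<and> \<not> R y w"
    proof (rule ccontr)
      assume "\<nexists>w. R z w \<and> \<not> R y w"
      moreover have "x \<in> {u. R y u} - {u. R z u}" using xy(3) xz sym by blast
      ultimately have "{u. R z u} \<subset> {u. R y u}" by blast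
      then have "?deg z < ?deg y" by (intro psubset_card_mono) auto
      with deg show False by linarith
    qed
    then obtain w where w: "R z w" "\<not> R y w" by blast
    have wK: "w \<notin> K" using w yK irrefl by blast
    have "R w x"
      using no_2K2[OF xy(3) w(1)] xz z(2) w(2) sym by blast
    obtain z' where z': "z' \<in> K" "\<not> R w z'" using nonnbr[OF wK] by blast
    then have "z' \<noteq> z" using w(1) sym by blast
    then have zz': "R z z'" "R y z'" using adj z(1) z'(1) yK by auto
    \<comment> \<open>If \<open>x\<close> and \<open>z'\<close> are adjacent, then \<open>x\<close>,
      \<open>w\<close>, \<open>z\<close>, \<open>z'\<close> form an induced 4-cycle; otherwise these
      four and \<open>y\<close> form an induced 5-cycle.\<close>
    show False
    proof (cases "R x z'")
      case True
      have "R x w" "R w z" "R z' x" using \<open>R w x\<close> w(1) True sym by auto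
      from no_C4[OF this(1,2) zz'(1) this(3) xz z'(2)] xy(1) z(1) z'(1) wK show False by blast
    next
      case False
      have "C5 y x w z z'"
        unfolding C5_def using xy(3) \<open>R w x\<close> w zz' z xz z' False sym by blast
      then show False using no_C5 by blast
    qed
  qed
  have "\<not> R x y" if "x \<notin> K" "y \<notin> K" for x y
  proof
    assume xy: "R x y"
    show False
    proof (cases "\<forall>u\<in>K. \<not> R y u \<longrightarrow> \<not> R x u")
      case True
      then show False using main that xy by blast
    next
      case False
      then obtain w where w: "w \<in> K" "\<not> R y w" "R x w" by blast
      \<comment> \<open>The sets of nonneighbors of \<open>x\<close> and of \<open>y\<close> in
        \<open>K\<close> are nested, as otherwise \<open>x\<close>, \<open>y\<close>,
        \<open>u\<close>, \<open>w\<close> form an induced 4-cycle. So \<open>main\<close> applies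
        with \<open>x\<close> and \<open>y\<close> in one of the two orders.\<close>
      have "\<forall>u\<in>K. \<not> R x u \<longrightarrow> \<not> R y u"
      proof (intro ballI impI notI)
        fix u assume u: "u \<in> K" "\<not> R x u" "R y u"
        then have "R u w" using adj w by blast
        from no_C4[OF xy u(3) this sym[OF w(3)] u(2) w(2)] show False using that u(1) w(1) by blast
      qed
      then show False using main[of y x] that sym[OF xy] by blast
    qed
  qed
  then show ?thesis using K(1) by blast
qed

text \<open>A vertex of \<open>K\<close> without neighbors outside \<open>K\<close> could be moved
  to the independent side, which a smallest \<open>K\<close> rules out. The extra property makes the
  neighborhood of each vertex of \<open>K\<close> at least as large as \<open>K\<close>, so that
  trading it for \<open>K\<close> never raises the degree.\<close>

lemma split_partition:
  assumes "\<And>a b c d e. \<not> C5 a b c d e"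
  obtains K where "clique K" "\<And>x y. x \<notin> K \<Longrightarrow> y \<notin> K \<Longrightarrow> \<not> R x y"
    "\<And>x. x \<in> K \<Longrightarrow> \<exists>y. y \<notin> K \<and> R x y"
proof -
  let ?P = "\<lambda>K. clique K \<and> (\<forall>x y. x \<notin> K \<longrightarrow> y \<notin> K \<longrightarrow> \<not> R x y)"
  obtain K where K: "?P K" and min: "\<And>K'. ?P K' \<Longrightarrow> card K \<le> card K'"
    using ex_has_least_nat[of ?P _ card] split_partition_exists[OF assms] by metis
  have "\<exists>y. y \<notin> K \<and> R x y" if x: "x \<in> K" for x
  proof (rule ccontr)
    assume *: "\<nexists>y. y \<notin> K \<and> R x y"
    have "\<not> R u v" if "u \<notin> K - {x}" "v \<notin> K - {x}" for u v
      using that * K irrefl sym by (metis Diff_iff singletonD)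
    moreover have "clique (K - {x})" using K by (simp add: clique_def)
    ultimately have "card K \<le> card (K - {x})" by (intro min) blast
    then show False using x card_Diff1_less[of K x] by simp
  qed
  then show ?thesis using K that by blast
qed

text \<open>A vertex off the cycle is adjacent to all of the cycle or to none of it, and
  \<open>K\<close> collects the former. Two nonadjacent vertices of \<open>K\<close> would form an
  induced 4-cycle with \<open>a\<close> and \<open>c\<close>; an edge among the latter would form an
  induced \<open>2K2\<close> with the edge from \<open>a\<close> to \<open>b\<close>.\<close>

lemma C5_partition:
  assumes C5: "C5 a b c d e"
  obtains K where "K \<inter> {a, b, c, d, e} = {}" "clique K"
    "\<And>v u. v \<in> K \<Longrightarrow> u \<in> {a, b, c, d, e} \<Longrightarrow> R v u"
    "\<And>v u. v \<notin> K \<Longrightarrow> v \<notin> {a, b, c, d, e} \<Longrightarrow> u \<notin> K \<Longrightarrow> \<not> R v u"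
proof -
  let ?C = "{a, b, c, d, e}"
  define K where "K = {v. v \<notin> ?C \<and> (\<forall>u\<in>?C. R v u)}"
  have dist: "distinct [a, b, c, d, e]" using C5_distinct[OF C5] .
  have R: "R a b" "R b c" "R c d" "R d e" "R e a" "\<not> R a c" "\<not> R a d" "\<not> R b d" "\<not> R b e" "\<not> R c e"
    using C5 by (auto simp: C5_def)
  have R': "R b a" "R c b" "R d c" "R e d" "R a e" "\<not> R c a" "\<not> R d a" "\<not> R d b" "\<not> R e b" "\<not> R e c"
    using R sym by blast+
  have all: "\<forall>u\<in>?C. R v u" if v: "v \<notin> ?C" and vu: "R v u" "u \<in> ?C" for v u
  proof -
    \<comment> \<open>A neighbor on the cycle forces another one on the opposite edge (no
      \<open>2K2\<close>), and two neighbors at distance two force the vertex between them (no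
      \<open>C4\<close>). Repeating this reaches all five vertices.\<close>
    have "R v a \<and> R v b \<and> R v c \<and> R v d \<and> R v e"
      using vu(1) vu(2) v R R' dist sym[of v]
        no_2K2[of v a c d] no_2K2[of v b d e] no_2K2[of v c e a] no_2K2[of v d a b] no_2K2[of v e b c]
        no_C4[of v a b c] no_C4[of v b c d] no_C4[of v c d e] no_C4[of v d e a] no_C4[of v e a b]
      by (smt (verit) distinct_length_2_or_more insert_iff empty_iff)
    then show ?thesis by simp
  qed
  show ?thesis
  proof (rule that[of K])
    show "K \<inter> ?C = {}" by (auto simp: K_def)
    show "R v u" if "v \<in> K" "u \<in> ?C" for v u using that by (auto simp: K_def)
    show "clique K"
      unfolding clique_def
    proof (intro ballI impI)
      fix x y assume xy: "x \<in> K" "y \<in> K" "x \<noteq> y"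
      then have "R x a" "R c x" "R y c" "R a y" using sym by (auto simp: K_def)
      moreover have "a \<noteq> c" using dist by simp
      ultimately show "R x y" using no_C4[of a y c x] R(6) xy(3) sym by blast
    qed
    show "\<not> R v u" if v: "v \<notin> K" "v \<notin> ?C" and u: "u \<notin> K" for v u
    proof
      assume vu: "R v u"
      have nv: "\<not> R v x" if "x \<in> ?C" for x using all[OF v(2) _ that] v by (auto simp: K_def)
      show False
      proof (cases "u \<in> ?C")
        case True
        then show False using nv vu by blast
      next
        case False
        have nu: "\<not> R u x" if "x \<in> ?C" for x using all[OF False _ that] u False by (auto simp: K_def)
        show False using no_2K2[OF vu R(1)] nv nu by simp
      qed
    qed
  qed
qed

end

section \<open>The cover exponents of split graphs and of pseudo-split graphs with a 5-cycle\<close>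

text \<open>The only cover of the second kind is \<open>K\<close>, so \<open>b\<close> is its
  multiplicity. As there is a single index of each weight, the set of colon variables belonging to
  \<open>b\<close> is empty.\<close>

lemma cover_exponents_split:
  fixes K :: "'v::finite set"
  assumes N_K: "\<And>v. v \<in> K \<Longrightarrow> N v \<inter> K = K - {v}" and N: "\<And>v. v \<in> K \<Longrightarrow> \<not> N v \<subseteq> K"
  shows "cover_exponents K N UNIV (\<lambda>b. b) (\<lambda>b x. b * of_bool (x \<in> K)) (\<lambda>_. {}) (card K)"
proof
  show "card K \<le> card (N v)" if v: "v \<in> K" for v
  proof -
    obtain y where y: "y \<in> N v" "y \<notin> K" using N[OF v] by blast
    have "card K = card (insert y (K - {v}))"
      using v y(2) card.remove[of K v] by simp
    also have "\<dots> \<le> card (N v)"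
      using N_K[OF v] y(1) by (intro card_mono) auto
    finally show ?thesis .
  qed
  show "\<exists>b'\<in>UNIV. b' = Suc b \<and> (\<forall>x. b' * of_bool (x \<in> K) \<le> b * of_bool (x \<in> K) + of_bool (x \<in> insert v (N v)))"
    if "v \<in> K" for b v
    using N_K[OF that] by auto
  show "\<exists>b'\<in>UNIV. b' = Suc b \<and> (\<forall>x. b' * of_bool (x \<in> K) = b * of_bool (x \<in> K) + c * of_bool (x \<in> K))"
    if "c = 1" for b c :: nat
    using that by auto
  show "\<exists>b'\<in>UNIV. \<exists>c\<in>UNIV. b' = t \<and> c = 1 \<and>
      (\<forall>x. b * of_bool (x \<in> K) = b' * of_bool (x \<in> K) + c * of_bool (x \<in> K))"
    if "b = Suc t" for b t :: nat
    using that by auto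
qed (use N_K in auto)

text \<open>The vertices of the 5-cycle are listed as \<open>c\<^sub>0, \<dots>, c\<^sub>4\<close> such that \<open>c\<^sub>i\<close> and \<open>c\<^sub>i\<^sub>+\<^sub>1\<close> are not adjacent. The
  entry \<open>b\<^sub>i\<close> of a tuple counts how often the cover that omits \<open>c\<^sub>i\<close> and \<open>c\<^sub>i\<^sub>+\<^sub>1\<close> is used.\<close>

type_synonym cycle_index = "nat \<times> nat \<times> nat \<times> nat \<times> nat"

fun cycle_weight :: "cycle_index \<Rightarrow> nat" where
  "cycle_weight (b0, b1, b2, b3, b4) = b0 + b1 + b2 + b3 + b4"

text \<open>The vertex \<open>c\<^sub>i\<close> is omitted by the covers with numbers
  \<open>i - 1\<close> and \<open>i\<close> modulo 5, so its exponent is the sum of the other three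
  entries.\<close>

fun cycle_exponent :: "'v set \<Rightarrow> 'v \<Rightarrow> 'v \<Rightarrow> 'v \<Rightarrow> 'v \<Rightarrow> 'v \<Rightarrow> cycle_index \<Rightarrow> 'v \<Rightarrow> nat" where
  "cycle_exponent K c0 c1 c2 c3 c4 (b0, b1, b2, b3, b4) x =
    (if x \<in> K then b0 + b1 + b2 + b3 + b4
     else if x = c0 then b1 + b2 + b3 else if x = c1 then b2 + b3 + b4
     else if x = c2 then b3 + b4 + b0 else if x = c3 then b4 + b0 + b1
     else if x = c4 then b0 + b1 + b2 else 0)"

text \<open>Each clause comes from a trade that lowers the tuple lexicographically and raises only
  the exponent of the named variable. Cover 0 for cover 1 gains \<open>c0\<close>; 0 for 4 and 1 for
  2 gain \<open>c1\<close>; 2 for 3 gains \<open>c2\<close>; 3 for 4 gains \<open>c3\<close>; the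
  pair 0, 2 for the pair 1, 4 gains \<open>c3\<close> as well.\<close>

fun cycle_colon_variables :: "'v \<Rightarrow> 'v \<Rightarrow> 'v \<Rightarrow> 'v \<Rightarrow> cycle_index \<Rightarrow> 'v set" where
  "cycle_colon_variables c0 c1 c2 c3 (b0, b1, b2, b3, b4) =
    {x. x = c0 \<and> b0 > 0 \<or> x = c1 \<and> (b0 > 0 \<or> b1 > 0) \<or> x = c2 \<and> b2 > 0 \<or>
        x = c3 \<and> (b3 > 0 \<or> b0 > 0 \<and> b2 > 0)}"

text \<open>The clause \<open>b0 > 0 \<and> b2 > 0\<close> arises for \<open>b0' < b0\<close>. If
  the exponents of \<open>c0\<close> and \<open>c1\<close> do not grow, then \<open>b4' > b4\<close>
  and \<open>b0' + b1' \<ge> b0 + b1\<close>, so the exponent of \<open>c3\<close> grows, and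
  equality of the weights makes \<open>b2\<close> or \<open>b3\<close> positive.\<close>

lemma cycle_witness_arith:
  fixes b0 b1 b2 b3 b4 b0' b1' b2' b3' b4' :: nat
  assumes "b0' + b1' + b2' + b3' + b4' = b0 + b1 + b2 + b3 + b4"
    and "(b0', b1', b2', b3', b4') < (b0, b1, b2, b3, b4)"
  shows "b0 > 0 \<and> b1 + b2 + b3 < b1' + b2' + b3' \<or>
    (b0 > 0 \<or> b1 > 0) \<and> b2 + b3 + b4 < b2' + b3' + b4' \<or>
    b2 > 0 \<and> b3 + b4 + b0 < b3' + b4' + b0' \<or>
    (b3 > 0 \<or> b0 > 0 \<and> b2 > 0) \<and> b4 + b0 + b1 < b4' + b0' + b1'"
proof -
  \<comment> \<open>The last entry is determined by the others and the common weight, so the first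
    difference is among the first four.\<close>
  have "b0' < b0 \<or> b0' = b0 \<and> (b1' < b1 \<or> b1' = b1 \<and> (b2' < b2 \<or> b2' = b2 \<and> b3' < b3))"
    using assms by (auto simp: less_prod_def)
  then show ?thesis using assms(1) by linarith
qed

lemma cycle_exponent_le:
  assumes "distinct [c0, c1, c2, c3, c4]" "K \<inter> {c0, c1, c2, c3, c4} = {}"
    and "cycle_weight (b0', b1', b2', b3', b4') = cycle_weight (b0, b1, b2, b3, b4)"
    and "b1' + b2' + b3' \<le> b1 + b2 + b3 + of_bool (x = c0)"
    and "b2' + b3' + b4' \<le> b2 + b3 + b4 + of_bool (x = c1)"
    and "b3' + b4' + b0' \<le> b3 + b4 + b0 + of_bool (x = c2)"
    and "b4' + b0' + b1' \<le> b4 + b0 + b1 + of_bool (x = c3)"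
    and "b0' + b1' + b2' \<le> b0 + b1 + b2 + of_bool (x = c4)"
  shows "cycle_exponent K c0 c1 c2 c3 c4 (b0', b1', b2', b3', b4') y
    \<le> cycle_exponent K c0 c1 c2 c3 c4 (b0, b1, b2, b3, b4) y + of_bool (y = x)"
proof -
  have "distinct [c4, c3, c2, c1, c0]" using assms(1) by auto
  with assms show ?thesis by (cases "y \<in> K"; cases "y \<in> {c0, c1, c2, c3, c4}") (auto simp del: of_bool_eq_iff)
qed

text \<open>A cover of the second kind has \<open>card K + 3\<close> vertices, whereas
  \<open>N v\<close> contains \<open>K - {v}\<close> and all five vertices of the cycle. Trading a
  neighborhood therefore even lowers the degree.\<close>

lemma cover_exponents_cycle:
  fixes K :: "'v::finite set"
  assumes N_K: "\<And>v. v \<in> K \<Longrightarrow> N v \<inter> K = K - {v}"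
    and N: "\<And>v. v \<in> K \<Longrightarrow> {c0, c1, c2, c3, c4} \<subseteq> N v"
    and dist: "distinct [c0, c1, c2, c3, c4]" and K: "K \<inter> {c0, c1, c2, c3, c4} = {}"
  shows "cover_exponents K N UNIV cycle_weight (cycle_exponent K c0 c1 c2 c3 c4)
    (cycle_colon_variables c0 c1 c2 c3) (card K + 3)"
proof
  let ?n = "cycle_exponent K c0 c1 c2 c3 c4"
  have add: "?n (b0 + a0, b1 + a1, b2 + a2, b3 + a3, b4 + a4) x =
      ?n (b0, b1, b2, b3, b4) x + ?n (a0, a1, a2, a3, a4) x" for a0 a1 a2 a3 a4 b0 b1 b2 b3 b4 x
    by simp
  have dist': "distinct [c4, c3, c2, c1, c0]" using dist by auto
  show "N v \<inter> K = K - {v}" if "v \<in> K" for v using N_K that .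
  show "?n b x = cycle_weight b" if "x \<in> K" for b x
    using that by (cases b rule: cycle_weight.cases) simp
  show "finite {b \<in> UNIV. cycle_weight b = t}" for t
    by (rule finite_subset[of _ "{..t} \<times> {..t} \<times> {..t} \<times> {..t} \<times> {..t}"]) auto
  show "(\<Sum>x\<in>UNIV. ?n b x) = (card K + 3) * cycle_weight b" for b
  proof (cases b rule: cycle_weight.cases)
    case (1 b0 b1 b2 b3 b4)
    have "(\<Sum>x\<in>UNIV. ?n b x) = (\<Sum>x\<in>K \<union> {c0, c1, c2, c3, c4}. ?n b x)"
      by (intro sum.mono_neutral_right) (auto simp: 1)
    also have "\<dots> = (\<Sum>x\<in>K. ?n b x) + (\<Sum>x\<in>{c0, c1, c2, c3, c4}. ?n b x)"
      using K by (intro sum.union_disjoint) auto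
    also have "(\<Sum>x\<in>K. ?n b x) = card K * cycle_weight b" by (simp add: 1)
    also have "(\<Sum>x\<in>{c0, c1, c2, c3, c4}. ?n b x) = 3 * cycle_weight b"
      using dist dist' K by (simp add: 1)
    finally show ?thesis by (simp add: algebra_simps)
  qed
  show "card K + 3 \<le> card (N v)" if v: "v \<in> K" for v
  proof -
    have "card ((K - {v}) \<union> {c0, c1, c2, c3, c4}) = card (K - {v}) + card {c0, c1, c2, c3, c4}"
      using K by (intro card_Un_disjoint) auto
    moreover have "card {c0, c1, c2, c3, c4} = 5" using dist by simp
    moreover have "Suc (card (K - {v})) = card K" using v card.remove[of K v] by simp
    moreover have "card ((K - {v}) \<union> {c0, c1, c2, c3, c4}) \<le> card (N v)"
      using N_K[OF v] N[OF v] by (intro card_mono) auto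
    ultimately show ?thesis by linarith
  qed
  show "\<exists>b'\<in>UNIV. cycle_weight b' = Suc (cycle_weight b) \<and>
      (\<forall>x. ?n b' x \<le> ?n b x + of_bool (x \<in> insert v (N v)))" if v: "v \<in> K" for b v
  proof (cases b rule: cycle_weight.cases)
    case (1 b0 b1 b2 b3 b4)
    \<comment> \<open>Any of the five covers would do, since all of them lie in
      \<open>insert v (N v)\<close>; this one omits \<open>c0\<close> and \<open>c1\<close>.\<close>
    have "?n (1, 0, 0, 0, 0) x \<le> of_bool (x \<in> insert v (N v))" for x
      using N_K[OF v] N[OF v] by auto
    then have "\<forall>x. ?n (b0 + 1, b1 + 0, b2 + 0, b3 + 0, b4 + 0) x \<le> ?n b x + of_bool (x \<in> insert v (N v))"
      unfolding add 1 by (simp only: add_le_cancel_left) simp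
    then show ?thesis by (intro bexI[of _ "(b0 + 1, b1 + 0, b2 + 0, b3 + 0, b4 + 0)"]) (auto simp: 1 simp del: cycle_exponent.simps)
  qed
  show "\<exists>b'\<in>UNIV. cycle_weight b' = cycle_weight b \<and> b' < b \<and> (\<forall>y. ?n b' y \<le> ?n b y + of_bool (y = x))"
    if x: "x \<in> cycle_colon_variables c0 c1 c2 c3 b" for b x
  proof (cases b rule: cycle_weight.cases)
    case (1 b0 b1 b2 b3 b4)
    have le: "\<exists>b'\<in>UNIV. cycle_weight b' = cycle_weight b \<and> b' < b \<and> (\<forall>y. ?n b' y \<le> ?n b y + of_bool (y = x))"
      if "cycle_weight (b0', b1', b2', b3', b4') = cycle_weight (b0, b1, b2, b3, b4)"
        "b1' + b2' + b3' \<le> b1 + b2 + b3 + of_bool (x = c0)"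
        "b2' + b3' + b4' \<le> b2 + b3 + b4 + of_bool (x = c1)"
        "b3' + b4' + b0' \<le> b3 + b4 + b0 + of_bool (x = c2)"
        "b4' + b0' + b1' \<le> b4 + b0 + b1 + of_bool (x = c3)"
        "b0' + b1' + b2' \<le> b0 + b1 + b2 + of_bool (x = c4)"
        "(b0', b1', b2', b3', b4') < (b0, b1, b2, b3, b4)" for b0' b1' b2' b3' b4'
      using that(1,7) cycle_exponent_le[OF dist K that(1-6)] unfolding 1
      by (intro bexI[of _ "(b0', b1', b2', b3', b4')"] conjI allI) auto
    \<comment> \<open>One case for each trade; the arguments of \<open>le\<close> below are the
      tuple after the trade.\<close>
    have "x = c0 \<and> b0 > 0 \<or> x = c1 \<and> b0 > 0 \<or> x = c1 \<and> b1 > 0 \<or> x = c2 \<and> b2 > 0 \<or>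
        x = c3 \<and> b3 > 0 \<or> x = c3 \<and> b0 > 0 \<and> b2 > 0"
      using x 1 by auto
    then show ?thesis
    proof (elim disjE conjE)
      assume "x = c0" "b0 > 0"
      then show ?thesis by (intro le[of "b0 - 1" "b1 + 1" b2 b3 b4]) (auto simp: less_prod_def)
    next
      assume "x = c1" "b0 > 0"
      then show ?thesis by (intro le[of "b0 - 1" b1 b2 b3 "b4 + 1"]) (auto simp: less_prod_def)
    next
      assume "x = c1" "b1 > 0"
      then show ?thesis by (intro le[of b0 "b1 - 1" "b2 + 1" b3 b4]) (auto simp: less_prod_def)
    next
      assume "x = c2" "b2 > 0"
      then show ?thesis by (intro le[of b0 b1 "b2 - 1" "b3 + 1" b4]) (auto simp: less_prod_def)
    next
      assume "x = c3" "b3 > 0"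
      then show ?thesis by (intro le[of b0 b1 b2 "b3 - 1" "b4 + 1"]) (auto simp: less_prod_def)
    next
      assume "x = c3" "b0 > 0" "b2 > 0"
      then show ?thesis by (intro le[of "b0 - 1" "b1 + 1" "b2 - 1" b3 "b4 + 1"]) (auto simp: less_prod_def)
    qed
  qed
  show "\<exists>x\<in>cycle_colon_variables c0 c1 c2 c3 b. ?n b x < ?n b' x"
    if "cycle_weight b' = cycle_weight b" "b' < b" for b b'
  proof -
    obtain b0 b1 b2 b3 b4 b0' b1' b2' b3' b4'
      where b: "b = (b0, b1, b2, b3, b4)" "b' = (b0', b1', b2', b3', b4')"
      by (metis cycle_weight.cases)
    have notin: "c0 \<notin> K" "c1 \<notin> K" "c2 \<notin> K" "c3 \<notin> K" using K by auto
    have "b0 > 0 \<and> ?n b c0 < ?n b' c0 \<or> (b0 > 0 \<or> b1 > 0) \<and> ?n b c1 < ?n b' c1 \<or>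
        b2 > 0 \<and> ?n b c2 < ?n b' c2 \<or> (b3 > 0 \<or> b0 > 0 \<and> b2 > 0) \<and> ?n b c3 < ?n b' c3"
      using cycle_witness_arith[of b0' b1' b2' b3' b4' b0 b1 b2 b3 b4] that dist dist' notin unfolding b by simp
    then show ?thesis unfolding b(1) by (auto simp del: cycle_exponent.simps)
  qed
  show "\<exists>b\<in>UNIV. cycle_weight b = t" for t
    by (intro bexI[of _ "(t, 0, 0, 0, 0)"]) auto
  show "?n b x = 0" if "cycle_weight b = 0" for b x
    using that by (cases b rule: cycle_weight.cases) simp
  show "\<exists>b'\<in>UNIV. cycle_weight b' = Suc (cycle_weight b) \<and> (\<forall>x. ?n b' x = ?n b x + ?n c x)"
    if "cycle_weight c = 1" for b c
  proof -
    obtain b0 b1 b2 b3 b4 a0 a1 a2 a3 a4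
      where "b = (b0, b1, b2, b3, b4)" "c = (a0, a1, a2, a3, a4)"
      by (metis cycle_weight.cases)
    then show ?thesis using that
      by (intro bexI[of _ "(b0 + a0, b1 + a1, b2 + a2, b3 + a3, b4 + a4)"] conjI allI)
        (simp_all only: add, auto)
  qed
  show "\<exists>b'\<in>UNIV. \<exists>c\<in>UNIV. cycle_weight b' = t \<and> cycle_weight c = 1 \<and> (\<forall>x. ?n b x = ?n b' x + ?n c x)"
    if t: "cycle_weight b = Suc t" for b t
  proof (cases b rule: cycle_weight.cases)
    case (1 b0 b1 b2 b3 b4)
    \<comment> \<open>In use, \<open>(a0, a1, a2, a3, a4)\<close> is the unit tuple at a positive
      entry of \<open>b\<close>: one cover is split off.\<close>
    have split: "\<exists>b'\<in>UNIV. \<exists>c\<in>UNIV. cycle_weight b' = t \<and> cycle_weight c = 1 \<and> (\<forall>x. ?n b x = ?n b' x + ?n c x)"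
      if c: "cycle_weight (a0, a1, a2, a3, a4) = 1" "a0 \<le> b0" "a1 \<le> b1" "a2 \<le> b2" "a3 \<le> b3" "a4 \<le> b4"
      for a0 a1 a2 a3 a4
    proof (rule bexI[of _ "(b0 - a0, b1 - a1, b2 - a2, b3 - a3, b4 - a4)"],
        rule bexI[of _ "(a0, a1, a2, a3, a4)"], intro conjI allI)
      show "?n b x = ?n (b0 - a0, b1 - a1, b2 - a2, b3 - a3, b4 - a4) x + ?n (a0, a1, a2, a3, a4) x" for x
        unfolding add[symmetric] 1 using c(2-) by (simp only: le_add_diff_inverse2)
      show "cycle_weight (b0 - a0, b1 - a1, b2 - a2, b3 - a3, b4 - a4) = t"
        using t c unfolding 1 by simp
    qed (use c in auto)
    have "b0 \<ge> 1 \<or> b1 \<ge> 1 \<or> b2 \<ge> 1 \<or> b3 \<ge> 1 \<or> b4 \<ge> 1" using t 1 by auto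
    then show ?thesis
      using split[of 1 0 0 0 0] split[of 0 1 0 0 0] split[of 0 0 1 0 0] split[of 0 0 0 1 0] split[of 0 0 0 0 1]
      by (elim disjE) simp_all
  qed
qed

lemma cycle_weight_one:
  "{b. cycle_weight b = 1} =
    {(1, 0, 0, 0, 0), (0, 1, 0, 0, 0), (0, 0, 1, 0, 0), (0, 0, 0, 1, 0), (0, 0, 0, 0, 1)}"
proof (rule Set.set_eqI)
  fix b :: cycle_index
  show "b \<in> {b. cycle_weight b = 1} \<longleftrightarrow>
    b \<in> {(1, 0, 0, 0, 0), (0, 1, 0, 0, 0), (0, 0, 1, 0, 0), (0, 0, 0, 1, 0), (0, 0, 0, 0, 1)}"
    by (cases b rule: cycle_weight.cases) (auto simp: add_is_1)
qed

section \<open>The cover ideal\<close>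

lemma prod_Var: "(\<Prod>v\<in>C. Var v) = (xpow (expo (\<lambda>x. of_bool (x \<in> C))) :: ('v::finite, 'k::field) mpoly)"
  using finite[of C]
proof induction
  case empty
  then show ?case by simp
next
  case (insert v C)
  have "expo (\<lambda>x. of_bool (x \<in> insert v C)) = Poly_Mapping.single v 1 + expo (\<lambda>x. of_bool (x \<in> C))"
    using insert.hyps by (intro poly_mapping_eqI) (auto simp: lookup_add lookup_single when_def)
  with insert show ?case by (simp add: Var_def mult_single)
qed

text \<open>Every cover contains a minimal one, so its monomial is a multiple of a generator. Any
  family between the minimal covers and all covers thus generates the same ideal.\<close>

lemma cover_ideal_eq:
  fixes L :: "'v::finite set set"
  assumes covers: "\<And>C. C \<in> L \<Longrightarrow> vertex_cover UNIV E C"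
    and minimal: "\<And>C. minimal_vertex_cover UNIV E C \<Longrightarrow> C \<in> L"
  shows "cover_ideal E = (ideal_generated (xpow ` expo ` (\<lambda>C x. of_bool (x \<in> C)) ` L) :: ('v, 'k::field) mpoly set)"
proof -
  let ?ind = "\<lambda>C. expo (\<lambda>x. of_bool (x \<in> C)) :: 'v \<Rightarrow>\<^sub>0 nat"
  have "cover_ideal E = (ideal_generated (xpow ` ?ind ` {C. minimal_vertex_cover UNIV E C}) :: ('v, 'k) mpoly set)"
    unfolding cover_ideal_def prod_Var by (rule arg_cong[of _ _ ideal_generated]) auto
  also have "\<dots> = ideal_generated (xpow ` ?ind ` L)"
  proof
    show "ideal_generated (xpow ` ?ind ` {C. minimal_vertex_cover UNIV E C}) \<subseteq> (ideal_generated (xpow ` ?ind ` L) :: ('v, 'k) mpoly set)"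
    proof (rule ideal_generated_subset)
      have "xpow ` ?ind ` {C. minimal_vertex_cover UNIV E C} \<subseteq> (xpow ` ?ind ` L :: ('v, 'k) mpoly set)"
        using minimal by (intro image_mono) blast
      then show "xpow ` ?ind ` {C. minimal_vertex_cover UNIV E C} \<subseteq> (ideal_generated (xpow ` ?ind ` L) :: ('v, 'k) mpoly set)"
        using ideal_generated_superset by (rule subset_trans)
    qed
    show "(ideal_generated (xpow ` ?ind ` L) :: ('v, 'k) mpoly set) \<subseteq> ideal_generated (xpow ` ?ind ` {C. minimal_vertex_cover UNIV E C})"
    proof (rule ideal_generated_subset, rule subsetI)
      fix p :: "('v, 'k) mpoly" assume "p \<in> xpow ` ?ind ` L"
      then obtain C where C: "C \<in> L" "p = xpow (?ind C)" by auto
      obtain D where D: "D \<in> {D. vertex_cover UNIV E D}" "D \<subseteq> C"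
          "\<And>B. B \<in> {D. vertex_cover UNIV E D} \<Longrightarrow> B \<subseteq> D \<Longrightarrow> D = B"
        using finite_has_minimal2[of "{D. vertex_cover UNIV E D}" C] covers[OF C(1)] by auto
      have "minimal_vertex_cover UNIV E D"
        using D unfolding minimal_vertex_cover_def by blast
      moreover have "\<forall>v. Poly_Mapping.lookup (?ind D) v \<le> Poly_Mapping.lookup (?ind C) v"
        using D(2) by auto
      ultimately show "p \<in> ideal_generated (xpow ` ?ind ` {C. minimal_vertex_cover UNIV E C})"
        unfolding C(2) mem_monomial_ideal_le by auto
    qed
  qed
  finally show ?thesis by (simp only: image_image)
qed

section \<open>Forbidden induced subgraphs\<close>

text \<open>Inverting the isomorphism lists the vertices of \<open>U\<close> as
  \<open>g 0, g 1, ...\<close>, which turns statements on induced subgraphs into statements on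
  tuples of vertices.\<close>

lemma graph_isomorphic_iff:
  "graph_isomorphic U (induced_edges E U) {..<n} F \<longleftrightarrow>
    (\<exists>g. bij_betw g {..<n} U \<and> (\<forall>i<n. \<forall>j<n. {g i, g j} \<in> E \<longleftrightarrow> {i, j} \<in> F))"
proof
  assume "graph_isomorphic U (induced_edges E U) {..<n} F"
  then obtain f where f: "bij_betw f U {..<n}"
      "\<forall>a\<in>U. \<forall>b\<in>U. {a, b} \<in> induced_edges E U \<longleftrightarrow> {f a, f b} \<in> F"
    by (auto simp: graph_isomorphic_def)
  let ?g = "inv_into U f"
  have g: "bij_betw ?g {..<n} U" using f(1) by (rule bij_betw_inv_into)
  have "{?g i, ?g j} \<in> E \<longleftrightarrow> {i, j} \<in> F" if "i < n" "j < n" for i j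
  proof -
    have "?g i \<in> U" "?g j \<in> U" using g that by (auto simp: bij_betw_def)
    moreover have "f (?g i) = i" "f (?g j) = j"
      using f(1) that by (auto simp: bij_betw_inv_into_right)
    ultimately show ?thesis using f(2) by (auto simp: induced_edges_def)
  qed
  then show "\<exists>g. bij_betw g {..<n} U \<and> (\<forall>i<n. \<forall>j<n. {g i, g j} \<in> E \<longleftrightarrow> {i, j} \<in> F)"
    using g by blast
next
  assume "\<exists>g. bij_betw g {..<n} U \<and> (\<forall>i<n. \<forall>j<n. {g i, g j} \<in> E \<longleftrightarrow> {i, j} \<in> F)"
  then obtain g where g: "bij_betw g {..<n} U" "\<forall>i<n. \<forall>j<n. {g i, g j} \<in> E \<longleftrightarrow> {i, j} \<in> F" by blast
  let ?f = "inv_into {..<n} g"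
  have f: "bij_betw ?f U {..<n}" using g(1) by (rule bij_betw_inv_into)
  have "{a, b} \<in> induced_edges E U \<longleftrightarrow> {?f a, ?f b} \<in> F" if "a \<in> U" "b \<in> U" for a b
  proof -
    have "?f a < n" "?f b < n" using f that by (auto simp: bij_betw_def)
    then have "{g (?f a), g (?f b)} \<in> E \<longleftrightarrow> {?f a, ?f b} \<in> F" using g(2) by blast
    moreover have "g (?f a) = a" "g (?f b) = b"
      using g(1) that by (auto simp: bij_betw_inv_into_right)
    ultimately show ?thesis using that by (simp add: induced_edges_def)
  qed
  then show "graph_isomorphic U (induced_edges E U) {..<n} F"
    using f by (auto simp: graph_isomorphic_def)
qed

lemma lessThan_4: "{..<4::nat} = {0, 1, 2, 3}" and lessThan_5: "{..<5::nat} = {0, 1, 2, 3, 4}"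
  by auto

lemma cycle_edges_4: "cycle_edges 4 = {{0, 1}, {1, 2}, {2, 3}, {3, 0}}"
proof -
  have "cycle_edges 4 = (\<lambda>i. {i, (i + 1) mod 4}) ` {..<4}" by (auto simp: cycle_edges_def)
  then show ?thesis by (simp add: lessThan_4) (simp add: numeral_eq_Suc)
qed

lemma cycle_edges_5: "cycle_edges 5 = {{0, 1}, {1, 2}, {2, 3}, {3, 4}, {4, 0}}"
proof -
  have "cycle_edges 5 = (\<lambda>i. {i, (i + 1) mod 5}) ` {..<5}" by (auto simp: cycle_edges_def)
  then show ?thesis by (simp add: lessThan_5) (simp add: numeral_eq_Suc)
qed

lemma all_less_4: "(\<forall>i<4. P i) \<longleftrightarrow> P 0 \<and> P 1 \<and> P 2 \<and> P (3::nat)"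
  using lessThan_4 by (metis (no_types, opaque_lifting) insertE insert_iff lessThan_iff singletonD)

lemma all_less_5: "(\<forall>i<5. P i) \<longleftrightarrow> P 0 \<and> P 1 \<and> P 2 \<and> P 3 \<and> P (4::nat)"
  using lessThan_5 by (metis (no_types, opaque_lifting) insertE insert_iff lessThan_iff singletonD)

lemma C4_2K2_free_relationI:
  fixes E :: "'v::finite set set"
  assumes graph: "simple_graph UNIV E" and free: "C4_2K2_free UNIV E"
  shows "C4_2K2_free_relation (\<lambda>a b. {a, b} \<in> E)"
proof
  have loop: "{a} \<notin> E" for a using graph by (force simp: simple_graph_def)
  then show "{a, a} \<notin> E" for a by simp
  show "{a, b} \<in> E \<Longrightarrow> {b, a} \<in> E" for a b by (simp add: insert_commute)
  have no_iso: "\<not> graph_isomorphic U (induced_edges E U) {..<4} (cycle_edges 4)"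
    "\<not> graph_isomorphic U (induced_edges E U) {..<4} (complement_edges {..<4} (cycle_edges 4))" for U
    using free unfolding C4_2K2_free_def induced_free_def by auto
  have emb: "graph_isomorphic {a, b, c, d} (induced_edges E {a, b, c, d}) {..<4} F"
    if "distinct [a, b, c, d]" and "\<forall>i<4. \<forall>j<4. {[a, b, c, d] ! i, [a, b, c, d] ! j} \<in> E \<longleftrightarrow> {i, j} \<in> F"
    for a b c d F
    unfolding graph_isomorphic_iff
    using that by (intro exI[of _ "(!) [a, b, c, d]"] conjI bij_betw_nth) auto
  show False if ab: "{a, b} \<in> E" "{b, c} \<in> E" "{c, d} \<in> E" "{d, a} \<in> E"
    and n: "{a, c} \<notin> E" "{b, d} \<notin> E" "a \<noteq> c" "b \<noteq> d" for a b c d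
  proof -
    have ab': "{b, a} \<in> E" "{c, b} \<in> E" "{d, c} \<in> E" "{a, d} \<in> E"
      and n': "{c, a} \<notin> E" "{d, b} \<notin> E"
      using ab n by (simp_all add: insert_commute)
    have "distinct [a, b, c, d]" using ab ab' n n' loop by auto
    moreover have "\<forall>i<4. \<forall>j<4. {[a, b, c, d] ! i, [a, b, c, d] ! j} \<in> E \<longleftrightarrow> {i, j} \<in> cycle_edges 4"
      unfolding all_less_4 cycle_edges_4 using ab ab' n n' loop
      by (simp add: doubleton_eq_iff)
    ultimately show False
      using emb no_iso by metis
  qed
  show False if ab: "{a, b} \<in> E" "{c, d} \<in> E"
    and n: "{a, c} \<notin> E" "{a, d} \<notin> E" "{b, c} \<notin> E" "{b, d} \<notin> E" for a b c d
  proof -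
    have ab': "{b, a} \<in> E" "{d, c} \<in> E"
      and n': "{c, a} \<notin> E" "{d, a} \<notin> E" "{c, b} \<notin> E" "{d, b} \<notin> E"
      using ab n by (simp_all add: insert_commute)
    \<comment> \<open>The complement of the 4-cycle on 0, 1, 2, 3 has the edges 02 and 13, so the
      two ends of an edge go to positions of equal parity.\<close>
    have "distinct [a, c, b, d]" using ab ab' n n' loop by auto
    moreover have "\<forall>i<4. \<forall>j<4. {[a, c, b, d] ! i, [a, c, b, d] ! j} \<in> E \<longleftrightarrow>
        {i, j} \<in> complement_edges {..<4} (cycle_edges 4)"
      unfolding all_less_4 complement_edges_def cycle_edges_4 lessThan_4 using ab ab' n n' loop
      by (simp add: doubleton_eq_iff)
    ultimately show False
      using emb no_iso by metis
  qed
qed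

lemma C5_plus_isolated_iff:
  fixes E :: "'v::finite set set"
  assumes graph: "simple_graph UNIV E" and free: "C4_2K2_free UNIV E"
  shows "C5_plus_isolated UNIV E \<longleftrightarrow>
    (\<exists>a b c d e. C4_2K2_free_relation.C5 (\<lambda>a b. {a, b} \<in> E) a b c d e \<and>
      (\<forall>v. v \<notin> {a, b, c, d, e} \<longrightarrow> neighbors E v = {}))"
proof -
  interpret C4_2K2_free_relation "\<lambda>a b. {a, b} \<in> E"
    by (rule C4_2K2_free_relationI[OF graph free])
  have loop: "{a} \<notin> E" for a using irrefl[of a] by simp
  show ?thesis
  proof
    assume "C5_plus_isolated UNIV E"
    then obtain U where U: "graph_isomorphic U (induced_edges E U) {..<5} (cycle_edges 5)"
        "\<forall>v\<in>UNIV - U. neighbors E v = {}"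
      by (auto simp: C5_plus_isolated_def)
    obtain g where g: "bij_betw g {..<5} U" "\<forall>i<5. \<forall>j<5. {g i, g j} \<in> E \<longleftrightarrow> {i, j} \<in> cycle_edges 5"
      using U(1) unfolding graph_isomorphic_iff by blast
    have "C5 (g 0) (g 1) (g 2) (g 3) (g 4)"
      using g(2) unfolding all_less_5 cycle_edges_5 C5_def by (simp add: doubleton_eq_iff)
    moreover have "{g 0, g 1, g 2, g 3, g 4} = U"
      using g(1) unfolding bij_betw_def lessThan_5 by auto
    ultimately show "\<exists>a b c d e. C5 a b c d e \<and> (\<forall>v. v \<notin> {a, b, c, d, e} \<longrightarrow> neighbors E v = {})"
      using U(2) by blast
  next
    assume "\<exists>a b c d e. C5 a b c d e \<and> (\<forall>v. v \<notin> {a, b, c, d, e} \<longrightarrow> neighbors E v = {})"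
    then obtain a b c d e where C5: "C5 a b c d e"
        and iso: "\<forall>v. v \<notin> {a, b, c, d, e} \<longrightarrow> neighbors E v = {}" by blast
    have e: "{a, b} \<in> E" "{b, c} \<in> E" "{c, d} \<in> E" "{d, e} \<in> E" "{e, a} \<in> E"
      "{a, c} \<notin> E" "{a, d} \<notin> E" "{b, d} \<notin> E" "{b, e} \<notin> E" "{c, e} \<notin> E"
      using C5 by (auto simp: C5_def)
    then have e': "{b, a} \<in> E" "{c, b} \<in> E" "{d, c} \<in> E" "{e, d} \<in> E" "{a, e} \<in> E"
      "{c, a} \<notin> E" "{d, a} \<notin> E" "{d, b} \<notin> E" "{e, b} \<notin> E" "{e, c} \<notin> E"
      by (simp_all add: insert_commute)
    have "\<forall>i<5. \<forall>j<5. {[a, b, c, d, e] ! i, [a, b, c, d, e] ! j} \<in> E \<longleftrightarrow> {i, j} \<in> cycle_edges 5"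
      unfolding all_less_5 cycle_edges_5 using e e' loop by (simp add: doubleton_eq_iff)
    moreover have "bij_betw ((!) [a, b, c, d, e]) {..<5} {a, b, c, d, e}"
      using C5_distinct[OF C5] by (intro bij_betw_nth) auto
    ultimately have "graph_isomorphic {a, b, c, d, e} (induced_edges E {a, b, c, d, e}) {..<5} (cycle_edges 5)"
      unfolding graph_isomorphic_iff by blast
    then show "C5_plus_isolated UNIV E"
      using iso unfolding C5_plus_isolated_def by blast
  qed
qed

section \<open>Vertex covers and degrees in the two kinds of graphs\<close>

lemma vertex_cover_iff:
  assumes "simple_graph UNIV E"
  shows "vertex_cover UNIV E C \<longleftrightarrow> (\<forall>x y. {x, y} \<in> E \<longrightarrow> x \<in> C \<or> y \<in> C)"
proof -
  have pair: "\<exists>x y. e = {x, y}" if e: "e \<in> E" for e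
  proof -
    have "card e = 2" using assms e by (simp add: simple_graph_def)
    then show ?thesis unfolding card_2_iff by blast
  qed
  show ?thesis
  proof
    assume C: "vertex_cover UNIV E C"
    show "\<forall>x y. {x, y} \<in> E \<longrightarrow> x \<in> C \<or> y \<in> C"
    proof (intro allI impI)
      fix x y assume "{x, y} \<in> E"
      then have "{x, y} \<inter> C \<noteq> {}" using C unfolding vertex_cover_def by blast
      then show "x \<in> C \<or> y \<in> C" by blast
    qed
  next
    assume C: "\<forall>x y. {x, y} \<in> E \<longrightarrow> x \<in> C \<or> y \<in> C"
    have "e \<inter> C \<noteq> {}" if e: "e \<in> E" for e
    proof -
      obtain x y where "e = {x, y}" using pair[OF e] by blast
      then show ?thesis using C e by auto
    qed
    then show "vertex_cover UNIV E C" by (simp add: vertex_cover_def)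
  qed
qed

lemma minimal_vertex_cover_eq:
  "minimal_vertex_cover V E D \<Longrightarrow> vertex_cover V E C \<Longrightarrow> C \<subseteq> D \<Longrightarrow> D = C"
  unfolding minimal_vertex_cover_def by blast

text \<open>The number \<open>d\<close> separates the degrees in \<open>K\<close> from those
  outside, so a vertex of \<open>K\<close> attains the maximum. In both applications
  \<open>d\<close> is the size of the covers of the second kind.\<close>

lemma max_degree_bounds:
  fixes E :: "'v::finite set set"
  assumes le: "\<And>v. v \<in> K \<Longrightarrow> d \<le> card (neighbors E v)"
    and ge: "\<And>v. v \<notin> K \<Longrightarrow> card (neighbors E v) \<le> d" and "K \<noteq> {}"
  shows "card (neighbors E v) \<le> max_degree UNIV E" and "d \<le> max_degree UNIV E"
    and "\<exists>v\<in>K. card (neighbors E v) = max_degree UNIV E"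
proof -
  show deg: "card (neighbors E v) \<le> max_degree UNIV E" for v
    unfolding max_degree_def by (intro Max_ge) auto
  obtain v where v: "v \<in> K" using \<open>K \<noteq> {}\<close> by blast
  show "d \<le> max_degree UNIV E" using le[OF v] deg[of v] by linarith
  have "max_degree UNIV E \<in> (\<lambda>v. card (neighbors E v)) ` UNIV"
    unfolding max_degree_def by (intro Max_in) auto
  then obtain u where u: "card (neighbors E u) = max_degree UNIV E" by auto
  show "\<exists>v\<in>K. card (neighbors E v) = max_degree UNIV E"
  proof (cases "u \<in> K")
    case False
    then have "card (neighbors E v) = max_degree UNIV E"
      using u ge[of u] le[OF v] deg[of v] by linarith
    then show ?thesis using v by blast
  qed (use u in blast)
qed

text \<open>A minimal cover that misses a vertex \<open>v\<close> of \<open>K\<close> contains all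
  neighbors of \<open>v\<close>, and these already form a cover; otherwise it contains the cover
  \<open>K\<close>. This gives the generators, and the largest of them has the maximum degree of the
  graph as its size.\<close>

lemma regularity_split:
  fixes E :: "'v::finite set set"
  assumes graph: "simple_graph UNIV E"
    and clique: "\<And>x y. x \<in> K \<Longrightarrow> y \<in> K \<Longrightarrow> x \<noteq> y \<Longrightarrow> {x, y} \<in> E"
    and indep: "\<And>x y. x \<notin> K \<Longrightarrow> y \<notin> K \<Longrightarrow> {x, y} \<notin> E"
    and nbr: "\<And>x. x \<in> K \<Longrightarrow> \<exists>y. y \<notin> K \<and> {x, y} \<in> E"
  shows "regularity (ideal_power (cover_ideal E :: ('v, 'k::field) mpoly set) s) =
    int s * int (max_degree UNIV E)"
proof -
  have loop: "{a} \<notin> E" for a using graph by (force simp: simple_graph_def)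
  have N_K: "neighbors E v \<inter> K = K - {v}" if "v \<in> K" for v
    using clique[OF that] loop by (auto simp: neighbors_def)
  have N: "\<not> neighbors E v \<subseteq> K" if "v \<in> K" for v
    using nbr[OF that] by (auto simp: neighbors_def)
  interpret cover_exponents K "neighbors E" UNIV "\<lambda>b. b" "\<lambda>b x. b * of_bool (x \<in> K)" "\<lambda>_. {}" "card K"
    by (rule cover_exponents_split[OF N_K N])
  have cover_nbr: "vertex_cover UNIV E (neighbors E v)" if "v \<in> K" for v
    unfolding vertex_cover_iff[OF graph]
  proof (intro allI impI)
    fix x y assume xy: "{x, y} \<in> E"
    then have yx: "{y, x} \<in> E" by (simp add: insert_commute)
    have nb: "z = v \<or> z \<in> neighbors E v" if "z \<in> K" for z
      using clique[OF \<open>v \<in> K\<close> that] by (auto simp: neighbors_def)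
    have "x \<in> K \<or> y \<in> K" using indep xy by blast
    then show "x \<in> neighbors E v \<or> y \<in> neighbors E v"
      using nb xy yx by (auto simp: neighbors_def)
  qed
  have cover_K: "vertex_cover UNIV E K"
    unfolding vertex_cover_iff[OF graph] using indep by blast
  have minimal: "C \<in> neighbors E ` K \<union> {K}" if C: "minimal_vertex_cover UNIV E C" for C
  proof (cases "K \<subseteq> C")
    case True
    then show ?thesis using minimal_vertex_cover_eq[OF C cover_K] by simp
  next
    case False
    then obtain v where v: "v \<in> K" "v \<notin> C" by blast
    have "neighbors E v \<subseteq> C"
      using C v(2) unfolding minimal_vertex_cover_def vertex_cover_iff[OF graph] neighbors_def by blast
    then show ?thesis using minimal_vertex_cover_eq[OF C cover_nbr[OF v(1)]] v(1) by blast
  qed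
  have "cover_ideal E = (ideal_generated (xpow ` expo ` (\<lambda>C x. of_bool (x \<in> C)) ` (neighbors E ` K \<union> {K})) :: ('v, 'k) mpoly set)"
    by (rule cover_ideal_eq) (use cover_nbr cover_K minimal in auto)
  moreover have "(\<lambda>C x. of_bool (x \<in> C) :: nat) ` (neighbors E ` K \<union> {K}) =
      (\<lambda>v x. of_bool (x \<in> neighbors E v)) ` K \<union> (\<lambda>b x. b * of_bool (x \<in> K)) ` {b \<in> UNIV. b = 1}"
    by (auto simp: image_image)
  moreover have "card (neighbors E v) \<le> card K" if "v \<notin> K" for v
    using indep that by (intro card_mono) (auto simp: neighbors_def)
  note bounds = max_degree_bounds[OF N_degree this]
  have "card (neighbors E v) \<le> max_degree UNIV E" if "v \<in> K" for v
    using bounds(1) that by blast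
  moreover have "card K \<le> max_degree UNIV E"
    using bounds(2) by (cases "K = {}") auto
  \<comment> \<open>For \<open>K = {}\<close> the graph has no edges: the empty cover gives the unit
    ideal, and both numbers are 0.\<close>
  moreover have "card K = max_degree UNIV E \<or> (\<exists>v\<in>K. card (neighbors E v) = max_degree UNIV E)"
  proof (cases "K = {}")
    case True
    then have "neighbors E = (\<lambda>_. {})" using indep by (auto simp: neighbors_def)
    then show ?thesis using True by (simp add: max_degree_def image_constant_conv)
  qed (use bounds(3) in blast)
  ultimately show ?thesis by (simp only: regularity_power)
qed

text \<open>As in the split case, a minimal cover that misses a vertex of \<open>K\<close> is its
  neighborhood; one that contains \<open>K\<close> adds a minimal cover of the cycle. For
  \<open>K = {}\<close> only the latter remain, which is the exceptional value.\<close>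

lemma regularity_cycle:
  fixes E :: "'v::finite set set"
  assumes graph: "simple_graph UNIV E"
    and clique: "\<And>x y. x \<in> K \<Longrightarrow> y \<in> K \<Longrightarrow> x \<noteq> y \<Longrightarrow> {x, y} \<in> E"
    and K: "K \<inter> {a, b, c, d, e} = {}" and dist: "distinct [a, b, c, d, e]"
    and complete: "\<And>v u. v \<in> K \<Longrightarrow> u \<in> {a, b, c, d, e} \<Longrightarrow> {v, u} \<in> E"
    and outside: "\<And>v u. v \<notin> K \<Longrightarrow> v \<notin> {a, b, c, d, e} \<Longrightarrow> u \<notin> K \<Longrightarrow> {v, u} \<notin> E"
    and C5: "{a, b} \<in> E" "{b, c} \<in> E" "{c, d} \<in> E" "{d, e} \<in> E" "{e, a} \<in> E"
      "{a, c} \<notin> E" "{a, d} \<notin> E" "{b, d} \<notin> E" "{b, e} \<notin> E" "{c, e} \<notin> E"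
  shows "regularity (ideal_power (cover_ideal E :: ('v, 'k::field) mpoly set) s) =
    (if K = {} then 3 * int s else int s * int (max_degree UNIV E))"
proof -
  have loop: "{a} \<notin> E" for a using graph by (force simp: simple_graph_def)
  have sym: "{x, y} \<in> E \<longleftrightarrow> {y, x} \<in> E" for x y by (simp add: insert_commute)
  let ?C = "{a, b, c, d, e}"
  have N_K: "neighbors E v \<inter> K = K - {v}" if "v \<in> K" for v
    using clique[OF that] loop by (auto simp: neighbors_def)
  have N: "{a, c, e, b, d} \<subseteq> neighbors E v" if "v \<in> K" for v
    using complete[OF that] by (auto simp: neighbors_def)
  \<comment> \<open>Going round the cycle in steps of two makes consecutive vertices nonadjacent, as
    the numbering of the covers requires.\<close>
  let ?n = "cycle_exponent K a c e b d"
  interpret cover_exponents K "neighbors E" UNIV cycle_weight ?n "cycle_colon_variables a c e b" "card K + 3"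
    by (rule cover_exponents_cycle[OF N_K N]) (use dist K in auto)
  let ?B = "{K \<union> {e, b, d}, K \<union> {b, d, a}, K \<union> {d, a, c}, K \<union> {a, c, e}, K \<union> {c, e, b}}"
  have edge_C: "x \<in> K \<or> y \<in> K \<or> (x \<in> ?C \<and> y \<in> ?C)" if "{x, y} \<in> E" for x y
    using outside[of x y] outside[of y x] that sym by blast
  have cover_nbr: "vertex_cover UNIV E (neighbors E v)" if v: "v \<in> K" for v
    unfolding vertex_cover_iff[OF graph]
  proof (intro allI impI)
    fix x y assume xy: "{x, y} \<in> E"
    then have yx: "{y, x} \<in> E" by (simp add: insert_commute)
    have "z = v \<or> z \<in> neighbors E v" if "z \<in> K" for z
      using clique[OF v that] by (auto simp: neighbors_def)
    moreover have "z \<in> neighbors E v" if "z \<in> ?C" for z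
      using complete[OF v that] by (simp add: neighbors_def)
    ultimately show "x \<in> neighbors E v \<or> y \<in> neighbors E v"
      using edge_C[OF xy] xy yx by (auto simp: neighbors_def)
  qed
  have cover_B: "vertex_cover UNIV E B" if B: "B \<in> ?B" for B
    unfolding vertex_cover_iff[OF graph]
  proof (intro allI impI)
    fix x y assume xy: "{x, y} \<in> E"
    show "x \<in> B \<or> y \<in> B"
    proof (cases "x \<in> K \<or> y \<in> K")
      case True
      then show ?thesis using B by auto
    next
      case False
      then have "x \<in> ?C" "y \<in> ?C" using edge_C[OF xy] by auto
      then show ?thesis using B xy C5(6-) loop sym by auto
    qed
  qed
  have minimal: "D \<in> neighbors E ` K \<union> ?B" if D: "minimal_vertex_cover UNIV E D" for D
  proof (cases "K \<subseteq> D")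
    case True
    have cov: "x \<in> D \<or> y \<in> D" if "{x, y} \<in> E" for x y
      using D that unfolding minimal_vertex_cover_def vertex_cover_iff[OF graph] by blast
    \<comment> \<open>Choosing an end of each of the five edges always includes the complement of
      some nonadjacent pair.\<close>
    have "{e, b, d} \<subseteq> D \<or> {b, d, a} \<subseteq> D \<or> {d, a, c} \<subseteq> D \<or> {a, c, e} \<subseteq> D \<or> {c, e, b} \<subseteq> D"
      using cov[OF C5(1)] cov[OF C5(2)] cov[OF C5(3)] cov[OF C5(4)] cov[OF C5(5)]
      by (elim disjE) simp_all
    then have "\<exists>B\<in>?B. B \<subseteq> D"
      using True by (elim disjE) (simp_all only: bex_simps Un_subset_iff simp_thms)
    then obtain B where B: "B \<in> ?B" "B \<subseteq> D" by (rule bexE)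
    then have "D = B" using minimal_vertex_cover_eq[OF D cover_B] by simp
    then show ?thesis using B(1) by (simp only: UnI2)
  next
    case False
    then obtain v where v: "v \<in> K" "v \<notin> D" by blast
    have "neighbors E v \<subseteq> D"
      using D v(2) unfolding minimal_vertex_cover_def vertex_cover_iff[OF graph] neighbors_def by blast
    then show ?thesis using minimal_vertex_cover_eq[OF D cover_nbr[OF v(1)]] v(1) by blast
  qed
  have ideal: "cover_ideal E = (ideal_generated (xpow ` expo ` (\<lambda>C x. of_bool (x \<in> C)) ` (neighbors E ` K \<union> ?B)) :: ('v, 'k) mpoly set)"
  proof (rule cover_ideal_eq)
    fix D assume "D \<in> neighbors E ` K \<union> ?B"
    then show "vertex_cover UNIV E D"
    proof
      assume "D \<in> neighbors E ` K"
      then obtain v where "v \<in> K" "D = neighbors E v" by (rule imageE)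
      then show ?thesis using cover_nbr by simp
    qed (rule cover_B)
  qed (rule minimal)
  have ind: "?n (1, 0, 0, 0, 0) = (\<lambda>x. of_bool (x \<in> K \<union> {e, b, d}))"
    "?n (0, 1, 0, 0, 0) = (\<lambda>x. of_bool (x \<in> K \<union> {b, d, a}))"
    "?n (0, 0, 1, 0, 0) = (\<lambda>x. of_bool (x \<in> K \<union> {d, a, c}))"
    "?n (0, 0, 0, 1, 0) = (\<lambda>x. of_bool (x \<in> K \<union> {a, c, e}))"
    "?n (0, 0, 0, 0, 1) = (\<lambda>x. of_bool (x \<in> K \<union> {c, e, b}))"
    using dist by (auto simp: fun_eq_iff)
  have gens: "(\<lambda>C x. of_bool (x \<in> C) :: nat) ` (neighbors E ` K \<union> ?B) =
      (\<lambda>v x. of_bool (x \<in> neighbors E v)) ` K \<union> ?n ` {b \<in> UNIV. cycle_weight b = 1}"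
    unfolding image_Un image_image by (simp only: UNIV_I simp_thms cycle_weight_one image_insert image_empty ind)
  show ?thesis
  proof (cases "K = {}")
    case True
    have "regularity (ideal_power (cover_ideal E :: ('v, 'k) mpoly set) s) = int s * int 3"
      unfolding ideal gens by (rule regularity_power) (use True in auto)
    then show ?thesis using True by simp
  next
    case False
    \<comment> \<open>A vertex of the cycle is adjacent to \<open>K\<close> and to two further
      vertices, any other vertex outside \<open>K\<close> at most to \<open>K\<close>. So the
      degrees outside \<open>K\<close> do not exceed the size of the covers of the second
      kind.\<close>
    have "card (neighbors E v) \<le> card K + 3" if v: "v \<notin> K" for v
    proof (cases "v \<in> ?C")
      case True
      have "\<exists>p q. neighbors E v \<subseteq> K \<union> {p, q}"
      proof -
        have sub: "neighbors E v \<subseteq> K \<union> ?C" using edge_C v True outside by (auto simp: neighbors_def sym)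
        \<comment> \<open>The five alternatives are \<open>v = a\<close> to \<open>v = e\<close> in
          turn: each lists the vertex itself and its two nonneighbors on the cycle.\<close>
        have "{v, a} \<notin> E \<and> {v, c} \<notin> E \<and> {v, d} \<notin> E \<or> {v, b} \<notin> E \<and> {v, d} \<notin> E \<and> {v, e} \<notin> E \<or>
            {v, c} \<notin> E \<and> {v, e} \<notin> E \<and> {v, a} \<notin> E \<or> {v, d} \<notin> E \<and> {v, a} \<notin> E \<and> {v, b} \<notin> E \<or>
            {v, e} \<notin> E \<and> {v, b} \<notin> E \<and> {v, c} \<notin> E"
          using True C5(6-) loop sym by auto
        then have "neighbors E v \<subseteq> K \<union> {b, e} \<or> neighbors E v \<subseteq> K \<union> {a, c} \<or> neighbors E v \<subseteq> K \<union> {b, d} \<or>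
            neighbors E v \<subseteq> K \<union> {c, e} \<or> neighbors E v \<subseteq> K \<union> {a, d}"
          using sub unfolding neighbors_def by blast
        then show ?thesis by blast
      qed
      then obtain p q where pq: "neighbors E v \<subseteq> K \<union> {p, q}" by blast
      have "card (neighbors E v) \<le> card (K \<union> {p, q})" using pq by (intro card_mono) auto
      also have "\<dots> \<le> card K + card {p, q}" by (rule card_Un_le)
      also have "card {p, q} \<le> 2" by (simp add: card_insert_if)
      finally show ?thesis by simp
    next
      case False
      then have "neighbors E v \<subseteq> K" using outside[OF v] by (auto simp: neighbors_def)
      then have "card (neighbors E v) \<le> card K" by (intro card_mono) auto
      then show ?thesis by simp
    qed
    note bounds = max_degree_bounds[OF N_degree this False]
    have "regularity (ideal_power (cover_ideal E :: ('v, 'k) mpoly set) s) = int s * int (max_degree UNIV E)"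
      unfolding ideal gens by (rule regularity_power) (use bounds in auto)
    then show ?thesis using False by simp
  qed
qed

theorem corollary3p8:
  fixes E :: "'v::finite set set" and s :: nat
  assumes "simple_graph UNIV E"
    and "C4_2K2_free UNIV E"
    and "s \<ge> 1"
  shows "regularity (ideal_power (cover_ideal E :: ('v, 'k::field) mpoly set) s) =
    (if C5_plus_isolated UNIV E then 3 * int s else int s * int (max_degree UNIV E))"
proof -
  interpret C4_2K2_free_relation "\<lambda>a b. {a, b} \<in> E"
    by (rule C4_2K2_free_relationI[OF assms(1,2)])
  show ?thesis
  proof (cases "\<exists>a b c d e. C5 a b c d e")
    case False
    then have "\<not> C5_plus_isolated UNIV E"
      unfolding C5_plus_isolated_iff[OF assms(1,2)] by blast
    moreover obtain K where K: "clique K" "\<And>x y. x \<notin> K \<Longrightarrow> y \<notin> K \<Longrightarrow> {x, y} \<notin> E"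
        "\<And>x. x \<in> K \<Longrightarrow> \<exists>y. y \<notin> K \<and> {x, y} \<in> E"
      using split_partition False by metis
    have "regularity (ideal_power (cover_ideal E :: ('v, 'k) mpoly set) s) = int s * int (max_degree UNIV E)"
      by (rule regularity_split[OF assms(1) _ K(2,3)]) (use K(1) in \<open>auto simp: clique_def\<close>)
    ultimately show ?thesis by simp
  next
    case True
    then obtain a b c d e where C5: "C5 a b c d e" by blast
    obtain K where K: "K \<inter> {a, b, c, d, e} = {}" "clique K"
        "\<And>v u. v \<in> K \<Longrightarrow> u \<in> {a, b, c, d, e} \<Longrightarrow> {v, u} \<in> E"
        "\<And>v u. v \<notin> K \<Longrightarrow> v \<notin> {a, b, c, d, e} \<Longrightarrow> u \<notin> K \<Longrightarrow> {v, u} \<notin> E"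
      by (rule C5_partition[OF C5]) blast
    \<comment> \<open>The 5-cycle provided by \<open>C5_plus_isolated\<close> may differ from the
      fixed one, so the argument counts: a vertex of \<open>K\<close> together with the fixed cycle
      would give six vertices that have neighbors.\<close>
    have "C5_plus_isolated UNIV E \<longleftrightarrow> K = {}"
    proof
      assume "C5_plus_isolated UNIV E"
      then obtain a' b' c' d' e' where iso: "\<forall>v. v \<notin> {a', b', c', d', e'} \<longrightarrow> neighbors E v = {}"
        unfolding C5_plus_isolated_iff[OF assms(1,2)] by blast
      show "K = {}"
      proof (rule ccontr)
        assume "K \<noteq> {}"
        then obtain v where v: "v \<in> K" by blast
        have "neighbors E u \<noteq> {}" if "u \<in> insert v {a, b, c, d, e}" for u
          using that K(3)[OF v, of u] K(3)[OF v, of a] by (auto simp: neighbors_def insert_commute)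
        then have "insert v {a, b, c, d, e} \<subseteq> {a', b', c', d', e'}" using iso by blast
        then have "card (insert v {a, b, c, d, e}) \<le> card {a', b', c', d', e'}"
          by (intro card_mono) auto
        moreover have "distinct [v, a, b, c, d, e]"
          using C5_distinct[OF C5] v K(1) by auto
        from distinct_card[OF this] have "card (insert v {a, b, c, d, e}) = 6" by simp
        moreover have "card {a', b', c', d', e'} \<le> 5"
          using card_length[of "[a', b', c', d', e']"] by simp
        ultimately show False by simp
      qed
    next
      assume "K = {}"
      then have "\<forall>v. v \<notin> {a, b, c, d, e} \<longrightarrow> neighbors E v = {}"
        using K(4) by (auto simp: neighbors_def)
      then show "C5_plus_isolated UNIV E"
        unfolding C5_plus_isolated_iff[OF assms(1,2)] using C5 by blast
    qed
    moreover have "regularity (ideal_power (cover_ideal E :: ('v, 'k) mpoly set) s) =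
        (if K = {} then 3 * int s else int s * int (max_degree UNIV E))"
      by (rule regularity_cycle[OF assms(1) _ K(1) C5_distinct[OF C5] K(3,4)])
        (use K(2) C5 in \<open>auto simp: clique_def C5_def\<close>)
    ultimately show ?thesis by simp
  qed
qed

end
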